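(* Let $n\ge 1$ be an integer. For all $1\le u,v\le\infty$, one has $$A_n(u,v)=\max\Bigl\{\frac{2n-1}{v},\ 1-\frac1u,\ 1+\frac{2n-1}{v}-\frac{2n}{u}\Bigr\},$$ where $A_n(u,v)$ is the smallest non-negative real number, independent of the field size $q$, for which there exists a constant $C_{n,u,v}>0$ (independent of $q$) with $$\|\mathcal{M}_{\mathbb{H}_n}F\|_{\ell^v(\mathbb{P}^{2n-1}(\mathbb{F}_q))}\le C_{n,u,v}\, q^{A_n(u,v)}\,\|F\|_{\ell^u(\mathbb{H}_n(\mathbb{F}_q))}$$ for all odd prime powers $q$ and all $F:\mathbb{H}_n(\mathbb{F}_q)\to\mathbb{C}$.
   Context: Throughout, $q$ ranges over odd prime powers and $\mathbb{F}_q$ is the field with $q$ elements. The Heisenberg group $\mathbb{H}_n(\mathbb{F}_q)$ is the set $\mathbb{F}_q^n\times\mathbb{F}_q^n\times\mathbb{F}_q$ with group law $(\mathbf{x},\mathbf{y},t)\cdot(\mathbf{x}',\mathbf{y}',t')=(\mathbf{x}+\mathbf{x}',\,\mathbf{y}+\mathbf{y}',\,t+t'+(\mathbf{x}\cdot\mathbf{y}'-\mathbf{y}\cdot\mathbf{x}'))$, where $\mathbf{x}\cdot\mathbf{y}'$ is the standard dot product. A horizontal direction is an element $[\mathbf{v}]\in\mathbb{P}^{2n-1}(\mathbb{F}_q)$ represented by $\mathbf{v}=(\mathbf{a},\mathbf{b})\in\mathbb{F}_q^n\times\mathbb{F}_q^n$, $\mathbf{v}\ne\mathbf{0}$. For $\mathbf{p}=(\mathbf{x}_0,\mathbf{y}_0,t_0)$,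 the horizontal line through $\mathbf{p}$ in direction $[\mathbf{v}]$ is $L_{\mathbf{p},[\mathbf{v}]}=\{\mathbf{p}\cdot(s\mathbf{a},s\mathbf{b},0):s\in\mathbb{F}_q\}=\{(\mathbf{x}_0+s\mathbf{a},\,\mathbf{y}_0+s\mathbf{b},\,t_0+s(\mathbf{x}_0\cdot\mathbf{b}-\mathbf{y}_0\cdot\mathbf{a})):s\in\mathbb{F}_q\}$. For $F:\mathbb{H}_n(\mathbb{F}_q)\to\mathbb{C}$ the maximal operator (with sums, not averages) is $$\mathcal{M}_{\mathbb{H}_n}F([\mathbf{v}]):=\max_{\mathbf{p}\in\mathbb{H}_n(\mathbb{F}_q)}\sum_{\mathbf{x}\in L_{\mathbf{p},[\mathbf{v}]}}|F(\mathbf{x})|,\qquad[\mathbf{v}]\in\mathbb{P}^{2n-1}(\mathbb{F}_q).$$ For a finite set $X$, $\ell^p(X)$ is the space of complex-valued functions on $X$ with the $\ell^p$-norm with respect to counting measure. Convention: $1/\infty=0$. *)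

theory Defs
  imports
    "HOL-Algebra.Ring"
    "HOL-Number_Theory.Prime_Powers"
    "HOL-Library.Extended_Nonnegative_Real"
begin

subsection \<open>Coordinate vectors over a field\<close>

text \<open>Vectors of length \<open>n\<close> are functions on \<open>{..<n}\<close>, extended by \<open>undefined\<close> outside,
  so that there are exactly \<open>q ^ n\<close> of them over a field with \<open>q\<close> elements.\<close>

definition vecs :: "('a, 'm) ring_scheme \<Rightarrow> nat \<Rightarrow> (nat \<Rightarrow> 'a) set"
  where "vecs R n = {..<n} \<rightarrow>\<^sub>E carrier R"

definition vec_zero :: "('a, 'm) ring_scheme \<Rightarrow> nat \<Rightarrow> nat \<Rightarrow> 'a"
  where "vec_zero R n = (\<lambda>i\<in>{..<n}. \<zero>\<^bsub>R\<^esub>)"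

definition vec_add :: "('a, 'm) ring_scheme \<Rightarrow> nat \<Rightarrow> (nat \<Rightarrow> 'a) \<Rightarrow> (nat \<Rightarrow> 'a) \<Rightarrow> nat \<Rightarrow> 'a"
  where "vec_add R n x y = (\<lambda>i\<in>{..<n}. x i \<oplus>\<^bsub>R\<^esub> y i)"

definition vec_smult :: "('a, 'm) ring_scheme \<Rightarrow> nat \<Rightarrow> 'a \<Rightarrow> (nat \<Rightarrow> 'a) \<Rightarrow> nat \<Rightarrow> 'a"
  where "vec_smult R n c x = (\<lambda>i\<in>{..<n}. c \<otimes>\<^bsub>R\<^esub> x i)"

definition vec_dot :: "('a, 'm) ring_scheme \<Rightarrow> nat \<Rightarrow> (nat \<Rightarrow> 'a) \<Rightarrow> (nat \<Rightarrow> 'a) \<Rightarrow> 'a"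
  where "vec_dot R n x y = (\<Oplus>\<^bsub>R\<^esub>i\<in>{..<n}. x i \<otimes>\<^bsub>R\<^esub> y i)"

subsection \<open>The Heisenberg group\<close>

type_synonym 'a heis = "(nat \<Rightarrow> 'a) \<times> (nat \<Rightarrow> 'a) \<times> 'a"

definition heisenberg :: "('a, 'm) ring_scheme \<Rightarrow> nat \<Rightarrow> 'a heis monoid"
  where "heisenberg R n =
    \<lparr>carrier = vecs R n \<times> vecs R n \<times> carrier R,
     monoid.mult = (\<lambda>(x, y, t) (x', y', t').
       (vec_add R n x x', vec_add R n y y',
        t \<oplus>\<^bsub>R\<^esub> t' \<oplus>\<^bsub>R\<^esub> (vec_dot R n x y' \<ominus>\<^bsub>R\<^esub> vec_dot R n y x'))),
     monoid.one = (vec_zero R n, vec_zero R n, \<zero>\<^bsub>R\<^esub>)\<rparr>"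

subsection \<open>Horizontal directions and horizontal lines\<close>

definition nonzero_vecs :: "('a, 'm) ring_scheme \<Rightarrow> nat \<Rightarrow> ((nat \<Rightarrow> 'a) \<times> (nat \<Rightarrow> 'a)) set"
  where "nonzero_vecs R n = vecs R n \<times> vecs R n - {(vec_zero R n, vec_zero R n)}"

definition proportional ::
    "('a, 'm) ring_scheme \<Rightarrow> nat \<Rightarrow> ((nat \<Rightarrow> 'a) \<times> (nat \<Rightarrow> 'a)) rel"
  where "proportional R n =
    {((a, b), (a', b')). (a, b) \<in> nonzero_vecs R n \<and> (a', b') \<in> nonzero_vecs R n \<and>
       (\<exists>c\<in>carrier R - {\<zero>\<^bsub>R\<^esub>}. a' = vec_smult R n c a \<and> b' = vec_smult R n c b)}"

definition directions ::
    "('a, 'm) ring_scheme \<Rightarrow> nat \<Rightarrow> ((nat \<Rightarrow> 'a) \<times> (nat \<Rightarrow> 'a)) set set"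
  where "directions R n = nonzero_vecs R n // proportional R n"

definition line_through ::
    "('a, 'm) ring_scheme \<Rightarrow> nat \<Rightarrow> 'a heis \<Rightarrow> (nat \<Rightarrow> 'a) \<times> (nat \<Rightarrow> 'a) \<Rightarrow> 'a heis set"
  where "line_through R n p v =
    {p \<otimes>\<^bsub>heisenberg R n\<^esub> (vec_smult R n s (fst v), vec_smult R n s (snd v), \<zero>\<^bsub>R\<^esub>) |s. s \<in> carrier R}"

text \<open>All representatives of a direction give the same line (see
  \<open>horizontal_line_representative\<close> below), so the union merely avoids choosing one.\<close>

definition horizontal_line ::
    "('a, 'm) ring_scheme \<Rightarrow> nat \<Rightarrow> 'a heis \<Rightarrow> ((nat \<Rightarrow> 'a) \<times> (nat \<Rightarrow> 'a)) set \<Rightarrow> 'a heis set"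
  where "horizontal_line R n p D = (\<Union>v\<in>D. line_through R n p v)"

lemma vec_smult_assoc:
  assumes "field R" and "s \<in> carrier R" and "c \<in> carrier R" and "x \<in> vecs R n"
  shows "vec_smult R n s (vec_smult R n c x) = vec_smult R n (s \<otimes>\<^bsub>R\<^esub> c) x"
proof -
  interpret field R by fact
  have "x i \<in> carrier R" if "i < n" for i
    using assms(4) that by (auto simp: vecs_def)
  then show ?thesis
    using assms(2,3) by (auto simp: vec_smult_def m_assoc intro!: restrict_ext)
qed

lemma vec_smult_one:
  assumes "field R" and "x \<in> vecs R n"
  shows "vec_smult R n \<one>\<^bsub>R\<^esub> x = x"
proof -
  interpret field R by fact
  have "x i \<in> carrier R" if "i < n" for i
    using assms(2) that by (auto simp: vecs_def)
  then have "vec_smult R n \<one>\<^bsub>R\<^esub> x = restrict x {..<n}"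
    unfolding vec_smult_def by (intro restrict_ext) simp
  then show ?thesis
    using assms(2) by (simp add: vecs_def PiE_restrict)
qed

lemma line_through_scale_subset:
  assumes "field R" and "c \<in> carrier R" and "a \<in> vecs R n" and "b \<in> vecs R n"
  shows "line_through R n p (vec_smult R n c a, vec_smult R n c b) \<subseteq> line_through R n p (a, b)"
proof
  interpret field R by fact
  fix z
  assume "z \<in> line_through R n p (vec_smult R n c a, vec_smult R n c b)"
  then obtain s where s: "s \<in> carrier R" and
    "z = p \<otimes>\<^bsub>heisenberg R n\<^esub> (vec_smult R n s (vec_smult R n c a),
           vec_smult R n s (vec_smult R n c b), \<zero>\<^bsub>R\<^esub>)"
    unfolding line_through_def fst_conv snd_conv by blast
  then have "z = p \<otimes>\<^bsub>heisenberg R n\<^esub> (vec_smult R n (s \<otimes>\<^bsub>R\<^esub> c) a,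
           vec_smult R n (s \<otimes>\<^bsub>R\<^esub> c) b, \<zero>\<^bsub>R\<^esub>)"
    using vec_smult_assoc[OF assms(1) s assms(2)] assms(3,4) by metis
  moreover have "s \<otimes>\<^bsub>R\<^esub> c \<in> carrier R"
    using s assms(2) by (rule m_closed)
  ultimately show "z \<in> line_through R n p (a, b)"
    unfolding line_through_def fst_conv snd_conv by blast
qed

lemma line_through_proportional:
  assumes "field R" and "(v, w) \<in> proportional R n"
  shows "line_through R n p w = line_through R n p v"
proof -
  interpret field R by fact
  obtain a b where v: "v = (a, b)" by (cases v)
  obtain a' b' where w: "w = (a', b')" by (cases w)
  have ab: "a \<in> vecs R n" "b \<in> vecs R n" "a' \<in> vecs R n" "b' \<in> vecs R n"
    using assms(2) unfolding v w proportional_def nonzero_vecs_def by blast+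
  obtain c where c: "c \<in> carrier R" "c \<noteq> \<zero>\<^bsub>R\<^esub>"
      "a' = vec_smult R n c a" "b' = vec_smult R n c b"
    using assms(2) unfolding v w proportional_def by blast
  then have "c \<in> Units R"
    by (simp add: field_Units)
  then have i: "inv\<^bsub>R\<^esub> c \<in> carrier R" "inv\<^bsub>R\<^esub> c \<otimes>\<^bsub>R\<^esub> c = \<one>\<^bsub>R\<^esub>"
    by (rule Units_inv_closed, rule Units_l_inv)
  have cancel: "vec_smult R n (inv\<^bsub>R\<^esub> c) (vec_smult R n c x) = x" if "x \<in> vecs R n" for x
    using vec_smult_assoc[OF assms(1) i(1) c(1) that] vec_smult_one[OF assms(1) that]
    unfolding i(2) by (rule trans)
  have "line_through R n p w \<subseteq> line_through R n p v"
    using line_through_scale_subset[OF assms(1) c(1) ab(1,2)] unfolding v w c(3,4) .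
  moreover have "line_through R n p v \<subseteq> line_through R n p w"
    using line_through_scale_subset[OF assms(1) i(1) ab(3,4)]
    unfolding v w c(3,4) cancel[OF ab(1)] cancel[OF ab(2)] .
  ultimately show ?thesis by blast
qed

lemma horizontal_line_representative:
  assumes "field R" and "v \<in> nonzero_vecs R n"
  shows "horizontal_line R n p (proportional R n `` {v}) = line_through R n p v"
proof -
  interpret field R by fact
  obtain a b where v: "v = (a, b)" by (cases v)
  have "a \<in> vecs R n" "b \<in> vecs R n"
    using assms(2) unfolding v nonzero_vecs_def by blast+
  then have "a = vec_smult R n \<one>\<^bsub>R\<^esub> a" "b = vec_smult R n \<one>\<^bsub>R\<^esub> b"
    using vec_smult_one[OF assms(1)] by metis+
  moreover have "\<one>\<^bsub>R\<^esub> \<in> carrier R - {\<zero>\<^bsub>R\<^esub>}"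
    by simp
  ultimately have "(v, v) \<in> proportional R n"
    using assms(2) unfolding v proportional_def by blast
  then show ?thesis
    using line_through_proportional[OF assms(1)] unfolding horizontal_line_def by blast
qed

subsection \<open>The maximal operator and its exponent\<close>

definition maximal_op ::
    "('a, 'm) ring_scheme \<Rightarrow> nat \<Rightarrow> ('a heis \<Rightarrow> complex) \<Rightarrow> ((nat \<Rightarrow> 'a) \<times> (nat \<Rightarrow> 'a)) set \<Rightarrow> real"
  where "maximal_op R n F D =
    Max ((\<lambda>p. \<Sum>x\<in>horizontal_line R n p D. norm (F x)) ` carrier (heisenberg R n))"

text \<open>The counting-measure norm on a finite nonempty set \<open>S\<close>, for an exponent in \<open>[1, \<infinity>]\<close>.\<close>

definition lp_norm :: "ennreal \<Rightarrow> 'x set \<Rightarrow> ('x \<Rightarrow> 'b::real_normed_vector) \<Rightarrow> real"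
  where "lp_norm p S f =
    (if p = \<infinity> then Max ((\<lambda>x. norm (f x)) ` S)
     else (\<Sum>x\<in>S. norm (f x) powr enn2real p) powr (1 / enn2real p))"

text \<open>Every finite field is isomorphic to one whose carrier is a set of integers, so nothing
  is lost by letting \<open>R\<close> range over the rings on subsets of \<^typ>\<open>int\<close>; this keeps the
  quantification over all fields inside the scope of the constant \<open>C\<close>.\<close>

definition admissible_exponent :: "nat \<Rightarrow> ennreal \<Rightarrow> ennreal \<Rightarrow> real \<Rightarrow> bool"
  where "admissible_exponent n u v A \<longleftrightarrow>
    0 \<le> A \<and>
    (\<exists>C>0. \<forall>(q::nat) (R::int ring) (F::int heis \<Rightarrow> complex).
       primepow q \<and> odd q \<and> field R \<and> card (carrier R) = q \<longrightarrow>
       lp_norm v (directions R n) (maximal_op R n F)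
         \<le> C * real q powr A * lp_norm u (carrier (heisenberg R n)) F)"

definition optimal_exponent :: "nat \<Rightarrow> ennreal \<Rightarrow> ennreal \<Rightarrow> real"
  where "optimal_exponent n u v = (LEAST A. admissible_exponent n u v A)"

text \<open>The reciprocal of an exponent, with \<open>1 / \<infinity> = 0\<close>.\<close>

definition recip :: "ennreal \<Rightarrow> real"
  where "recip p = enn2real (1 / p)"

end

theory Submission
  imports
    Defs
    "HOL-Algebra.Multiplicative_Group"
    "HOL-Algebra.Product_Groups"
    "HOL-Number_Theory.Residues"
    "HOL-Computational_Algebra.Polynomial"
begin

text \<open>
  Upper bound: with \<open>N = 2 n\<close> and \<open>f (x, y) = sup\<^sub>t |F (x, y, t)|\<close>, horizontal lines project to lines of
  \<open>K\<^sup>N\<close>, so everything reduces to the Kakeya maximal function on \<open>K\<^sup>N\<close>, whose strong type \<open>(N, N)\<close> bound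
  with exponent \<open>(N - 1) / N\<close> implies all others by Hoelder's inequality.

  The strong type bound uses the polynomial method with multiplicities. For integer-valued \<open>g\<close>, the
  polynomials that vanish to order \<open>g x\<close> at every \<open>x\<close> have codimension at most \<open>\<Sum>\<^sub>x g x ^ N\<close>. If such a
  polynomial has degree \<open>e\<close>, its leading form vanishes to order about \<open>(N - 1) e / q\<close> at each direction whose
  line has \<open>g\<close>-mass more than \<open>N e\<close>. Vanishing to that order at all directions forces a form of degree
  \<open>e\<close> to be zero, so by averaging over translations (codimension is submodular) vanishing on a fraction
  \<open>\<delta>\<close> of the directions costs at least \<open>\<delta>\<close> times the dimension, which is of order \<open>e ^ (N - 1)\<close>.
  Summation over \<open>e\<close> gives the bound with no logarithmic loss.

  Lower bound: a point, a line, and the union \<open>K\<^sup>N \<times> {0}\<close> of all horizontal lines through the origin.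
\<close>

subsection \<open>Hasse derivatives\<close>

text \<open>Multiplicities are forced by the shape of the inequality: a polynomial that merely
  vanishes on the support of \<open>g\<close> sees nothing of its size, whereas vanishing to order
  \<open>g x\<close> costs at most \<open>g x ^ N\<close> conditions, the summand on the right-hand
  side. A dyadic treatment of the line masses would handle each level with its own polynomial and
  add the losses. Here one space of polynomials of degree at most \<open>D\<close> serves all
  levels: it is filtered by degree, its piece of degree \<open>e\<close> records the directions of
  mass above \<open>N * e\<close>, and so the codimensions of all levels together are paid for by
  the single total \<open>\<Sum> g ^ N\<close>. The obstacle is a set of directions of small
  density, for which a direct zero count gives no conclusion; averaging over translates makes the
  cost linear in the density. Dimension is replaced throughout by the logarithm of cardinality, so
  that rank-nullity and submodularity become counting in finite groups. Hasse derivatives are used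
  because ordinary derivatives of high order vanish identically in positive characteristic.\<close>

definition hasse_mon :: "'i set \<Rightarrow> ('i \<Rightarrow> nat) \<Rightarrow> ('i \<Rightarrow> nat) \<Rightarrow> ('i \<Rightarrow> 'a::comm_ring_1) \<Rightarrow> 'a"
  where "hasse_mon J \<alpha> \<beta> x = (\<Prod>i\<in>J. of_nat (\<alpha> i choose \<beta> i) * x i ^ (\<alpha> i - \<beta> i))"

text \<open>Binomial theorem for the power of \<open>x + z\<close>, combined with
  \<open>choose_mult\<close>. The limit \<open>d\<close> is common to all exponents
  \<open>a\<close>, so that the sums for different coordinates multiply out over one index set;
  surplus terms have a vanishing binomial coefficient.\<close>

lemma binomial_shift:
  fixes x z :: "'a::comm_ring_1"
  assumes "a \<le> d"
  shows "of_nat (a choose b) * (x + z) ^ (a - b) =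
    (\<Sum>g\<le>d. (of_nat (b + g choose b) * z ^ g) * (of_nat (a choose (b + g)) * x ^ (a - (b + g))))"
proof (cases "b \<le> a")
  case True
  have "of_nat (a choose b) * (x + z) ^ (a - b) =
      (\<Sum>g\<le>a - b. of_nat (a choose b) * (of_nat (a - b choose g) * z ^ g * x ^ (a - b - g)))"
    by (subst add.commute, subst binomial_ring) (simp add: sum_distrib_left)
  also have "\<dots> = (\<Sum>g\<le>a - b. (of_nat (b + g choose b) * z ^ g) *
      (of_nat (a choose (b + g)) * x ^ (a - (b + g))))"
  proof (rule sum.cong)
    fix g assume "g \<in> {..a - b}"
    then have "(a choose (b + g)) * (b + g choose b) = (a choose b) * (a - b choose g)"
      using choose_mult[of b "b + g" a] True by simp
    then have "(of_nat (a choose (b + g)) * of_nat (b + g choose b) :: 'a) =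
        of_nat (a choose b) * of_nat (a - b choose g)"
      by (metis of_nat_mult)
    then show "of_nat (a choose b) * (of_nat (a - b choose g) * z ^ g * x ^ (a - b - g)) =
        (of_nat (b + g choose b) * z ^ g) * (of_nat (a choose (b + g)) * x ^ (a - (b + g)))"
      by (simp add: mult_ac) (metis mult.assoc)
  qed simp
  also have "\<dots> = (\<Sum>g\<le>d. (of_nat (b + g choose b) * z ^ g) *
      (of_nat (a choose (b + g)) * x ^ (a - (b + g))))"
    using assms True by (intro sum.mono_neutral_left) (auto simp: binomial_eq_0 less_diff_conv2 not_le)
  finally show ?thesis .
qed (simp add: binomial_eq_0)

text \<open>Taylor's formula, by multiplying out \<open>binomial_shift\<close> over the coordinates;
  no factorial has to be inverted.\<close>

lemma hasse_mon_add:
  assumes "finite J" and "\<And>i. i \<in> J \<Longrightarrow> \<alpha> i \<le> d"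
  shows "hasse_mon J \<alpha> \<beta> (\<lambda>i. x i + z i) =
    (\<Sum>\<gamma>\<in>J \<rightarrow>\<^sub>E {..d}. (\<Prod>i\<in>J. of_nat (\<beta> i + \<gamma> i choose \<beta> i) * z i ^ \<gamma> i) *
       hasse_mon J \<alpha> (\<lambda>i. \<beta> i + \<gamma> i) x)"
proof -
  have "hasse_mon J \<alpha> \<beta> (\<lambda>i. x i + z i) = (\<Prod>i\<in>J. \<Sum>g\<le>d. (of_nat (\<beta> i + g choose \<beta> i) * z i ^ g) *
      (of_nat (\<alpha> i choose (\<beta> i + g)) * x i ^ (\<alpha> i - (\<beta> i + g))))"
    unfolding hasse_mon_def by (intro prod.cong refl binomial_shift assms(2))
  also have "\<dots> = (\<Sum>\<gamma>\<in>J \<rightarrow>\<^sub>E {..d}. \<Prod>i\<in>J. (of_nat (\<beta> i + \<gamma> i choose \<beta> i) * z i ^ \<gamma> i) *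
      (of_nat (\<alpha> i choose (\<beta> i + \<gamma> i)) * x i ^ (\<alpha> i - (\<beta> i + \<gamma> i))))"
    using assms(1) by (intro prod_sum_PiE) auto
  also have "\<dots> = (\<Sum>\<gamma>\<in>J \<rightarrow>\<^sub>E {..d}. (\<Prod>i\<in>J. of_nat (\<beta> i + \<gamma> i choose \<beta> i) * z i ^ \<gamma> i) *
       hasse_mon J \<alpha> (\<lambda>i. \<beta> i + \<gamma> i) x)"
    unfolding hasse_mon_def prod.distrib by (simp only: )
  finally show ?thesis .
qed

text \<open>A polynomial is a set \<open>A\<close> of exponents with coefficients \<open>c\<close>,
  over any commutative ring. Taking a ring of univariate polynomials turns evaluation at a point
  into restriction to a line.\<close>

definition hasse :: "'i set \<Rightarrow> ('i \<Rightarrow> nat) set \<Rightarrow> (('i \<Rightarrow> nat) \<Rightarrow> 'a) \<Rightarrow> ('i \<Rightarrow> nat) \<Rightarrow>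
    ('i \<Rightarrow> 'a::comm_ring_1) \<Rightarrow> 'a"
  where "hasse J A c \<beta> x = (\<Sum>\<alpha>\<in>A. c \<alpha> * hasse_mon J \<alpha> \<beta> x)"

lemma hasse_add:
  assumes "finite J" and "\<And>\<alpha> i. \<alpha> \<in> A \<Longrightarrow> i \<in> J \<Longrightarrow> \<alpha> i \<le> d"
  shows "hasse J A c \<beta> (\<lambda>i. x i + z i) =
    (\<Sum>\<gamma>\<in>J \<rightarrow>\<^sub>E {..d}. (\<Prod>i\<in>J. of_nat (\<beta> i + \<gamma> i choose \<beta> i) * z i ^ \<gamma> i) *
       hasse J A c (\<lambda>i. \<beta> i + \<gamma> i) x)"
proof -
  have "hasse J A c \<beta> (\<lambda>i. x i + z i) = (\<Sum>\<alpha>\<in>A. \<Sum>\<gamma>\<in>J \<rightarrow>\<^sub>E {..d}. c \<alpha> *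
      ((\<Prod>i\<in>J. of_nat (\<beta> i + \<gamma> i choose \<beta> i) * z i ^ \<gamma> i) * hasse_mon J \<alpha> (\<lambda>i. \<beta> i + \<gamma> i) x))"
    unfolding hasse_def sum_distrib_left[symmetric]
    by (intro sum.cong refl arg_cong2[where f="(*)"] hasse_mon_add assms)
  then show ?thesis
    unfolding hasse_def sum_distrib_left
    by (subst sum.swap) (simp only: mult.left_commute)
qed

definition multi_indices :: "'i set \<Rightarrow> nat \<Rightarrow> ('i \<Rightarrow> nat) set"
  where "multi_indices J d = {\<alpha> \<in> J \<rightarrow>\<^sub>E UNIV. sum \<alpha> J \<le> d}"

lemma multi_indices_le:
  assumes "finite J" "\<alpha> \<in> multi_indices J d" "i \<in> J"
  shows "\<alpha> i \<le> d"
proof -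
  have "\<alpha> i \<le> sum \<alpha> J" by (rule member_le_sum) (use assms in auto)
  also have "\<dots> \<le> d" using assms by (simp add: multi_indices_def)
  finally show ?thesis .
qed

lemma finite_multi_indices: "finite J \<Longrightarrow> finite (multi_indices J d)"
  by (rule finite_subset[of _ "J \<rightarrow>\<^sub>E {..d}"])
     (auto simp: multi_indices_le finite_PiE intro!: PiE_I, auto simp: multi_indices_def)

section \<open>Taylor coefficients of univariate polynomials\<close>

lemma pcompose_conv_sum:
  fixes p :: "'a::comm_ring_1 poly"
  assumes "degree p \<le> d"
  shows "pcompose p q = (\<Sum>j\<le>d. smult (coeff p j) (q ^ j))"
proof -
  have "p = (\<Sum>j\<le>d. monom (coeff p j) j)"
    using poly_as_sum_of_monoms'[OF assms] by simp
  then have "pcompose p q = (\<Sum>j\<le>d. pcompose (monom (coeff p j) j) q)"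
    using pcompose_sum by metis
  moreover have "pcompose (monom a j) q = smult a (q ^ j)" for a j
    by (induction j) (simp_all add: monom_0 monom_Suc pcompose_pCons)
  ultimately show ?thesis by simp
qed

lemma coeff_pcompose_linear:
  fixes p :: "'a::comm_ring_1 poly"
  assumes "degree p \<le> d"
  shows "coeff (pcompose p [:a, b:]) e =
    (\<Sum>j\<le>d. coeff p j * (of_nat (j choose e) * b ^ e * a ^ (j - e)))"
proof -
  have pw: "coeff ([:a, b:] ^ j) e = of_nat (j choose e) * b ^ e * a ^ (j - e)" for j
  proof (cases "e \<le> j")
    case True
    then show ?thesis by (rule coeff_linear_poly_power)
  next
    case False
    have "degree ([:a, b:] ^ j) \<le> degree [:a, b:] * j" by (rule degree_power_le)
    also have "\<dots> \<le> j" by simp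
    finally show ?thesis using False by (simp add: coeff_eq_0 binomial_eq_0)
  qed
  have "pcompose p [:a, b:] = (\<Sum>j\<le>d. smult (coeff p j) ([:a, b:] ^ j))"
    using assms by (rule pcompose_conv_sum)
  then show ?thesis by (simp add: coeff_sum pw)
qed

subsection \<open>Vanishing orders over a field presented as a quotient\<close>

text \<open>The field is presented as a quotient of a type-class ring, so that polynomial arithmetic over it is
  type-class arithmetic modulo a maximal ideal. For finite fields the ring of integer polynomials,
  evaluated at a generator of the multiplicative group, is such a ring (\<open>finite_field_cover\<close> below).\<close>

locale field_cover = field R for R :: "('b, 'm) ring_scheme" (structure) +
  fixes \<phi> :: "'s::comm_ring_1 \<Rightarrow> 'b"
  assumes cover_add: "\<phi> (x + y) = \<phi> x \<oplus> \<phi> y"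
    and cover_mult: "\<phi> (x * y) = \<phi> x \<otimes> \<phi> y"
    and cover_one: "\<phi> 1 = \<one>"
    and cover_range: "range \<phi> = carrier R"
    and finite_carrier: "finite (carrier R)"
begin

lemma cover_closed [simp, intro]: "\<phi> x \<in> carrier R"
  using cover_range by blast

lemma cover_zero [simp]: "\<phi> 0 = \<zero>"
proof -
  have "\<phi> 0 \<oplus> \<phi> 0 = \<phi> 0"
    using cover_add[of 0 0] by simp
  then show ?thesis
    by (metis a_assoc cover_closed a_inv_closed r_neg r_zero)
qed

lemma cover_uminus: "\<phi> (- x) = \<ominus> \<phi> x"
  using cover_add[of "- x" x] by (intro sum_zero_eq_neg) auto

lemma cover_diff: "\<phi> (x - y) = \<phi> x \<ominus> \<phi> y"
  using cover_add[of x "- y"] by (simp add: cover_uminus minus_eq)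

lemma cover_diff_eq_zero: "\<phi> (x - y) = \<zero> \<longleftrightarrow> \<phi> x = \<phi> y"
  by (simp add: cover_diff)

lemma cover_mult_eq_zero: "\<phi> (x * y) = \<zero> \<longleftrightarrow> \<phi> x = \<zero> \<or> \<phi> y = \<zero>"
  by (simp add: cover_mult integral_iff)

lemma cover_sum_cong:
  "(\<And>a. a \<in> A \<Longrightarrow> \<phi> (f a) = \<phi> (g a)) \<Longrightarrow> \<phi> (sum f A) = \<phi> (sum g A)"
  by (induction A rule: infinite_finite_induct) (auto simp: cover_add)

lemma cover_sum_zero: "(\<And>a. a \<in> A \<Longrightarrow> \<phi> (f a) = \<zero>) \<Longrightarrow> \<phi> (sum f A) = \<zero>"
  using cover_sum_cong[of A f "\<lambda>_. 0"] by simp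

lemma cover_prod_cong:
  "(\<And>a. a \<in> A \<Longrightarrow> \<phi> (f a) = \<phi> (g a)) \<Longrightarrow> \<phi> (prod f A) = \<phi> (prod g A)"
  by (induction A rule: infinite_finite_induct) (auto simp: cover_mult)

lemma cover_power_cong: "\<phi> x = \<phi> y \<Longrightarrow> \<phi> (x ^ k) = \<phi> (y ^ k)"
  by (induction k) (auto simp: cover_mult)

lemma cover_mult_cong: "\<phi> x = \<phi> y \<Longrightarrow> \<phi> z = \<phi> w \<Longrightarrow> \<phi> (x * z) = \<phi> (y * w)"
  by (simp add: cover_mult)

text \<open>An arbitrary section of \<open>\<phi>\<close>, in general neither additive nor
  multiplicative; hence identities are stated after applying \<open>\<phi>\<close>.\<close>

definition lift :: "'b \<Rightarrow> 's"
  where "lift = inv_into UNIV \<phi>"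

lemma cover_lift [simp]: "a \<in> carrier R \<Longrightarrow> \<phi> (lift a) = a"
  unfolding lift_def by (rule f_inv_into_f) (simp add: cover_range)

lemma hasse_mon_cong:
  assumes "\<And>i. i \<in> J \<Longrightarrow> \<phi> (x i) = \<phi> (y i)"
  shows "\<phi> (hasse_mon J \<alpha> \<beta> x) = \<phi> (hasse_mon J \<alpha> \<beta> y)"
  unfolding hasse_mon_def by (intro cover_prod_cong cover_mult_cong cover_power_cong assms refl)

lemma hasse_cong:
  assumes "\<And>\<alpha>. \<alpha> \<in> A \<Longrightarrow> \<phi> (c \<alpha>) = \<phi> (c' \<alpha>)" and "\<And>i. i \<in> J \<Longrightarrow> \<phi> (x i) = \<phi> (y i)"
  shows "\<phi> (hasse J A c \<beta> x) = \<phi> (hasse J A c' \<beta> y)"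
  unfolding hasse_def by (intro cover_sum_cong cover_mult_cong hasse_mon_cong assms)

text \<open>The order of vanishing is read off the Taylor coefficients modulo the kernel of
  \<open>\<phi>\<close>; divisibility by a power of \<open>[:- a, 1:]\<close> over \<open>'s\<close>
  itself would be too strong.\<close>

definition vanishes :: "'s poly \<Rightarrow> 's \<Rightarrow> nat \<Rightarrow> bool"
  where "vanishes p a m \<longleftrightarrow> (\<forall>e<m. \<phi> (coeff (pcompose p [:a, 1:]) e) = \<zero>)"

text \<open>Expanded at \<open>a\<close>, the linear factor is the variable and shifts coefficients
  by one. Expanded at \<open>b\<close> it is \<open>[:b - a, 1:]\<close>, whose constant term is
  invertible under \<open>\<phi>\<close>, so the coefficients of \<open>p'\<close> vanish one after
  another.\<close>

lemma vanishes_factor: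
  assumes p: "p = [:- a, 1:] * p' + [:c:]" and c: "\<phi> c = \<zero>"
  shows "vanishes p a m \<Longrightarrow> vanishes p' a (m - 1)"
    and "vanishes p b m \<Longrightarrow> \<phi> b \<noteq> \<phi> a \<Longrightarrow> vanishes p' b m"
proof -
  have shift: "pcompose p [:b, 1:] = [:b - a, 1:] * pcompose p' [:b, 1:] + [:c:]" for b
  proof -
    have "pcompose [:- a, 1:] [:b, 1:] = [:b - a, 1:]" by (simp add: pcompose_pCons)
    then show ?thesis unfolding p pcompose_add pcompose_mult by simp
  qed
  show "vanishes p' a (m - 1)" if "vanishes p a m"
    unfolding vanishes_def
  proof (intro allI impI)
    fix e assume "e < m - 1"
    then have "\<phi> (coeff (pcompose p [:a, 1:]) (Suc e)) = \<zero>"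
      using that unfolding vanishes_def by auto
    then show "\<phi> (coeff (pcompose p' [:a, 1:]) e) = \<zero>"
      by (simp add: shift)
  qed
  show "vanishes p' b m" if v: "vanishes p b m" and ne: "\<phi> b \<noteq> \<phi> a"
    unfolding vanishes_def
  proof (intro allI impI)
    fix e assume "e < m"
    then show "\<phi> (coeff (pcompose p' [:b, 1:]) e) = \<zero>"
    proof (induction e)
      case 0
      then have "\<phi> (coeff (pcompose p [:b, 1:]) 0) = \<zero>"
        using v unfolding vanishes_def by blast
      then have "\<phi> ((b - a) * coeff (pcompose p' [:b, 1:]) 0) = \<zero>"
        by (simp add: shift cover_add c)
      then show ?case using ne by (simp add: cover_mult_eq_zero cover_diff_eq_zero)
    next
      case (Suc e)
      then have "\<phi> (coeff (pcompose p [:b, 1:]) (Suc e)) = \<zero>"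
        using v unfolding vanishes_def by blast
      then have "\<phi> ((b - a) * coeff (pcompose p' [:b, 1:]) (Suc e)) = \<zero>"
        using Suc by (simp add: shift cover_add c)
      then show ?case using ne by (simp add: cover_mult_eq_zero cover_diff_eq_zero)
    qed
  qed
qed

text \<open>The bound on roots counted with multiplicity, in a form that survives reduction:
  \<open>degree p\<close> is the degree over \<open>'s\<close>, which may exceed that of the image.
  Each step splits off one linear factor and lowers one multiplicity by one.\<close>

lemma vanishes_imp_null:
  assumes "finite A" "inj_on \<phi> A"
  shows "(\<And>a. a \<in> A \<Longrightarrow> vanishes p a (m a)) \<Longrightarrow> degree p < sum m A \<Longrightarrow> \<phi> (coeff p e) = \<zero>"
proof (induction "degree p" arbitrary: p m e rule: less_induct)
  case (less p m e)
  obtain a where a: "a \<in> A" "m a > 0"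
    using less.prems(2) assms(1) by (metis not_gr_zero not_less_zero sum.neutral)
  define p' where "p' = synthetic_div p a"
  define c where "c = poly p a"
  have p: "p = [:- a, 1:] * p' + [:c:]"
    unfolding p'_def c_def by (rule synthetic_div_correct'[symmetric])
  have "\<phi> (coeff (pcompose p [:a, 1:]) 0) = \<zero>"
    using less.prems(1)[OF a(1)] a(2) unfolding vanishes_def by blast
  moreover have "coeff (pcompose p [:a, 1:]) 0 = c"
    by (simp add: p pcompose_add pcompose_mult pcompose_pCons)
  ultimately have c: "\<phi> c = \<zero>" by simp
  have "\<phi> (coeff p' e) = \<zero>" for e
  proof (cases "degree p = 0")
    case True
    then have "p' = 0" unfolding p'_def by (simp only: synthetic_div_eq_0_iff)
    then show ?thesis by simp
  next
    case False
    define m' where "m' = m(a := m a - 1)"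
    have deg: "degree p' = degree p - 1"
      unfolding p'_def by (rule degree_synthetic_div)
    have "sum m A = m a + sum m (A - {a})"
      using assms(1) a(1) by (rule sum.remove)
    moreover have "sum m' A = m' a + sum m' (A - {a})"
      using assms(1) a(1) by (rule sum.remove)
    moreover have "sum m' (A - {a}) = sum m (A - {a})"
      by (rule sum.cong) (auto simp: m'_def)
    ultimately have "degree p' < sum m' A"
      using less.prems(2) a(2) False deg by (simp add: m'_def)
    moreover have "vanishes p' b (m' b)" if "b \<in> A" for b
    proof (cases "b = a")
      case True
      then show ?thesis
        using vanishes_factor(1)[OF p c less.prems(1)[OF a(1)]] by (simp add: m'_def)
    next
      case False
      then have "\<phi> b \<noteq> \<phi> a" using assms(2) a(1) that by (auto dest: inj_onD)
      then show ?thesis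
        using vanishes_factor(2)[OF p c less.prems(1)[OF that]] False by (simp add: m'_def)
    qed
    ultimately show ?thesis
      using less.hyps[of p' m'] deg False by simp
  qed
  then show ?case
    by (subst p) (cases e; simp add: cover_diff_eq_zero cover_mult c)
qed

text \<open>Induction on the variables. With orders and point fixed in all coordinates but one,
  there remains a univariate polynomial of degree below \<open>B\<close> that vanishes to order
  \<open>k\<close> at every field element, hence is null. Its coefficients are derivatives of
  polynomials in the remaining variables.\<close>

lemma box_vanishing:
  assumes "finite J" and "B \<le> k * card (carrier R)"
  shows "(\<And>w \<beta>. (\<And>i. i \<in> J \<Longrightarrow> \<beta> i < k) \<Longrightarrow> \<phi> (hasse J (J \<rightarrow>\<^sub>E {..<B}) b \<beta> w) = \<zero>) \<Longrightarrow>
    \<gamma> \<in> J \<rightarrow>\<^sub>E {..<B} \<Longrightarrow> \<phi> (b \<gamma>) = \<zero>"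
  using assms(1)
proof (induction J arbitrary: b \<gamma> rule: finite_induct)
  case empty
  then show ?case
    by (auto simp: hasse_def hasse_mon_def)
next
  case (insert i J)
  \<comment> \<open>The coefficient of the \<open>j\<close>-th power of the variable
    \<open>i\<close>, as a polynomial in the others.\<close>
  define c where "c j \<gamma>' = b (\<gamma>'(i := j))" for j \<gamma>'
  have split: "hasse (insert i J) (insert i J \<rightarrow>\<^sub>E {..<B}) b \<beta> w =
      (\<Sum>j<B. hasse J (J \<rightarrow>\<^sub>E {..<B}) (c j) \<beta> w * (of_nat (j choose \<beta> i) * w i ^ (j - \<beta> i)))" for \<beta> w
  proof -
    have "hasse (insert i J) (insert i J \<rightarrow>\<^sub>E {..<B}) b \<beta> w =
        (\<Sum>(j, \<gamma>')\<in>{..<B} \<times> (J \<rightarrow>\<^sub>E {..<B}).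
          b (\<gamma>'(i := j)) * hasse_mon (insert i J) (\<gamma>'(i := j)) \<beta> w)"
      unfolding hasse_def PiE_insert_eq
      by (subst sum.reindex[OF inj_combinator[OF insert(2)]]) (simp add: case_prod_unfold)
    also have "\<dots> = (\<Sum>j<B. \<Sum>\<gamma>'\<in>J \<rightarrow>\<^sub>E {..<B}.
          b (\<gamma>'(i := j)) * hasse_mon (insert i J) (\<gamma>'(i := j)) \<beta> w)"
      by (rule sum.cartesian_product[symmetric])
    also have "\<dots> = (\<Sum>j<B. \<Sum>\<gamma>'\<in>J \<rightarrow>\<^sub>E {..<B}.
          c j \<gamma>' * (hasse_mon J \<gamma>' \<beta> w * (of_nat (j choose \<beta> i) * w i ^ (j - \<beta> i))))"
    proof (intro sum.cong refl arg_cong2[where f="(*)"])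
      fix j \<gamma>'
      have "hasse_mon J (\<gamma>'(i := j)) \<beta> w = hasse_mon J \<gamma>' \<beta> w"
        using insert(2) unfolding hasse_mon_def by (intro prod.cong) auto
      then show "hasse_mon (insert i J) (\<gamma>'(i := j)) \<beta> w =
          hasse_mon J \<gamma>' \<beta> w * (of_nat (j choose \<beta> i) * w i ^ (j - \<beta> i))"
        using insert(1,2) by (simp add: hasse_mon_def mult.commute)
    qed (simp add: c_def)
    finally show ?thesis
      by (simp add: hasse_def sum_distrib_right mult.assoc)
  qed
  have null: "\<phi> (hasse J (J \<rightarrow>\<^sub>E {..<B}) (c j) \<beta> w) = \<zero>"
    if \<beta>: "\<And>i. i \<in> J \<Longrightarrow> \<beta> i < k" and j: "j < B" for j \<beta> w
  proof -
    define p where "p = (\<Sum>j<B. monom (hasse J (J \<rightarrow>\<^sub>E {..<B}) (c j) \<beta> w) j)"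
    have coeff_p: "coeff p j = (if j < B then hasse J (J \<rightarrow>\<^sub>E {..<B}) (c j) \<beta> w else 0)" for j
      unfolding p_def by (simp add: coeff_sum)
    have deg: "degree p \<le> B - 1"
      by (rule degree_le) (use j in \<open>auto simp: coeff_p\<close>)
    have "vanishes p a k" for a
      unfolding vanishes_def
    proof (intro allI impI)
      fix e assume e: "e < k"
      have J: "hasse J A b' (\<beta>(i := e)) (w(i := a)) = hasse J A b' \<beta> w" for A b'
        using insert(2) unfolding hasse_def hasse_mon_def
        by (intro sum.cong refl arg_cong2[where f="(*)"] prod.cong) auto
      have "coeff (pcompose p [:a, 1:]) e =
          (\<Sum>j\<le>B - 1. coeff p j * (of_nat (j choose e) * 1 ^ e * a ^ (j - e)))"
        by (rule coeff_pcompose_linear[OF deg])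
      also have "\<dots> = (\<Sum>j<B. hasse J (J \<rightarrow>\<^sub>E {..<B}) (c j) \<beta> w * (of_nat (j choose e) * a ^ (j - e)))"
        using j by (intro sum.cong) (auto simp: coeff_p)
      also have "\<dots> = hasse (insert i J) (insert i J \<rightarrow>\<^sub>E {..<B}) b (\<beta>(i := e)) (w(i := a))"
        by (simp add: split J)
      finally show "\<phi> (coeff (pcompose p [:a, 1:]) e) = \<zero>"
        using \<beta> e by (simp only:) (rule insert.prems(1), auto)
    qed
    moreover have "inj_on lift (carrier R)"
      by (metis cover_lift inj_onI)
    moreover have "inj_on \<phi> (lift ` carrier R)"
      by (auto intro!: inj_onI)
    moreover have "degree p < (\<Sum>a\<in>lift ` carrier R. k)"
      using deg j assms(2) by (simp add: card_image[OF \<open>inj_on lift (carrier R)\<close>] mult.commute)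
    ultimately have "\<phi> (coeff p j) = \<zero>"
      using finite_carrier by (intro vanishes_imp_null[where m="\<lambda>_. k"]) auto
    then show ?thesis using j by (simp add: coeff_p)
  qed
  have "\<gamma> i < B" "\<gamma>(i := undefined) \<in> J \<rightarrow>\<^sub>E {..<B}"
    using insert.prems(2) insert(2) by (auto simp: PiE_iff extensional_def)
  then have "\<phi> (c (\<gamma> i) (\<gamma>(i := undefined))) = \<zero>"
    using insert.IH[of "c (\<gamma> i)"] null by blast
  then show ?case by (simp add: c_def)
qed

end

section \<open>Leading coefficients and restriction to a line\<close>

text \<open>The coefficient at a degree bound is multiplicative even in the presence of zero
  divisors, where true degrees need not add.\<close>

lemma coeff_mult_top:
  fixes p q :: "'a::comm_ring_1 poly"
  assumes "degree p \<le> a" "degree q \<le> b"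
  shows "coeff (p * q) (a + b) = coeff p a * coeff q b"
proof -
  have "coeff (p * q) (a + b) = (\<Sum>i\<le>a + b. coeff p i * coeff q (a + b - i))"
    by (rule coeff_mult)
  also have "\<dots> = (\<Sum>i\<in>{a}. coeff p i * coeff q (a + b - i))"
  proof (rule sum.mono_neutral_right)
    show "\<forall>i\<in>{..a + b} - {a}. coeff p i * coeff q (a + b - i) = 0"
    proof
      fix i assume i: "i \<in> {..a + b} - {a}"
      show "coeff p i * coeff q (a + b - i) = 0"
      proof (cases "i < a")
        case True
        then have "coeff q (a + b - i) = 0" using assms by (intro coeff_eq_0) auto
        then show ?thesis by simp
      next
        case False
        then have "coeff p i = 0" using i assms by (intro coeff_eq_0) auto
        then show ?thesis by simp
      qed
    qed
  qed auto
  finally show ?thesis by simp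
qed

lemma coeff_prod_top:
  fixes p :: "'i \<Rightarrow> 'a::comm_ring_1 poly"
  assumes "finite I" "\<And>i. i \<in> I \<Longrightarrow> degree (p i) \<le> e i"
  shows "degree (prod p I) \<le> sum e I \<and> coeff (prod p I) (sum e I) = (\<Prod>i\<in>I. coeff (p i) (e i))"
  using assms
proof (induction I rule: finite_induct)
  case (insert i I)
  then have *: "degree (p i) \<le> e i" "degree (prod p I) \<le> sum e I"
      "coeff (prod p I) (sum e I) = (\<Prod>i\<in>I. coeff (p i) (e i))"
    by auto
  have "degree (p i * prod p I) \<le> degree (p i) + degree (prod p I)"
    by (rule degree_mult_le)
  with * have "degree (p i * prod p I) \<le> e i + sum e I" by linarith
  moreover have "coeff (p i * prod p I) (e i + sum e I) = coeff (p i) (e i) * (\<Prod>i\<in>I. coeff (p i) (e i))"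
    using *(3) by (simp add: coeff_mult_top[OF *(1,2)])
  ultimately show ?case
    using insert.hyps by simp
qed auto

lemma hasse_mon_eq_0: "finite J \<Longrightarrow> i \<in> J \<Longrightarrow> \<alpha> i < \<beta> i \<Longrightarrow> hasse_mon J \<alpha> \<beta> x = 0"
  unfolding hasse_mon_def by (rule prod_zero) (auto simp: binomial_eq_0 intro!: bexI[of _ i])

text \<open>Only the slopes \<open>\<omega> i\<close> reach the top formal degree, so the base point
  \<open>x\<close> drops out: this is how data on a line yield a derivative at its
  direction.\<close>

lemma hasse_mon_line:
  fixes x \<omega> :: "'i \<Rightarrow> 'a::comm_ring_1"
  assumes "finite J" "\<And>i. i \<in> J \<Longrightarrow> \<beta> i \<le> \<alpha> i"
  shows "degree (hasse_mon J \<alpha> \<beta> (\<lambda>i. [:x i, \<omega> i:])) \<le> sum \<alpha> J - sum \<beta> J"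
    and "coeff (hasse_mon J \<alpha> \<beta> (\<lambda>i. [:x i, \<omega> i:])) (sum \<alpha> J - sum \<beta> J) = hasse_mon J \<alpha> \<beta> \<omega>"
proof -
  have s: "sum \<alpha> J - sum \<beta> J = (\<Sum>i\<in>J. \<alpha> i - \<beta> i)"
    using assms(2) by (simp add: sum_subtractf_nat)
  have deg: "degree (of_nat m * [:a, b:] ^ k) \<le> k" for m k and a b :: 'a
  proof -
    have "degree (of_nat m * [:a, b:] ^ k) \<le> degree (of_nat m :: 'a poly) + degree ([:a, b:] ^ k)"
      by (rule degree_mult_le)
    also have "\<dots> \<le> 0 + degree [:a, b:] * k"
      by (intro add_mono degree_power_le) simp
    also have "\<dots> \<le> k" using mult_le_mono1[of "degree [:a, b:]" 1 k] by simp
    finally show ?thesis .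
  qed
  have co: "coeff (of_nat m * [:a, b:] ^ k) k = of_nat m * b ^ k" for m k and a b :: 'a
    by (simp add: of_nat_poly coeff_linear_poly_power)
  show "degree (hasse_mon J \<alpha> \<beta> (\<lambda>i. [:x i, \<omega> i:])) \<le> sum \<alpha> J - sum \<beta> J"
    and "coeff (hasse_mon J \<alpha> \<beta> (\<lambda>i. [:x i, \<omega> i:])) (sum \<alpha> J - sum \<beta> J) = hasse_mon J \<alpha> \<beta> \<omega>"
    using coeff_prod_top[OF assms(1), of "\<lambda>i. of_nat (\<alpha> i choose \<beta> i) * [:x i, \<omega> i:] ^ (\<alpha> i - \<beta> i)"
      "\<lambda>i. \<alpha> i - \<beta> i"] deg
    unfolding s hasse_mon_def co by auto
qed

lemma pcompose_hasse_mon: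
  fixes q :: "'a::comm_ring_1 poly"
  shows "pcompose (hasse_mon J \<alpha> \<beta> x) q = hasse_mon J \<alpha> \<beta> (\<lambda>i. pcompose (x i) q)"
proof -
  have "pcompose (p ^ k) q = pcompose p q ^ k" for p :: "'a poly" and k
    by (induction k) (simp_all add: pcompose_mult pcompose_1)
  then show ?thesis
    unfolding hasse_mon_def pcompose_prod by (simp add: pcompose_mult of_nat_poly pcompose_smult)
qed

lemma hasse_const:
  fixes c :: "('i \<Rightarrow> nat) \<Rightarrow> 'a::comm_ring_1"
  shows "hasse J A (\<lambda>\<alpha>. [:c \<alpha>:]) \<beta> (\<lambda>i. [:x i:]) = [:hasse J A c \<beta> x:]"
proof -
  have power: "[:a:] ^ k = [:a ^ k:]" for a :: 'a and k
    by (induction k) (auto simp: one_pCons mult.commute)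
  have prod: "(\<Prod>i\<in>J. [:f i:]) = [:\<Prod>i\<in>J. f i:]" for f :: "'i \<Rightarrow> 'a"
    by (induction J rule: infinite_finite_induct) (auto simp: one_pCons mult.commute)
  have sum: "(\<Sum>i\<in>A. [:f i:]) = [:\<Sum>i\<in>A. f i:]" for f :: "('i \<Rightarrow> nat) \<Rightarrow> 'a"
    by (induction A rule: infinite_finite_induct) auto
  have "hasse_mon J \<alpha> \<beta> (\<lambda>i. [:x i:]) = [:hasse_mon J \<alpha> \<beta> x:]" for \<alpha>
    unfolding hasse_mon_def prod[symmetric]
    by (intro prod.cong refl) (simp add: power of_nat_poly)
  then show ?thesis
    unfolding hasse_def sum[symmetric] by (simp add: mult.commute)
qed

context field_cover
begin

text \<open>The restriction is \<open>hasse\<close> evaluated at the generic point of the line. Its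
  Taylor coefficient of degree \<open>e\<close> at \<open>s\<close> combines Hasse derivatives of
  order \<open>sum \<beta> J + e\<close>, so differentiating costs at most
  \<open>sum \<beta> J\<close> orders of vanishing.\<close>

lemma line_restriction_vanishes:
  assumes fin: "finite J" and van: "\<And>\<gamma>. sum \<gamma> J < m \<Longrightarrow> \<phi> (hasse J A c \<gamma> (\<lambda>i. x i + s * \<omega> i)) = \<zero>"
    and A: "A \<subseteq> multi_indices J d"
  shows "vanishes (hasse J A (\<lambda>\<alpha>. [:c \<alpha>:]) \<beta> (\<lambda>i. [:x i, \<omega> i:])) s (m - sum \<beta> J)"
  unfolding vanishes_def
proof (intro allI impI)
  fix e assume e: "e < m - sum \<beta> J"
  define X where "X = (\<lambda>i. x i + s * \<omega> i)"
  have "pcompose (hasse J A (\<lambda>\<alpha>. [:c \<alpha>:]) \<beta> (\<lambda>i. [:x i, \<omega> i:])) [:s, 1:] =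
      hasse J A (\<lambda>\<alpha>. [:c \<alpha>:]) \<beta> (\<lambda>i. [:X i:] + [:0, \<omega> i:])"
    unfolding hasse_def
    by (simp add: pcompose_sum pcompose_mult pcompose_hasse_mon pcompose_pCons X_def pcompose_smult mult.commute)
  also have "\<dots> = (\<Sum>\<gamma>\<in>J \<rightarrow>\<^sub>E {..d}. (\<Prod>i\<in>J. of_nat (\<beta> i + \<gamma> i choose \<beta> i) * [:0, \<omega> i:] ^ \<gamma> i) *
       [:hasse J A c (\<lambda>i. \<beta> i + \<gamma> i) X:])"
    by (subst hasse_add[OF fin, where d=d]) (use A multi_indices_le[OF fin] in \<open>auto simp: hasse_const\<close>)
  also have "\<dots> = (\<Sum>\<gamma>\<in>J \<rightarrow>\<^sub>E {..d}. monom ((\<Prod>i\<in>J. of_nat (\<beta> i + \<gamma> i choose \<beta> i) * \<omega> i ^ \<gamma> i) *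
       hasse J A c (\<lambda>i. \<beta> i + \<gamma> i) X) (sum \<gamma> J))"
  proof (intro sum.cong refl)
    fix \<gamma>
    have pw: "[:0, a:] ^ k = monom (a ^ k) k" for a :: 's and k
    proof -
      have "[:0, a:] = monom a 1" by (simp add: monom_Suc monom_0)
      then have "[:0, a:] ^ k = monom (a ^ k) (1 * k)" by (metis monom_power)
      then show ?thesis by (metis mult_1)
    qed
    have "(\<Prod>i\<in>J. of_nat (\<beta> i + \<gamma> i choose \<beta> i) * [:0, \<omega> i:] ^ \<gamma> i) =
        (\<Prod>i\<in>J. monom (of_nat (\<beta> i + \<gamma> i choose \<beta> i) * \<omega> i ^ \<gamma> i) (\<gamma> i))"
      by (simp add: pw of_nat_poly smult_monom)
    also have "\<dots> = monom (\<Prod>i\<in>J. of_nat (\<beta> i + \<gamma> i choose \<beta> i) * \<omega> i ^ \<gamma> i) (sum \<gamma> J)"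
      using fin by (induction J rule: finite_induct) (auto simp: mult_monom one_pCons monom_0)
    finally show "(\<Prod>i\<in>J. of_nat (\<beta> i + \<gamma> i choose \<beta> i) * [:0, \<omega> i:] ^ \<gamma> i) *
       [:hasse J A c (\<lambda>i. \<beta> i + \<gamma> i) X:] =
       monom ((\<Prod>i\<in>J. of_nat (\<beta> i + \<gamma> i choose \<beta> i) * \<omega> i ^ \<gamma> i) * hasse J A c (\<lambda>i. \<beta> i + \<gamma> i) X) (sum \<gamma> J)"
      by (simp add: smult_monom mult.commute)
  qed
  finally have eq: "pcompose (hasse J A (\<lambda>\<alpha>. [:c \<alpha>:]) \<beta> (\<lambda>i. [:x i, \<omega> i:])) [:s, 1:] = \<dots>" .
  show "\<phi> (coeff (pcompose (hasse J A (\<lambda>\<alpha>. [:c \<alpha>:]) \<beta> (\<lambda>i. [:x i, \<omega> i:])) [:s, 1:]) e) = \<zero>"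
    unfolding eq coeff_sum
  proof (intro cover_sum_zero)
    fix \<gamma>
    have "\<phi> (hasse J A c (\<lambda>i. \<beta> i + \<gamma> i) X) = \<zero>" if "sum \<gamma> J = e"
      using van[of "\<lambda>i. \<beta> i + \<gamma> i"] e that by (simp add: sum.distrib X_def)
    then show "\<phi> (coeff (monom ((\<Prod>i\<in>J. of_nat (\<beta> i + \<gamma> i choose \<beta> i) * \<omega> i ^ \<gamma> i) *
       hasse J A c (\<lambda>i. \<beta> i + \<gamma> i) X) (sum \<gamma> J)) e) = \<zero>"
      by (simp add: cover_mult)
  qed
qed

text \<open>Zero count on the line: a derivative of order \<open>j = sum \<beta> J\<close> restricts
  to degree at most \<open>d - j\<close>, with zeros of total order at least
  \<open>sum m S - card S * j\<close>. Since \<open>j \<le> k - 1\<close>, hypothesis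
  \<open>m\<close> makes the latter larger, so the restriction is null under \<open>\<phi>\<close>.
  Its coefficient of degree \<open>d - j\<close> is the derivative of the top form at
  \<open>\<omega>\<close>.\<close>

lemma top_form_vanishes:
  assumes fin: "finite J" "finite S" and inj: "inj_on \<phi> S"
    and van: "\<And>s \<gamma>. s \<in> S \<Longrightarrow> sum \<gamma> J < m s \<Longrightarrow>
        \<phi> (hasse J (multi_indices J d) c \<gamma> (\<lambda>i. x i + s * \<omega> i)) = \<zero>"
    and m: "d + card S * (k - 1) < sum m S" and \<beta>: "sum \<beta> J < k"
  shows "\<phi> (hasse J {\<alpha> \<in> multi_indices J d. sum \<alpha> J = d} c \<beta> \<omega>) = \<zero>"
proof (cases "sum \<beta> J \<le> d")
  case True
  let ?A = "multi_indices J d"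
  define p where "p = hasse J ?A (\<lambda>\<alpha>. [:c \<alpha>:]) \<beta> (\<lambda>i. [:x i, \<omega> i:])"
  define j where "j = sum \<beta> J"
  have p_sum: "p = (\<Sum>\<alpha>\<in>?A. smult (c \<alpha>) (hasse_mon J \<alpha> \<beta> (\<lambda>i. [:x i, \<omega> i:])))"
    by (simp add: p_def hasse_def)
  have deg1: "degree (hasse_mon J \<alpha> \<beta> (\<lambda>i. [:x i, \<omega> i:])) \<le> sum \<alpha> J - j" for \<alpha>
  proof (cases "\<forall>i\<in>J. \<beta> i \<le> \<alpha> i")
    case True
    then show ?thesis unfolding j_def by (intro hasse_mon_line(1)[OF fin(1)]) simp
  next
    case False
    then obtain i where "i \<in> J" "\<alpha> i < \<beta> i" by (auto simp: not_le)
    then show ?thesis by (simp add: hasse_mon_eq_0[OF fin(1)])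
  qed
  have deg: "degree p \<le> d - j"
    unfolding p_sum
  proof (rule degree_sum_le)
    fix \<alpha> assume "\<alpha> \<in> ?A"
    then have "sum \<alpha> J - j \<le> d - j" by (auto simp: multi_indices_def)
    then show "degree (smult (c \<alpha>) (hasse_mon J \<alpha> \<beta> (\<lambda>i. [:x i, \<omega> i:]))) \<le> d - j"
      using deg1[of \<alpha>] degree_smult_le[of "c \<alpha>" "hasse_mon J \<alpha> \<beta> (\<lambda>i. [:x i, \<omega> i:])"] by linarith
  qed (rule finite_multi_indices[OF fin(1)])
  have "vanishes p s (m s - j)" if "s \<in> S" for s
    unfolding p_def j_def using van[OF that] fin(1) by (intro line_restriction_vanishes) auto
  moreover have "degree p < (\<Sum>s\<in>S. m s - j)"
  proof -
    \<comment> \<open>Points with \<open>m s < j\<close> count as zero in the truncated difference,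
      which only enlarges the sum.\<close>
    have "sum m S \<le> (\<Sum>s\<in>S. (m s - j) + j)" by (rule sum_mono) simp
    also have "\<dots> = (\<Sum>s\<in>S. m s - j) + card S * j" by (simp add: sum.distrib)
    also have "card S * j \<le> card S * (k - 1)" using \<beta> unfolding j_def by (intro mult_le_mono) auto
    finally show ?thesis using m deg by linarith
  qed
  ultimately have "\<phi> (coeff p (d - j)) = \<zero>"
    using vanishes_imp_null[OF fin(2) inj, of p "\<lambda>s. m s - j"] by blast
  moreover have "coeff p (d - j) = (\<Sum>\<alpha>\<in>?A. if sum \<alpha> J = d then c \<alpha> * hasse_mon J \<alpha> \<beta> \<omega> else 0)"
    unfolding p_sum coeff_sum
  proof (intro sum.cong refl)
    fix \<alpha> assume "\<alpha> \<in> ?A"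
    then have le: "sum \<alpha> J \<le> d" by (simp add: multi_indices_def)
    show "coeff (smult (c \<alpha>) (hasse_mon J \<alpha> \<beta> (\<lambda>i. [:x i, \<omega> i:]))) (d - j) =
        (if sum \<alpha> J = d then c \<alpha> * hasse_mon J \<alpha> \<beta> \<omega> else 0)"
    proof (cases "\<forall>i\<in>J. \<beta> i \<le> \<alpha> i")
      case T: True
      then have "j \<le> sum \<alpha> J" unfolding j_def by (intro sum_mono) auto
      then have "sum \<alpha> J \<noteq> d \<Longrightarrow> degree (hasse_mon J \<alpha> \<beta> (\<lambda>i. [:x i, \<omega> i:])) < d - j"
        using deg1[of \<alpha>] le by linarith
      then show ?thesis
        using hasse_mon_line(2)[OF fin(1), of \<beta> \<alpha> x \<omega>] T by (auto simp: coeff_eq_0 j_def)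
    next
      case False
      then obtain i where "i \<in> J" "\<alpha> i < \<beta> i" by (auto simp: not_le)
      then show ?thesis by (simp add: hasse_mon_eq_0[OF fin(1), of i \<alpha> \<beta>])
    qed
  qed
  ultimately show ?thesis
    using finite_multi_indices[OF fin(1)] by (simp add: hasse_def sum.inter_filter)
next
  case False
  have "hasse_mon J \<alpha> \<beta> \<omega> = 0" if "sum \<alpha> J = d" for \<alpha>
  proof -
    have "\<not> (\<forall>i\<in>J. \<beta> i \<le> \<alpha> i)"
      using False that sum_mono[of J \<beta> \<alpha>] by auto
    then obtain i where "i \<in> J" "\<alpha> i < \<beta> i" by (auto simp: not_le)
    then show ?thesis by (rule hasse_mon_eq_0[OF fin(1)])
  qed
  then show ?thesis by (simp add: hasse_def)
qed

end

subsection \<open>The rank of vanishing conditions\<close>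

lemma card_le_fibres:
  assumes "finite A" "finite W" "f ` A \<subseteq> W" "\<And>w. w \<in> W \<Longrightarrow> card {x \<in> A. f x = w} \<le> k"
  shows "card A \<le> card W * k"
proof -
  have "A = (\<Union>w\<in>W. {x \<in> A. f x = w})"
    using assms(3) by auto
  then have "card A \<le> (\<Sum>w\<in>W. card {x \<in> A. f x = w})"
    using card_UN_le[OF assms(2)] by metis
  also have "\<dots> \<le> (\<Sum>w\<in>W. k)"
    using assms(4) by (intro sum_mono)
  finally show ?thesis by simp
qed

text \<open>Rank-nullity by counting: dividing a fibre of \<open>L\<close> by one of its elements
  embeds it in \<open>K\<close>. The condition on quotients is what a homomorphism with kernel in
  \<open>K\<close> provides.\<close>

lemma (in group) card_le_kernel:
  assumes "finite H" "H \<subseteq> carrier G" "finite W" "L ` H \<subseteq> W" "finite K"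
    and "\<And>x y. x \<in> H \<Longrightarrow> y \<in> H \<Longrightarrow> L x = L y \<Longrightarrow> x \<otimes> inv y \<in> K"
  shows "card H \<le> card W * card K"
proof (rule card_le_fibres[where f=L])
  fix w
  show "card {x \<in> H. L x = w} \<le> card K"
  proof (cases "{x \<in> H. L x = w} = {}")
    case False
    then obtain y where y: "y \<in> H" "L y = w" by auto
    have "inj_on (\<lambda>x. x \<otimes> inv y) {x \<in> H. L x = w}"
      using assms(2) y by (intro inj_onI) (auto simp: subset_iff)
    moreover have "(\<lambda>x. x \<otimes> inv y) ` {x \<in> H. L x = w} \<subseteq> K"
      using assms(6) y by auto
    ultimately show ?thesis
      using assms(5) by (rule card_inj_on_le)
  qed (simp only: card.empty)
qed (use assms in auto)

text \<open>Multiplication maps \<open>X \<times> (Y \<inter> Z)\<close> into \<open>Y\<close>. From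
  \<open>x \<otimes> z = x0 \<otimes> z0\<close> follows
  \<open>inv x0 \<otimes> x = z0 \<otimes> inv z\<close>, an element of both \<open>X\<close> and
  \<open>Z\<close>, so each fibre embeds in \<open>X \<inter> Z\<close>.\<close>

lemma (in group) card_subgroup_submodular:
  assumes "finite (carrier G)" "subgroup X G" "subgroup Y G" "subgroup Z G" "X \<subseteq> Y"
  shows "card X * card (Y \<inter> Z) \<le> card Y * card (X \<inter> Z)"
proof -
  have c: "x \<in> carrier G" if "x \<in> X \<or> x \<in> Y \<or> x \<in> Z" for x
    using that assms(2-4) subgroup.mem_carrier by metis
  have fin: "finite X" "finite Y" "finite Z"
    using assms(1) c by (auto intro: finite_subset)
  have "card (X \<times> (Y \<inter> Z)) \<le> card Y * card (X \<inter> Z)"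
  proof (rule card_le_fibres[where f="\<lambda>(x, z). x \<otimes> z"])
    show "(\<lambda>(x, z). x \<otimes> z) ` (X \<times> (Y \<inter> Z)) \<subseteq> Y"
      using assms(5) subgroup.m_closed[OF assms(3)] by auto
    fix y
    let ?F = "{p \<in> X \<times> (Y \<inter> Z). (case p of (x, z) \<Rightarrow> x \<otimes> z) = y}"
    show "card ?F \<le> card (X \<inter> Z)"
    proof (cases "?F = {}")
      case False
      then obtain x0 z0 where p0: "x0 \<in> X" "z0 \<in> Z" "x0 \<otimes> z0 = y" by auto
      have eq: "inv x0 \<otimes> x = z0 \<otimes> inv z" if "x \<in> X" "z \<in> Z" "x \<otimes> z = y" for x z
      proof -
        have cc: "x \<in> carrier G" "z \<in> carrier G" "x0 \<in> carrier G" "z0 \<in> carrier G"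
          using c that p0 by auto
        have "x = (x0 \<otimes> z0) \<otimes> inv z"
          using p0(3) that(3) cc by (metis inv_solve_right m_closed)
        then show ?thesis
          using cc by (metis inv_closed inv_solve_left m_assoc m_closed)
      qed
      have "inj_on (\<lambda>(x, z). inv x0 \<otimes> x) ?F"
      proof (rule inj_onI, clarify)
        fix x z x' z'
        assume *: "x \<in> X" "z \<in> Z" "x' \<in> X" "z' \<in> Z" "inv x0 \<otimes> x = inv x0 \<otimes> x'"
          "x' \<otimes> z' = x \<otimes> z"
        have "x = x'" using * c p0 by (metis Units_eq Units_l_cancel inv_closed)
        moreover have "z = z'" using * c \<open>x = x'\<close> by (metis Units_eq Units_l_cancel)
        ultimately show "x = x' \<and> z = z'" by simp
      qed
      moreover have "(\<lambda>(x, z). inv x0 \<otimes> x) ` ?F \<subseteq> X \<inter> Z"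
      proof clarify
        fix x z assume *: "x \<in> X" "z \<in> Y" "z \<in> Z" "y = x \<otimes> z"
        have "inv x0 \<otimes> x \<in> X"
          using * p0 assms(2) by (simp add: subgroup.m_closed subgroup.m_inv_closed)
        moreover have "z0 \<otimes> inv z \<in> Z"
          using * p0 assms(4) by (simp add: subgroup.m_closed subgroup.m_inv_closed)
        ultimately show "inv x0 \<otimes> x \<in> X \<inter> Z" using eq[OF *(1,3)] *(4) by simp
      qed
      ultimately show ?thesis
        using fin by (intro card_inj_on_le) auto
    qed (simp only: card.empty)
  qed (use fin in auto)
  then show ?thesis by (simp add: card_cartesian_product)
qed

text \<open>A polymatroid version of Shearer's inequality.\<close>

lemma submodular_uniform_cover:
  fixes h :: "'x set \<Rightarrow> real"
  assumes "finite X" "h {} = 0"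
    and sub: "\<And>A B w. B \<subseteq> A \<Longrightarrow> A \<subseteq> X \<Longrightarrow> w \<in> X \<Longrightarrow> h (insert w A) - h A \<le> h (insert w B) - h B"
    and "finite T" and cover: "\<And>x. x \<in> X \<Longrightarrow> card {t \<in> T. x \<in> S t} = m"
  shows "real m * h X \<le> (\<Sum>t\<in>T. h (S t \<inter> X))"
proof -
  have "Y \<subseteq> X \<Longrightarrow> real m * h Y \<le> (\<Sum>t\<in>T. h (S t \<inter> Y))" if "finite Y" for Y
    using that
  proof (induction Y rule: finite_induct)
    case empty
    then show ?case using assms(2) by simp
  next
    case (insert w Y)
    \<comment> \<open>By submodularity, adding \<open>w\<close> raises each term with
      \<open>w \<in> S t\<close> by at least the increment of \<open>h\<close> at \<open>Y\<close>;
      exactly \<open>m\<close> terms are of this kind.\<close>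
    have step: "h (S t \<inter> Y) + (if w \<in> S t then h (insert w Y) - h Y else 0) \<le> h (S t \<inter> insert w Y)" for t
      using sub[of "S t \<inter> Y" Y w] insert.prems by (auto simp: Int_insert_right)
    have "(\<Sum>t\<in>T. if w \<in> S t then h (insert w Y) - h Y else 0) = real m * (h (insert w Y) - h Y)"
      using cover[of w] insert.prems assms(4) by (simp add: sum.If_cases Int_def)
    moreover have "(\<Sum>t\<in>T. h (S t \<inter> Y) + (if w \<in> S t then h (insert w Y) - h Y else 0))
        \<le> (\<Sum>t\<in>T. h (S t \<inter> insert w Y))"
      by (rule sum_mono) (rule step)
    ultimately show ?case
      using insert by (simp add: sum.distrib algebra_simps)
  qed
  then show ?thesis using assms(1) by blast
qed

section \<open>Linear conditions on coefficient vectors and their corank\<close>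

context field_cover
begin

abbreviation coeff_group :: "'k set \<Rightarrow> ('k \<Rightarrow> 'b) monoid"
  where "coeff_group A \<equiv> product_group A (\<lambda>_. add_monoid R)"

lemma group_coeff_group: "group (coeff_group A)"
  by (rule product_group) (rule add.group_axioms)

lemma finite_coeff_group: "finite A \<Longrightarrow> finite (A \<rightarrow>\<^sub>E carrier R)"
  using finite_carrier by (intro finite_PiE) auto

text \<open>Functionals have coefficients in \<open>'s\<close>, as Hasse derivatives of monomials
  do, while vectors have entries in the field: \<open>lift\<close> brings the two together, and
  \<open>\<phi>\<close> removes the dependence on the choice of \<open>lift\<close>.\<close>

definition pairing :: "'k set \<Rightarrow> ('k \<Rightarrow> 's) \<Rightarrow> ('k \<Rightarrow> 'b) \<Rightarrow> 'b"
  where "pairing A K c = \<phi> (\<Sum>\<alpha>\<in>A. lift (c \<alpha>) * K \<alpha>)"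

definition annihilator :: "'k set \<Rightarrow> ('k \<Rightarrow> 's) set \<Rightarrow> ('k \<Rightarrow> 'b) set"
  where "annihilator A Ks = {c \<in> A \<rightarrow>\<^sub>E carrier R. \<forall>K\<in>Ks. pairing A K c = \<zero>}"

lemma pairing_diff:
  assumes "c \<in> A \<rightarrow>\<^sub>E carrier R" "c' \<in> A \<rightarrow>\<^sub>E carrier R"
  shows "pairing A K (c \<otimes>\<^bsub>coeff_group A\<^esub> inv\<^bsub>coeff_group A\<^esub> c') = pairing A K c \<ominus> pairing A K c'"
proof -
  have inv: "inv\<^bsub>coeff_group A\<^esub> c' = (\<lambda>i\<in>A. inv\<^bsub>add_monoid R\<^esub> c' i)"
    by (rule inv_product_group) (use assms in \<open>simp_all add: add.group_axioms\<close>)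
  have "\<phi> (\<Sum>\<alpha>\<in>A. lift ((c \<otimes>\<^bsub>coeff_group A\<^esub> inv\<^bsub>coeff_group A\<^esub> c') \<alpha>) * K \<alpha>) =
      \<phi> (\<Sum>\<alpha>\<in>A. (lift (c \<alpha>) - lift (c' \<alpha>)) * K \<alpha>)"
  proof (intro cover_sum_cong cover_mult_cong refl)
    fix \<alpha> assume "\<alpha> \<in> A"
    then have "c \<alpha> \<in> carrier R" "c' \<alpha> \<in> carrier R" using assms by auto
    then show "\<phi> (lift ((c \<otimes>\<^bsub>coeff_group A\<^esub> inv\<^bsub>coeff_group A\<^esub> c') \<alpha>)) = \<phi> (lift (c \<alpha>) - lift (c' \<alpha>))"
      using \<open>\<alpha> \<in> A\<close> by (simp add: inv cover_diff minus_eq a_inv_def)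
  qed
  also have "\<dots> = pairing A K c \<ominus> pairing A K c'"
    by (simp add: pairing_def left_diff_distrib sum_subtractf cover_diff)
  finally show ?thesis unfolding pairing_def .
qed

lemma pairing_closed [simp]: "pairing A K c \<in> carrier R"
  by (simp add: pairing_def)

lemma annihilator_diff:
  assumes "c \<in> annihilator A Ks" "c' \<in> annihilator A Ks"
  shows "c \<otimes>\<^bsub>coeff_group A\<^esub> inv\<^bsub>coeff_group A\<^esub> c' \<in> annihilator A Ks"
proof -
  have "c \<otimes>\<^bsub>coeff_group A\<^esub> inv\<^bsub>coeff_group A\<^esub> c' \<in> carrier (coeff_group A)"
    using assms group_coeff_group[of A] unfolding annihilator_def
    by (intro monoid.m_closed group.inv_closed group.is_monoid) auto
  then show ?thesis
    using assms pairing_diff[of c A c'] unfolding annihilator_def by (auto simp: minus_eq)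
qed

lemma zero_in_annihilator: "(\<lambda>\<alpha>\<in>A. \<zero>) \<in> annihilator A Ks"
proof -
  have "\<phi> (\<Sum>\<alpha>\<in>A. lift ((\<lambda>\<alpha>\<in>A. \<zero>) \<alpha>) * K \<alpha>) = \<zero>" for K
    by (rule cover_sum_zero) (simp add: cover_mult)
  then show ?thesis by (auto simp: annihilator_def pairing_def)
qed

lemma subgroup_annihilator: "subgroup (annihilator A Ks) (coeff_group A)"
proof -
  interpret G: group "coeff_group A" by (rule group_coeff_group)
  have one: "\<one>\<^bsub>coeff_group A\<^esub> \<in> annihilator A Ks"
    using zero_in_annihilator[of A Ks] by simp
  have sub: "annihilator A Ks \<subseteq> carrier (coeff_group A)"
    by (auto simp: annihilator_def)
  have inv: "inv\<^bsub>coeff_group A\<^esub> c \<in> annihilator A Ks" if "c \<in> annihilator A Ks" for c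
    using annihilator_diff[OF one that] unfolding G.l_one[OF G.inv_closed[OF subsetD[OF sub that]]] .
  show ?thesis
  proof (rule G.subgroupI)
    fix c c' assume c: "c \<in> annihilator A Ks" and c': "c' \<in> annihilator A Ks"
    show "c \<otimes>\<^bsub>coeff_group A\<^esub> c' \<in> annihilator A Ks"
      using annihilator_diff[OF c inv[OF c']] unfolding G.inv_inv[OF subsetD[OF sub c']] .
  next
    show "annihilator A Ks \<noteq> {}" using one by blast
  qed (fact sub inv)+
qed

lemma annihilator_Un: "annihilator A (X \<union> Y) = annihilator A X \<inter> annihilator A Y"
  by (auto simp: annihilator_def)

lemma finite_annihilator: "finite A \<Longrightarrow> finite (annihilator A X)"
  by (rule finite_subset[OF _ finite_coeff_group]) (auto simp: annihilator_def)

lemma card_annihilator_pos: "finite A \<Longrightarrow> card (annihilator A X) > 0"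
  using finite_annihilator zero_in_annihilator by (metis card_gt_0_iff empty_iff)

text \<open>Each functional in \<open>Y\<close> takes at most \<open>card (carrier R)\<close>
  values, so it divides the cardinality by at most that factor.\<close>

lemma card_annihilator_Un:
  assumes "finite A" "finite Y"
  shows "card (annihilator A X) \<le> card (carrier R) ^ card Y * card (annihilator A (X \<union> Y))"
proof -
  interpret G: group "coeff_group A" by (rule group_coeff_group)
  have "card (annihilator A X) \<le> card (Y \<rightarrow>\<^sub>E carrier R) * card (annihilator A (X \<union> Y))"
  proof (rule G.card_le_kernel[where L="\<lambda>c. \<lambda>K\<in>Y. pairing A K c"])
    fix c c' assume *: "c \<in> annihilator A X" "c' \<in> annihilator A X"
      "(\<lambda>K\<in>Y. pairing A K c) = (\<lambda>K\<in>Y. pairing A K c')"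
    have "pairing A K c = pairing A K c'" if "K \<in> Y" for K
      using fun_cong[OF *(3), of K] that by simp
    then have "pairing A K (c \<otimes>\<^bsub>coeff_group A\<^esub> inv\<^bsub>coeff_group A\<^esub> c') = \<zero>" if "K \<in> Y" for K
      using pairing_diff[of c A c' K] * that by (auto simp: annihilator_def)
    moreover have "c \<otimes>\<^bsub>coeff_group A\<^esub> inv\<^bsub>coeff_group A\<^esub> c' \<in> annihilator A X"
      using * by (intro annihilator_diff)
    ultimately show "c \<otimes>\<^bsub>coeff_group A\<^esub> inv\<^bsub>coeff_group A\<^esub> c' \<in> annihilator A (X \<union> Y)"
      unfolding annihilator_def by blast
  qed (use assms finite_annihilator finite_coeff_group in \<open>auto simp: annihilator_def\<close>)
  then show ?thesis
    using assms by (simp add: card_PiE)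
qed

text \<open>The codimension of the common annihilator, times
  \<open>ln (card (carrier R))\<close>.\<close>

definition corank :: "'k set \<Rightarrow> ('w \<Rightarrow> ('k \<Rightarrow> 's) set) \<Rightarrow> 'w set \<Rightarrow> real"
  where "corank A F \<Omega> = ln (card (A \<rightarrow>\<^sub>E carrier R)) - ln (card (annihilator A (\<Union>(F ` \<Omega>))))"

text \<open>Logarithm of \<open>card_subgroup_submodular\<close>, applied to the annihilators
  belonging to \<open>P\<close>, \<open>Q\<close> and \<open>F w\<close>. More conditions leave a
  smaller annihilator, so the one for \<open>P\<close> is contained in the one for
  \<open>Q\<close>.\<close>

lemma corank_submodular:
  assumes A: "finite A" and "Q \<subseteq> P"
  shows "corank A F (insert w P) - corank A F P \<le> corank A F (insert w Q) - corank A F Q"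
proof -
  interpret G: group "coeff_group A" by (rule group_coeff_group)
  let ?a = "\<lambda>\<Omega>. annihilator A (\<Union>(F ` \<Omega>))"
  have ins: "?a (insert w \<Omega>) = ?a \<Omega> \<inter> annihilator A (F w)" for \<Omega>
    using annihilator_Un[of A "\<Union>(F ` \<Omega>)" "F w"] by (simp add: Un_commute)
  have pos: "card (?a \<Omega>) > 0" for \<Omega>
    using card_annihilator_pos[OF A] .
  have "card (?a P) * card (?a Q \<inter> annihilator A (F w)) \<le> card (?a Q) * card (?a P \<inter> annihilator A (F w))"
    using finite_coeff_group[OF A] assms(2)
    by (intro G.card_subgroup_submodular subgroup_annihilator) (auto simp: annihilator_def)
  then have "card (?a P) * card (?a (insert w Q)) \<le> card (?a Q) * card (?a (insert w P))"
    by (simp only: ins)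
  moreover define D where "D \<Omega> = card (?a \<Omega>)" for \<Omega>
  ultimately have "D P * D (insert w Q) \<le> D Q * D (insert w P)"
    by simp
  then have "real (D P) * real (D (insert w Q)) \<le> real (D Q) * real (D (insert w P))"
    by (metis of_nat_le_iff of_nat_mult)
  moreover have "real (D \<Omega>) > 0" for \<Omega>
    using pos by (simp add: D_def)
  ultimately have "ln (D P) + ln (D (insert w Q)) \<le> ln (D Q) + ln (D (insert w P))"
    by (metis ln_mult_pos ln_le_cancel_iff mult_pos_pos)
  then show ?thesis
    unfolding corank_def D_def[symmetric] by simp
qed

end

section \<open>Translations and the cost of vanishing on a set of given density\<close>

lemma hasse_mon_order_cong:
  "(\<And>i. i \<in> J \<Longrightarrow> \<beta> i = \<beta>' i) \<Longrightarrow> hasse_mon J \<alpha> \<beta> x = hasse_mon J \<alpha> \<beta>' x"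
  unfolding hasse_mon_def by (intro prod.cong) auto

lemma hasse_order_cong:
  "(\<And>i. i \<in> J \<Longrightarrow> \<beta> i = \<beta>' i) \<Longrightarrow> hasse J A c \<beta> x = hasse J A c \<beta>' x"
  unfolding hasse_def using hasse_mon_order_cong[of J \<beta> \<beta>'] by metis

lemma hasse_eq_0:
  assumes "finite J" "A \<subseteq> multi_indices J d" "d < sum \<beta> J"
  shows "hasse J A c \<beta> x = 0"
  unfolding hasse_def
proof (intro sum.neutral ballI)
  fix \<alpha> assume "\<alpha> \<in> A"
  then have "\<not> (\<forall>i\<in>J. \<beta> i \<le> \<alpha> i)"
    using assms(2,3) sum_mono[of J \<beta> \<alpha>] by (fastforce simp: multi_indices_def)
  then obtain i where "i \<in> J" "\<alpha> i < \<beta> i" by (auto simp: not_le)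
  then show "c \<alpha> * hasse_mon J \<alpha> \<beta> x = 0"
    by (simp add: hasse_mon_eq_0[OF assms(1), of i \<alpha> \<beta>])
qed

lemma hasse_at_zero:
  assumes "finite J" "finite A" "A \<subseteq> extensional J" "\<gamma> \<in> A"
  shows "hasse J A c \<gamma> (\<lambda>_. 0) = c \<gamma>"
proof -
  have "hasse_mon J \<alpha> \<gamma> (\<lambda>_. 0 :: 'b) = 0" if "\<alpha> \<in> A" "\<alpha> \<noteq> \<gamma>" for \<alpha>
  proof -
    have "\<not> (\<forall>i\<in>J. \<alpha> i = \<gamma> i)"
      using that assms(3,4) by (auto intro: extensionalityI)
    then obtain i where i: "i \<in> J" "\<alpha> i \<noteq> \<gamma> i" by auto
    then have "\<alpha> i < \<gamma> i \<or> \<gamma> i < \<alpha> i" by linarith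
    then have "of_nat (\<alpha> i choose \<gamma> i) * (0 :: 'b) ^ (\<alpha> i - \<gamma> i) = 0"
      by (auto simp: binomial_eq_0 power_0_left)
    then show ?thesis
      unfolding hasse_mon_def using i(1) assms(1) by (intro prod_zero) auto
  qed
  then have "hasse J A c \<gamma> (\<lambda>_. 0) = (\<Sum>\<alpha>\<in>{\<gamma>}. c \<alpha> * hasse_mon J \<alpha> \<gamma> (\<lambda>_. 0))"
    unfolding hasse_def using assms(2,4) by (intro sum.mono_neutral_right) auto
  then show ?thesis by (simp add: hasse_mon_def)
qed

lemma multi_indices_extensional: "multi_indices J d \<subseteq> extensional J"
  by (auto simp: multi_indices_def PiE_def)

text \<open>The derivatives at \<open>x\<close> are the coefficients of the polynomial translated by
  \<open>x\<close>: Taylor's formula as a statement on coefficient vectors. Bounding the total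
  degree gives a space that translations preserve.\<close>

lemma hasse_translate:
  fixes c :: "('i \<Rightarrow> nat) \<Rightarrow> 'a::comm_ring_1"
  assumes fin: "finite J" and A: "A = multi_indices J d"
  shows "hasse J A (\<lambda>\<alpha>. hasse J A c \<alpha> x) \<beta> z = hasse J A c \<beta> (\<lambda>i. x i + z i)"
proof -
  define H where "H \<alpha> = hasse J A c \<alpha> x" for \<alpha>
  \<comment> \<open>The increments for which \<open>\<beta> + \<gamma>\<close> is still an exponent
    of degree at most \<open>d\<close>; all others produce derivatives of too high an order, which
    are zero.\<close>
  define G where "G = {\<gamma> \<in> J \<rightarrow>\<^sub>E {..d}. (\<Sum>i\<in>J. \<beta> i + \<gamma> i) \<le> d}"
  have le: "\<alpha> i \<le> d" if "\<alpha> \<in> A" "i \<in> J" for \<alpha> i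
    using that multi_indices_le[OF fin] A by auto
  have "hasse J A c \<beta> (\<lambda>i. x i + z i) = (\<Sum>\<gamma>\<in>J \<rightarrow>\<^sub>E {..d}.
      (\<Prod>i\<in>J. of_nat (\<beta> i + \<gamma> i choose \<beta> i) * z i ^ \<gamma> i) * H (\<lambda>i. \<beta> i + \<gamma> i))"
    unfolding H_def by (rule hasse_add[OF fin]) (use le in auto)
  also have "\<dots> = (\<Sum>\<gamma>\<in>G. (\<Prod>i\<in>J. of_nat (\<beta> i + \<gamma> i choose \<beta> i) * z i ^ \<gamma> i) * H (\<lambda>i. \<beta> i + \<gamma> i))"
  proof (rule sum.mono_neutral_right)
    show "finite (J \<rightarrow>\<^sub>E {..d})" using fin by (intro finite_PiE) auto
    show "\<forall>\<gamma>\<in>(J \<rightarrow>\<^sub>E {..d}) - G. (\<Prod>i\<in>J. of_nat (\<beta> i + \<gamma> i choose \<beta> i) * z i ^ \<gamma> i) * H (\<lambda>i. \<beta> i + \<gamma> i) = 0"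
    proof
      fix \<gamma> assume "\<gamma> \<in> (J \<rightarrow>\<^sub>E {..d}) - G"
      then have "d < (\<Sum>i\<in>J. \<beta> i + \<gamma> i)" unfolding G_def by (auto simp: not_le)
      then have "H (\<lambda>i. \<beta> i + \<gamma> i) = 0"
        unfolding H_def A by (rule hasse_eq_0[OF fin order_refl])
      then show "(\<Prod>i\<in>J. of_nat (\<beta> i + \<gamma> i choose \<beta> i) * z i ^ \<gamma> i) * H (\<lambda>i. \<beta> i + \<gamma> i) = 0"
        by simp
    qed
  qed (auto simp: G_def)
  also have "\<dots> = (\<Sum>\<alpha>\<in>{\<alpha>\<in>A. \<forall>i\<in>J. \<beta> i \<le> \<alpha> i}. H \<alpha> * hasse_mon J \<alpha> \<beta> z)"
  proof (rule sum.reindex_bij_witness[where i="\<lambda>\<alpha>. \<lambda>i\<in>J. \<alpha> i - \<beta> i" and j="\<lambda>\<gamma>. \<lambda>i\<in>J. \<beta> i + \<gamma> i"])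
    fix \<gamma> assume \<gamma>: "\<gamma> \<in> G"
    show "(\<lambda>i\<in>J. (\<lambda>i\<in>J. \<beta> i + \<gamma> i) i - \<beta> i) = \<gamma>"
      using \<gamma> by (intro extensionalityI[of _ J]) (auto simp: G_def PiE_def)
    show "(\<lambda>i\<in>J. \<beta> i + \<gamma> i) \<in> {\<alpha>\<in>A. \<forall>i\<in>J. \<beta> i \<le> \<alpha> i}"
      using \<gamma> by (auto simp: G_def A multi_indices_def)
    have "H (\<lambda>i\<in>J. \<beta> i + \<gamma> i) = H (\<lambda>i. \<beta> i + \<gamma> i)"
      unfolding H_def by (rule hasse_order_cong) simp
    moreover have "hasse_mon J (\<lambda>i\<in>J. \<beta> i + \<gamma> i) \<beta> z =
        (\<Prod>i\<in>J. of_nat (\<beta> i + \<gamma> i choose \<beta> i) * z i ^ \<gamma> i)"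
      unfolding hasse_mon_def by (intro prod.cong) auto
    ultimately show "H (\<lambda>i\<in>J. \<beta> i + \<gamma> i) * hasse_mon J (\<lambda>i\<in>J. \<beta> i + \<gamma> i) \<beta> z =
        (\<Prod>i\<in>J. of_nat (\<beta> i + \<gamma> i choose \<beta> i) * z i ^ \<gamma> i) * H (\<lambda>i. \<beta> i + \<gamma> i)"
      by (simp only: mult.commute)
  next
    fix \<alpha> assume \<alpha>: "\<alpha> \<in> {\<alpha>\<in>A. \<forall>i\<in>J. \<beta> i \<le> \<alpha> i}"
    then show "(\<lambda>i\<in>J. \<beta> i + (\<lambda>i\<in>J. \<alpha> i - \<beta> i) i) = \<alpha>"
      by (intro extensionalityI[of _ J]) (auto simp: A multi_indices_def PiE_def)
    have "(\<Sum>i\<in>J. \<beta> i + (\<lambda>i\<in>J. \<alpha> i - \<beta> i) i) = sum \<alpha> J"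
      using \<alpha> by (intro sum.cong) auto
    then show "(\<lambda>i\<in>J. \<alpha> i - \<beta> i) \<in> G"
      using \<alpha> le by (fastforce simp: G_def A multi_indices_def intro: order_trans[OF diff_le_self])
  qed
  also have "\<dots> = (\<Sum>\<alpha>\<in>A. H \<alpha> * hasse_mon J \<alpha> \<beta> z)"
  proof (rule sum.mono_neutral_left)
    show "\<forall>\<alpha>\<in>A - {\<alpha>\<in>A. \<forall>i\<in>J. \<beta> i \<le> \<alpha> i}. H \<alpha> * hasse_mon J \<alpha> \<beta> z = 0"
    proof
      fix \<alpha> assume "\<alpha> \<in> A - {\<alpha>\<in>A. \<forall>i\<in>J. \<beta> i \<le> \<alpha> i}"
      then obtain i where "i \<in> J" "\<alpha> i < \<beta> i" by (auto simp: not_le)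
      then show "H \<alpha> * hasse_mon J \<alpha> \<beta> z = 0"
        by (simp add: hasse_mon_eq_0[OF fin, of i \<alpha> \<beta>])
    qed
  qed (auto simp: A finite_multi_indices[OF fin])
  finally show ?thesis by (simp add: hasse_def H_def)
qed

context field_cover
begin

text \<open>Only the values of \<open>\<beta>\<close> on \<open>J\<close> matter to the functional,
  so for finite \<open>J\<close> the set is finite although \<open>\<beta>\<close> ranges over all
  functions.\<close>

definition conditions :: "'i set \<Rightarrow> nat \<Rightarrow> ('i \<Rightarrow> 'b) \<Rightarrow> (('i \<Rightarrow> nat) \<Rightarrow> 's) set"
  where "conditions J k w = {\<lambda>\<gamma>. hasse_mon J \<gamma> \<beta> (\<lambda>i. lift (w i)) |\<beta>. sum \<beta> J < k}"

definition zero_order_ge :: "'i set \<Rightarrow> ('i \<Rightarrow> nat) set \<Rightarrow> (('i \<Rightarrow> nat) \<Rightarrow> 'b) \<Rightarrow> ('i \<Rightarrow> 's) \<Rightarrow> nat \<Rightarrow> bool"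
  where "zero_order_ge J A c x k \<longleftrightarrow> (\<forall>\<beta>. sum \<beta> J < k \<longrightarrow> \<phi> (hasse J A (\<lambda>\<alpha>. lift (c \<alpha>)) \<beta> x) = \<zero>)"

lemma annihilator_conditions:
  "c \<in> annihilator A (\<Union>w\<in>\<Omega>. conditions J (k w) w) \<longleftrightarrow>
    c \<in> A \<rightarrow>\<^sub>E carrier R \<and> (\<forall>w\<in>\<Omega>. zero_order_ge J A c (\<lambda>i. lift (w i)) (k w))"
proof -
  have "(\<forall>K\<in>conditions J k' w. pairing A K c = \<zero>) \<longleftrightarrow> zero_order_ge J A c (\<lambda>i. lift (w i)) k'" for w k'
  proof -
    have "(\<forall>K\<in>conditions J k' w. pairing A K c = \<zero>) \<longleftrightarrow>
        (\<forall>\<beta>. sum \<beta> J < k' \<longrightarrow> pairing A (\<lambda>\<gamma>. hasse_mon J \<gamma> \<beta> (\<lambda>i. lift (w i))) c = \<zero>)"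
      unfolding conditions_def by blast
    then show ?thesis by (simp add: pairing_def zero_order_ge_def hasse_def)
  qed
  then show ?thesis unfolding annihilator_def by blast
qed

lemma zero_order_ge_cong:
  assumes "\<And>i. i \<in> J \<Longrightarrow> \<phi> (x i) = \<phi> (y i)"
  shows "zero_order_ge J A c x k \<longleftrightarrow> zero_order_ge J A c y k"
proof -
  have "\<phi> (hasse J A c' \<beta> x) = \<phi> (hasse J A c' \<beta> y)" for c' \<beta>
    by (rule hasse_cong) (simp_all add: assms)
  then show ?thesis by (simp add: zero_order_ge_def)
qed

text \<open>Translating polynomials is injective, since translating back and evaluating derivatives
  at the origin recovers each coefficient. It carries zeros at \<open>w - \<tau>\<close> to zeros at
  \<open>w\<close> of the same order.\<close>

lemma card_annihilator_translate:
  assumes fin: "finite J" and A: "A = multi_indices J d" and \<tau>: "\<tau> \<in> J \<rightarrow>\<^sub>E carrier R"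
    and sub: "\<Omega>' \<subseteq> J \<rightarrow>\<^sub>E carrier R" "\<And>w. w \<in> \<Omega>' \<Longrightarrow> (\<lambda>i\<in>J. w i \<ominus> \<tau> i) \<in> \<Omega>"
  shows "card (annihilator A (\<Union>w\<in>\<Omega>. conditions J k w)) \<le> card (annihilator A (\<Union>w\<in>\<Omega>'. conditions J k w))"
proof -
  have finA: "finite A" unfolding A by (rule finite_multi_indices[OF fin])
  \<comment> \<open>The sign matters: \<open>\<Theta> c\<close> evaluated at \<open>z\<close> is the
    polynomial of \<open>c\<close> evaluated at \<open>z - \<tau>\<close>.\<close>
  define \<sigma> where "\<sigma> i = - lift (\<tau> i)" for i
  define \<Theta> where "\<Theta> c = (\<lambda>\<gamma>\<in>A. \<phi> (hasse J A (\<lambda>\<alpha>. lift (c \<alpha>)) \<gamma> \<sigma>))" for c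
  have shift: "\<phi> (hasse J A (\<lambda>\<alpha>. lift (\<Theta> c \<alpha>)) \<beta> z) = \<phi> (hasse J A (\<lambda>\<alpha>. lift (c \<alpha>)) \<beta> (\<lambda>i. \<sigma> i + z i))"
    for c \<beta> z
  proof -
    have "\<phi> (hasse J A (\<lambda>\<alpha>. lift (\<Theta> c \<alpha>)) \<beta> z) =
        \<phi> (hasse J A (\<lambda>\<alpha>. hasse J A (\<lambda>\<alpha>. lift (c \<alpha>)) \<alpha> \<sigma>) \<beta> z)"
      by (rule hasse_cong) (simp_all add: \<Theta>_def)
    then show ?thesis by (simp add: hasse_translate[OF fin A])
  qed
  show ?thesis
  proof (rule card_inj_on_le[where f=\<Theta>])
    show "inj_on \<Theta> (annihilator A (\<Union>w\<in>\<Omega>. conditions J k w))"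
    proof (rule inj_onI)
      fix c c' assume *: "c \<in> annihilator A (\<Union>w\<in>\<Omega>. conditions J k w)"
        "c' \<in> annihilator A (\<Union>w\<in>\<Omega>. conditions J k w)" "\<Theta> c = \<Theta> c'"
      have val: "c \<gamma> = \<phi> (hasse J A (\<lambda>\<alpha>. lift (\<Theta> c \<alpha>)) \<gamma> (\<lambda>i. lift (\<tau> i)))"
        if "\<gamma> \<in> A" "c \<in> A \<rightarrow>\<^sub>E carrier R" for c \<gamma>
      proof -
        have "hasse J A (\<lambda>\<alpha>. lift (c \<alpha>)) \<gamma> (\<lambda>i. \<sigma> i + lift (\<tau> i)) = lift (c \<gamma>)"
          using hasse_at_zero[OF fin finA _ that(1), of "\<lambda>\<alpha>. lift (c \<alpha>)"] multi_indices_extensional[of J d]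
          by (simp add: \<sigma>_def A)
        then show ?thesis using PiE_mem[OF that(2,1)] by (simp add: shift)
      qed
      have cc: "c \<in> A \<rightarrow>\<^sub>E carrier R" "c' \<in> A \<rightarrow>\<^sub>E carrier R"
        using * by (auto simp: annihilator_def)
      then show "c = c'"
        using val[OF _ cc(1)] val[OF _ cc(2)] *(3) by (intro PiE_ext[OF cc]) metis
    qed
    show "\<Theta> ` annihilator A (\<Union>w\<in>\<Omega>. conditions J k w) \<subseteq> annihilator A (\<Union>w\<in>\<Omega>'. conditions J k w)"
    proof (rule image_subsetI)
      fix c assume c: "c \<in> annihilator A (\<Union>w\<in>\<Omega>. conditions J k w)"
      have "zero_order_ge J A (\<Theta> c) (\<lambda>i. lift (w i)) k" if w: "w \<in> \<Omega>'" for w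
      proof -
        define v where "v = (\<lambda>i\<in>J. w i \<ominus> \<tau> i)"
        have "zero_order_ge J A c (\<lambda>i. lift (v i)) k"
          using c sub(2)[OF w] unfolding annihilator_conditions v_def by blast
        moreover have "\<phi> (lift (v i)) = \<phi> (\<sigma> i + lift (w i))" if "i \<in> J" for i
        proof -
          have "w i \<in> carrier R" "\<tau> i \<in> carrier R" using \<tau> sub(1) w that by auto
          then show ?thesis
            using that by (simp add: v_def \<sigma>_def cover_diff)
        qed
        ultimately have "zero_order_ge J A c (\<lambda>i. \<sigma> i + lift (w i)) k"
          using zero_order_ge_cong[of J "\<lambda>i. lift (v i)" "\<lambda>i. \<sigma> i + lift (w i)" A c k] by simp
        then show ?thesis by (simp add: zero_order_ge_def shift)
      qed
      then show "\<Theta> c \<in> annihilator A (\<Union>w\<in>\<Omega>'. conditions J k w)"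
        unfolding annihilator_conditions by (auto simp: \<Theta>_def)
    qed
  qed (rule finite_annihilator[OF finA])
qed

text \<open>Total degree at most \<open>d\<close> puts all exponents in the box below
  \<open>Suc d\<close>. Orders below \<open>\<kappa>\<close> in each coordinate sum to at most
  \<open>card J * (\<kappa> - 1)\<close>, hence to less than \<open>k\<close>. Thus
  \<open>box_vanishing\<close> applies.\<close>

lemma annihilator_everywhere:
  assumes fin: "finite J" and A: "A = multi_indices J d"
    and d: "d < \<kappa> * card (carrier R)" and k: "card J * (\<kappa> - 1) < k"
  shows "annihilator A (\<Union>w\<in>J \<rightarrow>\<^sub>E carrier R. conditions J k w) = {\<lambda>\<alpha>\<in>A. \<zero>}"
proof -
  have "c = (\<lambda>\<alpha>\<in>A. \<zero>)" if c: "c \<in> annihilator A (\<Union>w\<in>J \<rightarrow>\<^sub>E carrier R. conditions J k w)" for c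
  proof -
    define b where "b \<gamma> = (if \<gamma> \<in> A then lift (c \<gamma>) else 0)" for \<gamma>
    let ?B = "J \<rightarrow>\<^sub>E {..<Suc d}"
    have AB: "A \<subseteq> ?B"
      unfolding A using multi_indices_le[OF fin] by (fastforce simp: multi_indices_def less_Suc_eq_le)
    have ext: "hasse J ?B b \<beta> w = hasse J A (\<lambda>\<alpha>. lift (c \<alpha>)) \<beta> w" for \<beta> w
      unfolding hasse_def using AB fin
      by (intro sum.mono_neutral_cong_right) (auto simp: b_def finite_PiE)
    have "\<phi> (b \<gamma>) = \<zero>" if "\<gamma> \<in> A" for \<gamma>
    proof (rule box_vanishing[OF fin])
      show "Suc d \<le> \<kappa> * card (carrier R)" using d by simp
      show "\<gamma> \<in> ?B" using that AB by blast
      fix w \<beta> assume \<beta>: "\<And>i. i \<in> J \<Longrightarrow> \<beta> i < \<kappa>"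
      have "sum \<beta> J \<le> (\<Sum>i\<in>J. \<kappa> - 1)"
        using \<beta> by (intro sum_mono) fastforce
      then have "sum \<beta> J < k" using k by simp
      moreover have "zero_order_ge J A c (\<lambda>i. lift ((\<lambda>i\<in>J. \<phi> (w i)) i)) k"
        using c unfolding annihilator_conditions by auto
      then have "zero_order_ge J A c w k"
        by (subst (asm) zero_order_ge_cong[where y=w]) auto
      ultimately show "\<phi> (hasse J ?B b \<beta> w) = \<zero>"
        by (simp add: ext zero_order_ge_def)
    qed
    then have "c \<gamma> = \<zero>" if "\<gamma> \<in> A" for \<gamma>
      using that c by (force simp: b_def annihilator_def)
    then show ?thesis
      using c by (intro extensionalityI[of _ A]) (auto simp: annihilator_def PiE_def)
  qed
  then show ?thesis using zero_in_annihilator by blast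
qed

text \<open>\<open>submodular_uniform_cover\<close> for the translates \<open>S \<tau>\<close> of
  \<open>\<Omega>\<close>: each point lies in exactly \<open>card \<Omega>\<close> of them, none has
  larger corank than \<open>\<Omega>\<close>, and the whole space has full corank by
  \<open>annihilator_everywhere\<close>.\<close>

lemma corank_density:
  assumes fin: "finite J" and A: "A = multi_indices J d"
    and d: "d < \<kappa> * card (carrier R)" and k: "card J * (\<kappa> - 1) < k"
    and \<Omega>: "\<Omega> \<subseteq> J \<rightarrow>\<^sub>E carrier R"
  shows "card \<Omega> * (card A * ln (card (carrier R))) \<le>
    card (carrier R) ^ card J * corank A (conditions J k) \<Omega>"
proof -
  let ?X = "J \<rightarrow>\<^sub>E carrier R" and ?h = "corank A (conditions J k)"
  define S where "S \<tau> = {w. (\<lambda>i\<in>J. w i \<ominus> \<tau> i) \<in> \<Omega>}" for \<tau>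
  have finA: "finite A" unfolding A by (rule finite_multi_indices[OF fin])
  have finX: "finite ?X" by (rule finite_coeff_group[OF fin])
  have cardA: "card (A \<rightarrow>\<^sub>E carrier R) = card (carrier R) ^ card A"
    using finA by (simp add: card_PiE)
  have q: "card (carrier R) > 0"
    using finite_carrier by (auto simp: card_gt_0_iff)
  have hX: "?h ?X = card A * ln (card (carrier R))"
    using annihilator_everywhere[OF fin A d k] q by (simp add: corank_def cardA ln_realpow)
  have h0: "?h {} = 0"
    by (simp add: corank_def annihilator_def)
  have "real (card \<Omega>) * ?h ?X \<le> (\<Sum>\<tau>\<in>?X. ?h (S \<tau> \<inter> ?X))"
  proof (rule submodular_uniform_cover[where h="?h", OF finX h0 corank_submodular[OF finA] finX])
    fix w assume w: "w \<in> ?X"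
    \<comment> \<open>The involution \<open>\<tau> \<mapsto> w - \<tau>\<close> matches the
      translates containing \<open>w\<close> with the points of \<open>\<Omega>\<close>.\<close>
    have "bij_betw (\<lambda>\<tau>. \<lambda>i\<in>J. w i \<ominus> \<tau> i) {\<tau> \<in> ?X. w \<in> S \<tau>} \<Omega>"
    proof (rule bij_betw_byWitness[where f'="\<lambda>\<tau>. \<lambda>i\<in>J. w i \<ominus> \<tau> i"])
      have inv: "(\<lambda>i\<in>J. w i \<ominus> (\<lambda>i\<in>J. w i \<ominus> \<tau> i) i) = \<tau>" if "\<tau> \<in> ?X" for \<tau>
      proof (rule extensionalityI[of _ J])
        fix i assume i: "i \<in> J"
        then have "w i \<in> carrier R" "\<tau> i \<in> carrier R" using w that by auto
        then have "w i \<ominus> (w i \<ominus> \<tau> i) = \<tau> i"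
          by (simp add: minus_eq minus_add a_assoc[symmetric] r_neg)
        then show "(\<lambda>i\<in>J. w i \<ominus> (\<lambda>i\<in>J. w i \<ominus> \<tau> i) i) i = \<tau> i" using i by simp
      qed (use that in \<open>auto simp: PiE_def\<close>)
      have cl: "(\<lambda>i\<in>J. w i \<ominus> \<tau> i) \<in> ?X" if "\<tau> \<in> ?X" for \<tau>
        using w that by (auto simp: PiE_iff)
      show "\<forall>\<tau>\<in>{\<tau> \<in> ?X. w \<in> S \<tau>}. (\<lambda>i\<in>J. w i \<ominus> (\<lambda>i\<in>J. w i \<ominus> \<tau> i) i) = \<tau>"
        and "\<forall>\<tau>\<in>\<Omega>. (\<lambda>i\<in>J. w i \<ominus> (\<lambda>i\<in>J. w i \<ominus> \<tau> i) i) = \<tau>"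
        using inv \<Omega> by blast+
      show "(\<lambda>\<tau>. \<lambda>i\<in>J. w i \<ominus> \<tau> i) ` {\<tau> \<in> ?X. w \<in> S \<tau>} \<subseteq> \<Omega>"
        by (auto simp: S_def)
      show "(\<lambda>\<tau>. \<lambda>i\<in>J. w i \<ominus> \<tau> i) ` \<Omega> \<subseteq> {\<tau> \<in> ?X. w \<in> S \<tau>}"
      proof (rule image_subsetI)
        fix \<tau> assume t: "\<tau> \<in> \<Omega>"
        then have X: "\<tau> \<in> ?X" using \<Omega> by blast
        show "(\<lambda>i\<in>J. w i \<ominus> \<tau> i) \<in> {\<tau> \<in> ?X. w \<in> S \<tau>}"
          using cl[OF X] inv[OF X] t by (simp add: S_def del: restrict_apply)
      qed
    qed
    then show "card {\<tau> \<in> ?X. w \<in> S \<tau>} = card \<Omega>" by (rule bij_betw_same_card)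
  qed
  also have "\<dots> \<le> (\<Sum>\<tau>\<in>?X. ?h \<Omega>)"
  proof (rule sum_mono)
    fix \<tau> assume "\<tau> \<in> ?X"
    then have "card (annihilator A (\<Union>w\<in>\<Omega>. conditions J k w))
        \<le> card (annihilator A (\<Union>w\<in>S \<tau> \<inter> ?X. conditions J k w))"
      by (intro card_annihilator_translate[OF fin A]) (auto simp: S_def)
    then show "?h (S \<tau> \<inter> ?X) \<le> ?h \<Omega>"
      using card_annihilator_pos[OF finA] by (simp add: corank_def)
  qed
  finally show ?thesis
    using fin by (simp add: hX card_PiE)
qed

end

subsection \<open>The Kakeya maximal inequality\<close>

text \<open>Setting the variable \<open>i0\<close> to one loses nothing for forms of degree
  \<open>e\<close>, since the exponent of \<open>i0\<close> is determined by the others.\<close>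

lemma bij_betw_dehomogenize:
  assumes "finite J" "i0 \<notin> J"
  shows "bij_betw (\<lambda>\<gamma>. \<gamma>(i0 := e - sum \<gamma> J)) (multi_indices J e)
    {\<alpha> \<in> multi_indices (insert i0 J) e. sum \<alpha> (insert i0 J) = e}"
proof (rule bij_betw_byWitness[where f'="\<lambda>\<alpha>. \<alpha>(i0 := undefined)"])
  have s: "sum (\<gamma>(i0 := m)) J = sum \<gamma> J" for \<gamma> and m :: nat
    using assms(2) by (intro sum.cong) auto
  have s': "(\<Sum>x\<in>J. if x = i0 then m else \<gamma> x) = sum \<gamma> J" for \<gamma> and m :: nat
    using assms(2) by (intro sum.cong) auto
  show "\<forall>\<gamma>\<in>multi_indices J e. (\<gamma>(i0 := e - sum \<gamma> J))(i0 := undefined) = \<gamma>"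
    using assms(2) by (auto simp: multi_indices_def PiE_def extensional_def)
  show "\<forall>\<alpha>\<in>{\<alpha> \<in> multi_indices (insert i0 J) e. sum \<alpha> (insert i0 J) = e}.
      (\<alpha>(i0 := undefined))(i0 := e - sum (\<alpha>(i0 := undefined)) J) = \<alpha>"
  proof
    fix \<alpha> assume "\<alpha> \<in> {\<alpha> \<in> multi_indices (insert i0 J) e. sum \<alpha> (insert i0 J) = e}"
    then have "e - sum \<alpha> J = \<alpha> i0" using assms by auto
    then show "(\<alpha>(i0 := undefined))(i0 := e - sum (\<alpha>(i0 := undefined)) J) = \<alpha>"
      unfolding s by simp
  qed
  show "(\<lambda>\<gamma>. \<gamma>(i0 := e - sum \<gamma> J)) ` multi_indices J e
      \<subseteq> {\<alpha> \<in> multi_indices (insert i0 J) e. sum \<alpha> (insert i0 J) = e}"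
    using assms by (auto simp: multi_indices_def s' PiE_def extensional_def)
  show "(\<lambda>\<alpha>. \<alpha>(i0 := undefined)) ` {\<alpha> \<in> multi_indices (insert i0 J) e. sum \<alpha> (insert i0 J) = e}
      \<subseteq> multi_indices J e"
    using assms by (auto simp: multi_indices_def s' PiE_def extensional_def)
qed

lemma card_multi_indices_insert:
  assumes "finite J" "i0 \<notin> J"
  shows "card (multi_indices (insert i0 J) D) = (\<Sum>e\<le>D. card (multi_indices J e))"
proof -
  let ?T = "\<lambda>e. {\<alpha> \<in> multi_indices (insert i0 J) e. sum \<alpha> (insert i0 J) = e}"
  have "multi_indices (insert i0 J) D = (\<Union>e\<le>D. ?T e)"
    by (auto simp: multi_indices_def)
  moreover have "card (\<Union>e\<le>D. ?T e) = (\<Sum>e\<le>D. card (?T e))"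
    using assms by (intro card_UN_disjoint) (auto simp: finite_multi_indices)
  moreover have "card (?T e) = card (multi_indices J e)" for e
    using bij_betw_dehomogenize[OF assms] by (rule bij_betw_same_card[symmetric])
  ultimately show ?thesis by simp
qed

lemma hasse_dehomogenize:
  fixes c :: "('i \<Rightarrow> nat) \<Rightarrow> 'a::comm_ring_1"
  assumes "finite J" "i0 \<notin> J"
  shows "hasse (insert i0 J) {\<alpha> \<in> multi_indices (insert i0 J) e. sum \<alpha> (insert i0 J) = e} c
      (\<beta>(i0 := 0)) (\<omega>(i0 := 1)) =
    hasse J (multi_indices J e) (\<lambda>\<gamma>. c (\<gamma>(i0 := e - sum \<gamma> J))) \<beta> \<omega>"
proof -
  have "hasse_mon (insert i0 J) (\<gamma>(i0 := m)) (\<beta>(i0 := 0)) (\<omega>(i0 := 1)) = hasse_mon J \<gamma> \<beta> \<omega>" for \<gamma> m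
  proof -
    have "hasse_mon J (\<gamma>(i0 := m)) (\<beta>(i0 := 0)) (\<omega>(i0 := 1)) = hasse_mon J \<gamma> \<beta> \<omega>"
      using assms(2) unfolding hasse_mon_def by (intro prod.cong) auto
    then show ?thesis
      using assms by (simp add: hasse_mon_def)
  qed
  then show ?thesis
    unfolding hasse_def
    by (subst sum.reindex_bij_betw[OF bij_betw_dehomogenize[OF assms], symmetric]) simp
qed

text \<open>A line whose direction has coordinate one at \<open>i0\<close>: within this affine
  chart, directions are parametrised by \<open>w\<close> over \<open>J\<close> alone.\<close>

definition (in ring) line_point :: "'i set \<Rightarrow> 'i \<Rightarrow> ('i \<Rightarrow> 'a) \<Rightarrow> ('i \<Rightarrow> 'a) \<Rightarrow> 'a \<Rightarrow> 'i \<Rightarrow> 'a"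
  where "line_point J i0 x w s = (\<lambda>i\<in>insert i0 J. x i \<oplus> s \<otimes> (if i = i0 then \<one> else w i))"

context field_cover
begin

text \<open>The degree filtration, with degree strictly below \<open>m\<close>: level
  \<open>0\<close> is trivial, and level \<open>Suc D\<close> carries no degree restriction.\<close>

definition filtered_annihilator ::
    "'i set \<Rightarrow> nat \<Rightarrow> (('i \<Rightarrow> 'b) \<Rightarrow> nat) \<Rightarrow> nat \<Rightarrow> (('i \<Rightarrow> nat) \<Rightarrow> 'b) set"
  where "filtered_annihilator I D g m =
    {c \<in> annihilator (multi_indices I D) (\<Union>x\<in>I \<rightarrow>\<^sub>E carrier R. conditions I (g x) x).
       \<forall>\<alpha>\<in>multi_indices I D. m \<le> sum \<alpha> I \<longrightarrow> c \<alpha> = \<zero>}"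

lemma card_lift: "card (lift ` carrier R) = card (carrier R)"
  by (rule card_image) (metis cover_lift inj_onI)

text \<open>Write \<open>q = card (carrier R)\<close>. The value of \<open>k\<close> gives
  \<open>q * (k - 1) \<le> card J * e\<close>, so mass above \<open>Suc (card J) * e\<close> exceeds
  the budget \<open>e + q * (k - 1)\<close> of \<open>top_form_vanishes\<close>. It is also the
  least \<open>k\<close> that \<open>annihilator_everywhere\<close> accepts with
  \<open>\<kappa> = Suc (e div q)\<close>.\<close>

lemma top_form_in_annihilator:
  assumes fin: "finite J" and i0: "i0 \<notin> J" and e: "e \<le> D"
    and c: "c \<in> filtered_annihilator (insert i0 J) D g (Suc e)"
    and x: "x \<in> insert i0 J \<rightarrow>\<^sub>E carrier R" and w: "w \<in> J \<rightarrow>\<^sub>E carrier R"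
    and m: "Suc (card J) * e < (\<Sum>s\<in>carrier R. g (line_point J i0 x w s))"
    and k: "k = card J * (e div card (carrier R)) + 1"
  shows "zero_order_ge J (multi_indices J e) (\<lambda>\<gamma>\<in>multi_indices J e. c (\<gamma>(i0 := e - sum \<gamma> J)))
    (\<lambda>i. lift (w i)) k"
  unfolding zero_order_ge_def
proof (intro allI impI)
  fix \<beta> assume \<beta>: "sum \<beta> J < k"
  let ?I = "insert i0 J" and ?S = "lift ` carrier R"
  let ?c = "\<lambda>\<alpha>. lift (c \<alpha>)" and ?\<omega> = "(\<lambda>i. lift (w i))(i0 := 1)"
  have finI: "finite ?I" using fin by simp
  have inj: "inj_on lift (carrier R)"
    by (metis cover_lift inj_onI)
  have "\<phi> (hasse ?I {\<alpha> \<in> multi_indices ?I e. sum \<alpha> ?I = e} ?c (\<beta>(i0 := 0)) ?\<omega>) = \<zero>"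
  proof (rule top_form_vanishes[where x="\<lambda>i. lift (x i)" and S="?S" and k=k
        and m="\<lambda>s. g (line_point J i0 x w (\<phi> s))"])
    show "finite ?S" using finite_carrier by simp
    show "inj_on \<phi> ?S" by (auto intro!: inj_onI)
    have "sum (\<beta>(i0 := 0)) ?I = sum \<beta> J"
      using fin i0 by (simp add: sum.cong[OF refl, of J "\<beta>(i0 := 0)" \<beta>] ) (intro sum.cong, auto)
    then show "sum (\<beta>(i0 := 0)) ?I < k" using \<beta> by simp
    have "card (carrier R) * (card J * (e div card (carrier R))) \<le> card J * e"
      by (metis mult.left_commute mult_le_mono2 times_div_less_eq_dividend)
    moreover have "(\<Sum>s\<in>?S. g (line_point J i0 x w (\<phi> s))) = (\<Sum>s\<in>carrier R. g (line_point J i0 x w s))"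
      by (subst sum.reindex[OF inj]) (auto intro!: sum.cong)
    moreover have "card ?S * (k - 1) = card (carrier R) * (card J * (e div card (carrier R)))"
      by (simp only: k card_lift add_diff_cancel_right')
    moreover have "Suc (card J) * e = e + card J * e" by simp
    ultimately show "e + card ?S * (k - 1) < (\<Sum>s\<in>?S. g (line_point J i0 x w (\<phi> s)))"
      using m by linarith
  next
    fix s \<gamma> assume s: "s \<in> ?S" and \<gamma>: "sum \<gamma> ?I < g (line_point J i0 x w (\<phi> s))"
    define p where "p = line_point J i0 x w (\<phi> s)"
    have wc: "w i \<in> carrier R" if "i \<in> J" for i using w that by auto
    have xc: "x i \<in> carrier R" if "i \<in> ?I" for i using x that by auto
    have pI: "p \<in> ?I \<rightarrow>\<^sub>E carrier R"
      unfolding p_def line_point_def using wc xc by (auto intro!: a_closed m_closed)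
    have "zero_order_ge ?I (multi_indices ?I D) c (\<lambda>i. lift (p i)) (g p)"
      using c pI unfolding filtered_annihilator_def annihilator_conditions by blast
    then have "\<phi> (hasse ?I (multi_indices ?I D) ?c \<gamma> (\<lambda>i. lift (p i))) = \<zero>"
      using \<gamma> by (simp add: zero_order_ge_def p_def)
    moreover have "\<phi> (hasse ?I (multi_indices ?I D) ?c \<gamma> (\<lambda>i. lift (p i))) =
        \<phi> (hasse ?I (multi_indices ?I e) ?c \<gamma> (\<lambda>i. lift (x i) + s * ?\<omega> i))"
    proof -
      have sub: "multi_indices ?I e \<subseteq> multi_indices ?I D"
        using e by (auto simp: multi_indices_def)
      \<comment> \<open>Lifted coefficients above degree \<open>e\<close> vanish only under
        \<open>\<phi>\<close>, so they are replaced by \<open>0\<close> before the sum is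
        truncated.\<close>
      have "\<phi> (hasse ?I (multi_indices ?I D) ?c \<gamma> (\<lambda>i. lift (p i))) =
          \<phi> (hasse ?I (multi_indices ?I D) (\<lambda>\<alpha>. if sum \<alpha> ?I \<le> e then ?c \<alpha> else 0) \<gamma> (\<lambda>i. lift (x i) + s * ?\<omega> i))"
      proof (rule hasse_cong)
        fix \<alpha> assume "\<alpha> \<in> multi_indices ?I D"
        then show "\<phi> (?c \<alpha>) = \<phi> (if sum \<alpha> ?I \<le> e then ?c \<alpha> else 0)"
          using c by (auto simp: filtered_annihilator_def)
      next
        fix i assume i: "i \<in> ?I"
        then have "p i = x i \<oplus> \<phi> s \<otimes> (if i = i0 then \<one> else w i)"
          by (simp add: p_def line_point_def)
        moreover have "p i \<in> carrier R" using pI i by auto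
        ultimately show "\<phi> (lift (p i)) = \<phi> (lift (x i) + s * ?\<omega> i)"
          using i wc xc by (auto simp: cover_add cover_mult cover_one)
      qed
      also have "hasse ?I (multi_indices ?I D) (\<lambda>\<alpha>. if sum \<alpha> ?I \<le> e then ?c \<alpha> else 0) \<gamma> (\<lambda>i. lift (x i) + s * ?\<omega> i)
          = hasse ?I (multi_indices ?I e) ?c \<gamma> (\<lambda>i. lift (x i) + s * ?\<omega> i)"
        unfolding hasse_def using sub finite_multi_indices[OF finI]
        by (intro sum.mono_neutral_cong_right) (auto simp: multi_indices_def)
      finally show ?thesis .
    qed
    ultimately show "\<phi> (hasse ?I (multi_indices ?I e) ?c \<gamma> (\<lambda>i. lift (x i) + s * ?\<omega> i)) = \<zero>"
      by simp
  qed (use finI in simp)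
  then have "\<phi> (hasse J (multi_indices J e) (\<lambda>\<gamma>. ?c (\<gamma>(i0 := e - sum \<gamma> J))) \<beta> (\<lambda>i. lift (w i))) = \<zero>"
    by (simp only: hasse_dehomogenize[OF fin i0])
  then show "\<phi> (hasse J (multi_indices J e)
      (\<lambda>\<alpha>. lift ((\<lambda>\<gamma>\<in>multi_indices J e. c (\<gamma>(i0 := e - sum \<gamma> J))) \<alpha>)) \<beta> (\<lambda>i. lift (w i))) = \<zero>"
    by (simp add: hasse_def cong: sum.cong)
qed

text \<open>The map to the dehomogenised part of degree \<open>e\<close> takes values in the
  annihilator at the rich directions \<open>\<Omega>\<close>, and two members with the same image
  differ by one of degree below \<open>e\<close>.\<close>

lemma card_filtered_annihilator_Suc:
  assumes fin: "finite J" and i0: "i0 \<notin> J" and e: "e \<le> D"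
    and x: "\<And>w. w \<in> J \<rightarrow>\<^sub>E carrier R \<Longrightarrow> x w \<in> insert i0 J \<rightarrow>\<^sub>E carrier R"
    and \<Omega>: "\<Omega> = {w \<in> J \<rightarrow>\<^sub>E carrier R.
      Suc (card J) * e < (\<Sum>s\<in>carrier R. g (line_point J i0 (x w) w s))}"
    and k: "k = card J * (e div card (carrier R)) + 1"
  shows "card (filtered_annihilator (insert i0 J) D g (Suc e)) \<le>
    card (annihilator (multi_indices J e) (\<Union>w\<in>\<Omega>. conditions J k w)) *
    card (filtered_annihilator (insert i0 J) D g e)"
proof -
  let ?I = "insert i0 J"
  let ?A = "multi_indices ?I D" and ?B = "multi_indices J e"
  let ?G = "coeff_group ?A"
  interpret G: group ?G by (rule group_coeff_group)
  have finA: "finite ?A" "finite ?B" using fin by (simp_all add: finite_multi_indices)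
  have sub: "filtered_annihilator ?I D g m \<subseteq> annihilator ?A (\<Union>x\<in>?I \<rightarrow>\<^sub>E carrier R. conditions ?I (g x) x)" for m
    by (auto simp: filtered_annihilator_def)
  have emb: "\<gamma>(i0 := e - sum \<gamma> J) \<in> ?A" if "\<gamma> \<in> ?B" for \<gamma>
    using bij_betwE[OF bij_betw_dehomogenize[OF fin i0, of e]] that e by (force simp: multi_indices_def)
  show ?thesis
  proof (rule G.card_le_kernel[where L="\<lambda>c. \<lambda>\<gamma>\<in>?B. c (\<gamma>(i0 := e - sum \<gamma> J))"])
    show "finite (filtered_annihilator ?I D g (Suc e))" "finite (filtered_annihilator ?I D g e)"
      using sub finite_annihilator[OF finA(1)] finite_subset by blast+
    show "filtered_annihilator ?I D g (Suc e) \<subseteq> carrier ?G"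
      using sub by (auto simp: annihilator_def)
    show "finite (annihilator ?B (\<Union>w\<in>\<Omega>. conditions J k w))"
      by (rule finite_annihilator[OF finA(2)])
    show "(\<lambda>c. \<lambda>\<gamma>\<in>?B. c (\<gamma>(i0 := e - sum \<gamma> J))) ` filtered_annihilator ?I D g (Suc e)
        \<subseteq> annihilator ?B (\<Union>w\<in>\<Omega>. conditions J k w)"
    proof (rule image_subsetI)
      fix c assume c: "c \<in> filtered_annihilator ?I D g (Suc e)"
      then have "c \<in> ?A \<rightarrow>\<^sub>E carrier R" using sub by (auto simp: annihilator_def)
      then have "c (\<gamma>(i0 := e - sum \<gamma> J)) \<in> carrier R" if "\<gamma> \<in> ?B" for \<gamma>
        using emb[OF that] by blast
      then show "(\<lambda>\<gamma>\<in>?B. c (\<gamma>(i0 := e - sum \<gamma> J))) \<in> annihilator ?B (\<Union>w\<in>\<Omega>. conditions J k w)"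
        unfolding annihilator_conditions
        using top_form_in_annihilator[OF fin i0 e c x _ _ k] by (auto simp: \<Omega>)
    qed
    fix c c' assume c: "c \<in> filtered_annihilator ?I D g (Suc e)" "c' \<in> filtered_annihilator ?I D g (Suc e)"
      and eq: "(\<lambda>\<gamma>\<in>?B. c (\<gamma>(i0 := e - sum \<gamma> J))) = (\<lambda>\<gamma>\<in>?B. c' (\<gamma>(i0 := e - sum \<gamma> J)))"
    have cG: "c \<in> ?A \<rightarrow>\<^sub>E carrier R" "c' \<in> ?A \<rightarrow>\<^sub>E carrier R"
      using c sub by (auto simp: annihilator_def)
    have inv: "inv\<^bsub>?G\<^esub> c' = (\<lambda>i\<in>?A. inv\<^bsub>add_monoid R\<^esub> c' i)"
      by (rule inv_product_group) (use cG in \<open>simp_all add: add.group_axioms\<close>)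
    have "c \<alpha> = c' \<alpha>" if \<alpha>: "\<alpha> \<in> ?A" "e \<le> sum \<alpha> ?I" for \<alpha>
    proof (cases "sum \<alpha> ?I = e")
      case True
      then have "\<alpha> \<in> {\<alpha> \<in> multi_indices ?I e. sum \<alpha> ?I = e}"
        using \<alpha> by (auto simp: multi_indices_def)
      then obtain \<gamma> where \<gamma>: "\<gamma> \<in> ?B" "\<alpha> = \<gamma>(i0 := e - sum \<gamma> J)"
        using bij_betw_imp_surj_on[OF bij_betw_dehomogenize[OF fin i0, of e]] by blast
      then show ?thesis using fun_cong[OF eq, of \<gamma>] by simp
    next
      case False
      then show ?thesis using c \<alpha> by (auto simp: filtered_annihilator_def)
    qed
    then have "(c \<otimes>\<^bsub>?G\<^esub> inv\<^bsub>?G\<^esub> c') \<alpha> = \<zero>" if \<alpha>: "\<alpha> \<in> ?A" "e \<le> sum \<alpha> ?I" for \<alpha>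
    proof -
      have "c' \<alpha> \<in> carrier R" using cG \<alpha> by auto
      then have "c' \<alpha> \<oplus> (\<ominus> c' \<alpha>) = \<zero>" by (rule r_neg)
      then show ?thesis
        using \<open>\<And>\<alpha>. \<alpha> \<in> ?A \<Longrightarrow> e \<le> sum \<alpha> ?I \<Longrightarrow> c \<alpha> = c' \<alpha>\<close>[OF \<alpha>] \<alpha>
        unfolding inv a_inv_def by (simp del: One_nat_def)
    qed
    moreover have "c \<otimes>\<^bsub>?G\<^esub> inv\<^bsub>?G\<^esub> c' \<in> annihilator ?A (\<Union>x\<in>?I \<rightarrow>\<^sub>E carrier R. conditions ?I (g x) x)"
      using c sub by (intro annihilator_diff) blast+
    ultimately show "c \<otimes>\<^bsub>?G\<^esub> inv\<^bsub>?G\<^esub> c' \<in> filtered_annihilator ?I D g e"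
      unfolding filtered_annihilator_def by blast
  qed
qed

text \<open>Orders of total size below \<open>k\<close> lie in a box of side \<open>k\<close>. This
  crude count is the source of the power of \<open>g\<close> in the maximal inequality.\<close>

lemma card_conditions:
  assumes "finite I"
  shows "finite (conditions I k w) \<and> card (conditions I k w) \<le> k ^ card I"
proof -
  let ?f = "\<lambda>\<beta> \<gamma>. hasse_mon I \<gamma> \<beta> (\<lambda>i. lift (w i))"
  have "conditions I k w \<subseteq> ?f ` (I \<rightarrow>\<^sub>E {..<k})"
  proof
    fix K assume "K \<in> conditions I k w"
    then obtain \<beta> where \<beta>: "K = ?f \<beta>" "sum \<beta> I < k" by (auto simp: conditions_def)
    have "\<beta> i < k" if "i \<in> I" for i
      using member_le_sum[OF that, of \<beta>] assms \<beta>(2) by simp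
    moreover have "K = ?f (restrict \<beta> I)"
      using hasse_mon_order_cong[of I \<beta> "restrict \<beta> I"] \<beta>(1) by auto
    ultimately show "K \<in> ?f ` (I \<rightarrow>\<^sub>E {..<k})" by auto
  qed
  moreover have "finite (I \<rightarrow>\<^sub>E {..<k})" "card (I \<rightarrow>\<^sub>E {..<k}) = k ^ card I"
    using assms by (auto simp: finite_PiE card_PiE)
  ultimately have "finite (conditions I k w)" "card (conditions I k w) \<le> card (?f ` (I \<rightarrow>\<^sub>E {..<k}))"
      "card (?f ` (I \<rightarrow>\<^sub>E {..<k})) \<le> k ^ card I"
    using card_image_le[of "I \<rightarrow>\<^sub>E {..<k}" ?f]
    by (auto intro: card_mono finite_subset)
  then show ?thesis by simp
qed

text \<open>The multiplicity conditions have codimension at most \<open>card Zs\<close>, and the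
  filtration bounds what they leave by the product of the \<open>card (a e)\<close>. Hence the
  coranks in all degrees together are at most \<open>card Zs * ln ?q\<close>, while
  \<open>corank_density\<close> bounds each of them from below.\<close>

lemma rich_directions:
  assumes fin: "finite J" and i0: "i0 \<notin> J"
    and x: "\<And>w. w \<in> J \<rightarrow>\<^sub>E carrier R \<Longrightarrow> x w \<in> insert i0 J \<rightarrow>\<^sub>E carrier R"
    and \<Omega>: "\<And>e. \<Omega> e = {w \<in> J \<rightarrow>\<^sub>E carrier R.
      Suc (card J) * e < (\<Sum>s\<in>carrier R. g (line_point J i0 (x w) w s))}"
  shows "(\<Sum>e\<le>D. card (\<Omega> e) * card (multi_indices J e)) \<le>
    card (carrier R) ^ card J * (\<Sum>z\<in>insert i0 J \<rightarrow>\<^sub>E carrier R. g z ^ Suc (card J))"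
proof -
  let ?I = "insert i0 J" and ?q = "card (carrier R)"
  let ?A = "multi_indices ?I D" and ?B = "multi_indices J"
  define Zs where "Zs = (\<Union>x\<in>?I \<rightarrow>\<^sub>E carrier R. conditions ?I (g x) x)"
  define k where "k e = card J * (e div ?q) + 1" for e
  define a where "a e = annihilator (?B e) (\<Union>w\<in>\<Omega> e. conditions J (k e) w)" for e
  define Y where "Y = filtered_annihilator ?I D g"
  have finI: "finite ?I" using fin by simp
  have finA: "finite ?A" "finite (?B e)" for e
    using fin by (simp_all add: finite_multi_indices)
  have finX: "finite (?I \<rightarrow>\<^sub>E carrier R)" by (rule finite_coeff_group[OF finI])
  have q: "?q > 1"
  proof -
    have "card {\<zero>, \<one>} \<le> ?q" using finite_carrier by (intro card_mono) auto
    then show ?thesis by simp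
  qed
  have Zs: "finite Zs" "card Zs \<le> (\<Sum>z\<in>?I \<rightarrow>\<^sub>E carrier R. g z ^ Suc (card J))"
  proof -
    show "finite Zs" unfolding Zs_def using finX card_conditions[OF finI] by blast
    have "card Zs \<le> (\<Sum>z\<in>?I \<rightarrow>\<^sub>E carrier R. card (conditions ?I (g z) z))"
      unfolding Zs_def by (rule card_UN_le[OF finX])
    also have "\<dots> \<le> (\<Sum>z\<in>?I \<rightarrow>\<^sub>E carrier R. g z ^ Suc (card J))"
      using card_conditions[OF finI] fin i0 by (intro sum_mono) (simp del: power_Suc)
    finally show "card Zs \<le> (\<Sum>z\<in>?I \<rightarrow>\<^sub>E carrier R. g z ^ Suc (card J))" .
  qed
  have apos: "card (a e) > 0" for e
    unfolding a_def by (rule card_annihilator_pos[OF finA(2)])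
  have Ybound: "m \<le> Suc D \<Longrightarrow> card (Y m) \<le> (\<Prod>e<m. card (a e))" for m
  proof (induction m)
    case 0
    have "c = (\<lambda>\<alpha>\<in>?A. \<zero>)" if "c \<in> Y 0" for c
      using that unfolding Y_def filtered_annihilator_def annihilator_def
      by (intro extensionalityI[of _ ?A]) (auto simp: PiE_def)
    then have "Y 0 \<subseteq> {\<lambda>\<alpha>\<in>?A. \<zero>}" by blast
    then show ?case using card_mono[of "{\<lambda>\<alpha>\<in>?A. \<zero>}" "Y 0"] by simp
  next
    case (Suc m)
    have "card (Y (Suc m)) \<le> card (a m) * card (Y m)"
      unfolding Y_def a_def k_def using Suc.prems
      by (intro card_filtered_annihilator_Suc[OF fin i0 _ x \<Omega> refl]) auto
    also have "\<dots> \<le> card (a m) * (\<Prod>e<m. card (a e))"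
      using Suc by (intro mult_le_mono2) auto
    finally show ?case by (simp add: mult.commute)
  qed
  have "Y (Suc D) = annihilator ?A Zs"
    unfolding Y_def filtered_annihilator_def Zs_def by (auto simp: multi_indices_def)
  then have "card (annihilator ?A Zs) \<le> (\<Prod>e<Suc D. card (a e))"
    using Ybound[of "Suc D"] by simp
  then have "card (annihilator ?A Zs) \<le> (\<Prod>e\<le>D. card (a e))"
    by (simp only: lessThan_Suc_atMost)
  moreover have "?q ^ card ?A \<le> ?q ^ card Zs * card (annihilator ?A Zs)"
    using card_annihilator_Un[OF finA(1) Zs(1), of "{}"] finA(1) by (simp add: annihilator_def card_PiE)
  ultimately have "?q ^ card ?A \<le> ?q ^ card Zs * (\<Prod>e\<le>D. card (a e))"
    by (meson mult_le_mono2 order_trans)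
  then have "real ?q ^ card ?A \<le> real ?q ^ card Zs * (\<Prod>e\<le>D. real (card (a e)))"
    by (metis of_nat_le_iff of_nat_mult of_nat_power of_nat_prod)
  then have "ln (real ?q ^ card ?A) \<le> ln (real ?q ^ card Zs * (\<Prod>e\<le>D. real (card (a e))))"
    using q apos by (subst ln_le_cancel_iff) (auto intro!: mult_pos_pos prod_pos)
  also have "\<dots> = ln (real ?q ^ card Zs) + ln (\<Prod>e\<le>D. real (card (a e)))"
    using q apos by (intro ln_mult_pos) (auto intro!: prod_pos)
  also have "ln (\<Prod>e\<le>D. real (card (a e))) = (\<Sum>e\<le>D. ln (card (a e)))"
    using apos by (intro ln_prod) auto
  finally have "card ?A * ln ?q \<le> card Zs * ln ?q + (\<Sum>e\<le>D. ln (card (a e)))"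
    using q by (simp add: ln_realpow)
  moreover have "real (card ?A) = (\<Sum>e\<le>D. real (card (?B e)))"
    by (simp add: card_multi_indices_insert[OF fin i0])
  ultimately have sum: "(\<Sum>e\<le>D. card (?B e) * ln ?q - ln (card (a e))) \<le> card Zs * ln ?q"
    by (simp add: sum_subtractf sum_distrib_right)
  have "(\<Sum>e\<le>D. card (\<Omega> e) * (card (?B e) * ln ?q)) \<le>
      (\<Sum>e\<le>D. ?q ^ card J * (card (?B e) * ln ?q - ln (card (a e))))"
  proof (rule sum_mono)
    fix e
    \<comment> \<open>\<open>Suc (e div ?q)\<close> is the least \<open>\<kappa>\<close> with
      \<open>e < \<kappa> * ?q\<close>.\<close>
    have "e < Suc (e div ?q) * ?q"
      using q by (metis dividend_less_div_times mult_Suc add.commute less_trans zero_less_one)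
    then have "card (\<Omega> e) * (card (?B e) * ln ?q) \<le> ?q ^ card J * corank (?B e) (conditions J (k e)) (\<Omega> e)"
      by (intro corank_density[OF fin refl, where \<kappa>="Suc (e div ?q)"]) (auto simp: k_def \<Omega>)
    also have "corank (?B e) (conditions J (k e)) (\<Omega> e) = card (?B e) * ln ?q - ln (card (a e))"
      using q finA by (simp add: corank_def a_def card_PiE ln_realpow)
    finally show "card (\<Omega> e) * (card (?B e) * ln ?q) \<le> ?q ^ card J * (card (?B e) * ln ?q - ln (card (a e)))" .
  qed
  also have "\<dots> \<le> ?q ^ card J * (card Zs * ln ?q)"
    unfolding sum_distrib_left[symmetric] using sum by (intro mult_left_mono) auto
  also have "(\<Sum>e\<le>D. card (\<Omega> e) * (card (?B e) * ln ?q)) =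
      (\<Sum>e\<le>D. real (card (\<Omega> e) * card (?B e))) * ln ?q"
    by (simp add: sum_distrib_right mult.assoc)
  also have "?q ^ card J * (card Zs * ln ?q) = real (?q ^ card J * card Zs) * ln ?q"
    by simp
  finally have "(\<Sum>e\<le>D. real (card (\<Omega> e) * card (?B e))) * ln ?q \<le> real (?q ^ card J * card Zs) * ln ?q" .
  then have "(\<Sum>e\<le>D. real (card (\<Omega> e) * card (?B e))) \<le> real (?q ^ card J * card Zs)"
    using q by (simp only: mult_le_cancel_right) simp
  then have "(\<Sum>e\<le>D. card (\<Omega> e) * card (?B e)) \<le> ?q ^ card J * card Zs"
    by (metis of_nat_le_iff of_nat_sum)
  also have "\<dots> \<le> ?q ^ card J * (\<Sum>z\<in>?I \<rightarrow>\<^sub>E carrier R. g z ^ Suc (card J))"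
    using Zs(2) by (rule mult_le_mono2)
  finally show ?thesis .
qed

end

section \<open>Summation over the degree\<close>

text \<open>Discrete version of integrating a power: the increment from \<open>E ^ Suc r\<close> to
  \<open>Suc E ^ Suc r\<close> is at most \<open>Suc r * Suc E ^ r\<close>.\<close>

lemma power_le_sum_powers: "E ^ Suc r \<le> Suc r * (\<Sum>e<E. Suc e ^ r)"
proof (induction E)
  case (Suc E)
  have "Suc E ^ Suc r \<le> E ^ Suc r + Suc r * Suc E ^ r"
  proof -
    have "real (Suc E) ^ Suc r - real E ^ Suc r =
        (real (Suc E) - real E) * (\<Sum>p<Suc r. real (Suc E) ^ p * real E ^ (r - p))"
      unfolding power_diff_sumr2 diff_Suc_Suc by (simp only: mult.commute)
    also have "\<dots> \<le> (\<Sum>p<Suc r. real (Suc E) ^ r)"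
    proof -
      have "real (Suc E) ^ p * real E ^ (r - p) \<le> real (Suc E) ^ r" if "p < Suc r" for p
      proof -
        have "real (Suc E) ^ p * real E ^ (r - p) \<le> real (Suc E) ^ p * real (Suc E) ^ (r - p)"
          by (intro mult_left_mono power_mono) auto
        then show ?thesis using that by (simp flip: power_add)
      qed
      then show ?thesis by (simp del: sum.lessThan_Suc sum_constant) (rule sum_mono, simp)
    qed
    finally have "real (Suc E ^ Suc r) \<le> real (E ^ Suc r + Suc r * Suc E ^ r)"
      by (simp add: algebra_simps)
    then show ?thesis by (simp only: of_nat_le_iff)
  qed
  also have "\<dots> \<le> Suc r * (\<Sum>e<E. Suc e ^ r) + Suc r * Suc E ^ r"
    using Suc by simp
  finally show ?case by (simp add: algebra_simps)
qed simp

text \<open>Recovers a power of a line mass from the levels \<open>Suc r * e < m\<close> it exceeds.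
  The cut-off \<open>D\<close> lets all masses share one finite range of levels.\<close>

lemma power_le_sum_powers_scaled:
  assumes "m \<le> D"
  shows "m ^ Suc r \<le> Suc r ^ (r + 2) * (\<Sum>e\<in>{e. e \<le> D \<and> Suc r * e < m}. Suc e ^ r)"
proof -
  \<comment> \<open>\<open>m / Suc r\<close> rounded up: \<open>Suc r * E\<close> reaches
    \<open>m\<close>, yet every \<open>e < E\<close> still satisfies
    \<open>Suc r * e < m\<close>.\<close>
  define E where "E = (m + r) div Suc r"
  have "m + r = Suc r * E + (m + r) mod Suc r"
    unfolding E_def by (rule mult_div_mod_eq[symmetric])
  moreover have "(m + r) mod Suc r < Suc r" by simp
  ultimately have mE: "m \<le> Suc r * E" and Em: "Suc r * E \<le> m + r" by linarith+
  have sub: "{..<E} \<subseteq> {e. e \<le> D \<and> Suc r * e < m}"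
  proof
    fix e assume "e \<in> {..<E}"
    then have "Suc r * Suc e \<le> Suc r * E" by (intro mult_le_mono2) auto
    then have "Suc r * e < m" using Em by simp
    moreover have "e \<le> Suc r * e" by simp
    ultimately show "e \<in> {e. e \<le> D \<and> Suc r * e < m}" using assms by simp
  qed
  have "m ^ Suc r \<le> (Suc r * E) ^ Suc r" using mE by (rule power_mono) simp
  also have "\<dots> = Suc r ^ Suc r * E ^ Suc r" by (rule power_mult_distrib)
  also have "\<dots> \<le> Suc r ^ Suc r * (Suc r * (\<Sum>e<E. Suc e ^ r))"
    by (intro mult_le_mono2 power_le_sum_powers)
  also have "\<dots> = Suc r ^ (r + 2) * (\<Sum>e<E. Suc e ^ r)" by (simp add: mult_ac del: mult_Suc)
  also have "\<dots> \<le> Suc r ^ (r + 2) * (\<Sum>e\<in>{e. e \<le> D \<and> Suc r * e < m}. Suc e ^ r)"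
    using sub by (intro mult_le_mono2 sum_mono2) auto
  finally show ?thesis .
qed

text \<open>A cube of exponents up to \<open>e div card J\<close> fits into the simplex; the factor
  \<open>card J ^ card J\<close> compensates for its scale and the rounding.\<close>

lemma card_multi_indices_ge:
  assumes "finite J"
  shows "Suc e ^ card J \<le> card J ^ card J * card (multi_indices J e)"
proof (cases "J = {}")
  case False
  then have r: "card J > 0" using assms by auto
  have "J \<rightarrow>\<^sub>E {..e div card J} \<subseteq> multi_indices J e"
  proof
    fix \<alpha> assume \<alpha>: "\<alpha> \<in> J \<rightarrow>\<^sub>E {..e div card J}"
    then have "sum \<alpha> J \<le> (\<Sum>i\<in>J. e div card J)" by (intro sum_mono) auto
    also have "\<dots> \<le> e" by simp
    finally show "\<alpha> \<in> multi_indices J e" using \<alpha> by (auto simp: multi_indices_def)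
  qed
  then have "card (J \<rightarrow>\<^sub>E {..e div card J}) \<le> card (multi_indices J e)"
    using assms by (intro card_mono finite_multi_indices)
  then have c: "Suc (e div card J) ^ card J \<le> card (multi_indices J e)"
    using assms by (simp add: card_PiE)
  have "Suc e \<le> card J * Suc (e div card J)"
    using r by (metis Suc_leI dividend_less_times_div mult_Suc_right add.commute)
  then have "Suc e ^ card J \<le> (card J * Suc (e div card J)) ^ card J"
    by (rule power_mono) simp
  also have "\<dots> \<le> card J ^ card J * card (multi_indices J e)"
    unfolding power_mult_distrib using c by (rule mult_le_mono2)
  finally show ?thesis .
qed (simp add: multi_indices_def)

text \<open>\<open>Suc r ^ (r + 2)\<close> comes from \<open>power_le_sum_powers_scaled\<close> and
  \<open>r ^ r\<close> from \<open>card_multi_indices_ge\<close>.\<close>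

definition kakeya_const :: "nat \<Rightarrow> nat"
  where "kakeya_const r = Suc r ^ (r + 2) * r ^ r"

context field_cover
begin

text \<open>Layer-cake summation: level \<open>e\<close> has weight \<open>Suc e ^ r\<close>, which
  is at most a constant times the number of monomials that weights it in
  \<open>rich_directions\<close>. The base points \<open>x w\<close> are arbitrary, which is how the
  maximum over parallel lines enters.\<close>

lemma kakeya_maximal_nat:
  fixes g :: "('i \<Rightarrow> 'b) \<Rightarrow> nat"
  assumes fin: "finite J" and i0: "i0 \<notin> J"
    and x: "\<And>w. w \<in> J \<rightarrow>\<^sub>E carrier R \<Longrightarrow> x w \<in> insert i0 J \<rightarrow>\<^sub>E carrier R"
  shows "(\<Sum>w\<in>J \<rightarrow>\<^sub>E carrier R. (\<Sum>s\<in>carrier R. g (line_point J i0 (x w) w s)) ^ Suc (card J)) \<le>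
    kakeya_const (card J) * card (carrier R) ^ card J *
      (\<Sum>z\<in>insert i0 J \<rightarrow>\<^sub>E carrier R. g z ^ Suc (card J))"
proof -
  let ?X = "J \<rightarrow>\<^sub>E carrier R" and ?r = "card J"
  define m where "m w = (\<Sum>s\<in>carrier R. g (line_point J i0 (x w) w s))" for w
  define D where "D = sum m ?X"
  define \<Omega> where "\<Omega> e = {w \<in> ?X. Suc ?r * e < m w}" for e
  have finX: "finite ?X" by (rule finite_coeff_group[OF fin])
  have "(\<Sum>w\<in>?X. m w ^ Suc ?r) \<le>
      (\<Sum>w\<in>?X. Suc ?r ^ (?r + 2) * (\<Sum>e\<in>{e. e \<le> D \<and> Suc ?r * e < m w}. Suc e ^ ?r))"
    unfolding D_def using finX by (intro sum_mono power_le_sum_powers_scaled member_le_sum) auto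
  also have "\<dots> = Suc ?r ^ (?r + 2) * (\<Sum>w\<in>?X. \<Sum>e\<le>D. if Suc ?r * e < m w then Suc e ^ ?r else 0)"
  proof -
    have "{e. e \<le> D \<and> Suc ?r * e < m w} = {e \<in> {..D}. Suc ?r * e < m w}" for w by auto
    then show ?thesis unfolding sum_distrib_left[symmetric] by (simp only: sum.inter_filter finite_atMost)
  qed
  also have "(\<Sum>w\<in>?X. \<Sum>e\<le>D. if Suc ?r * e < m w then Suc e ^ ?r else 0) =
      (\<Sum>e\<le>D. card (\<Omega> e) * Suc e ^ ?r)"
    unfolding \<Omega>_def by (subst sum.swap) (simp add: sum.inter_filter[OF finX, symmetric] del: mult_Suc)
  also have "\<dots> \<le> (\<Sum>e\<le>D. card (\<Omega> e) * (?r ^ ?r * card (multi_indices J e)))"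
    by (intro sum_mono mult_le_mono2 card_multi_indices_ge[OF fin])
  also have "\<dots> = ?r ^ ?r * (\<Sum>e\<le>D. card (\<Omega> e) * card (multi_indices J e))"
    by (simp add: sum_distrib_left mult_ac)
  also have "\<dots> \<le> ?r ^ ?r * (card (carrier R) ^ ?r * (\<Sum>z\<in>insert i0 J \<rightarrow>\<^sub>E carrier R. g z ^ Suc ?r))"
    by (intro mult_le_mono2 rich_directions[OF fin i0 x]) (auto simp: \<Omega>_def m_def)
  finally show ?thesis
    by (simp add: m_def kakeya_const_def mult.assoc del: power_Suc)
qed

text \<open>The integer-valued inequality, applied to \<open>\<lfloor>t * f\<rfloor>\<close> and divided by \<open>t ^ (r + 1)\<close>,
  passes to the limit \<open>t \<rightarrow> \<infinity>\<close>.\<close>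

lemma kakeya_maximal_real:
  fixes f :: "('i \<Rightarrow> 'b) \<Rightarrow> real"
  assumes fin: "finite J" and i0: "i0 \<notin> J"
    and x: "\<And>w. w \<in> J \<rightarrow>\<^sub>E carrier R \<Longrightarrow> x w \<in> insert i0 J \<rightarrow>\<^sub>E carrier R"
    and f: "\<And>z. f z \<ge> 0"
  shows "(\<Sum>w\<in>J \<rightarrow>\<^sub>E carrier R. (\<Sum>s\<in>carrier R. f (line_point J i0 (x w) w s)) ^ Suc (card J)) \<le>
    real (kakeya_const (card J)) * card (carrier R) ^ card J *
      (\<Sum>z\<in>insert i0 J \<rightarrow>\<^sub>E carrier R. f z ^ Suc (card J))"
proof -
  let ?X = "J \<rightarrow>\<^sub>E carrier R" and ?Y = "insert i0 J \<rightarrow>\<^sub>E carrier R" and ?N = "Suc (card J)"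
  let ?C = "real (kakeya_const (card J)) * card (carrier R) ^ card J"
  define g where "g t z = nat \<lfloor>real t * f z\<rfloor>" for t :: nat and z
  define h where "h t z = real (g t z) / real t" for t :: nat and z
  have lim: "(\<lambda>t. h t z) \<longlonglongrightarrow> f z" for z
  proof (rule tendsto_sandwich)
    have "f z - 1 / real t \<le> h t z \<and> h t z \<le> f z" if "t \<ge> 1" for t
    proof -
      have "real (g t z) = of_int \<lfloor>real t * f z\<rfloor>"
        using f[of z] by (simp add: g_def)
      then have "real t * f z - 1 \<le> real (g t z)" "real (g t z) \<le> real t * f z" by linarith+
      then have "(real t * f z - 1) / real t \<le> h t z" "h t z \<le> real t * f z / real t"
        unfolding h_def by (intro divide_right_mono; simp)+
      then show ?thesis using that by (simp add: diff_divide_distrib)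
    qed
    then show "\<forall>\<^sub>F t in sequentially. f z - 1 / real t \<le> h t z" "\<forall>\<^sub>F t in sequentially. h t z \<le> f z"
      unfolding eventually_sequentially by blast+
    show "(\<lambda>t. f z - 1 / real t) \<longlonglongrightarrow> f z"
      using tendsto_diff[OF tendsto_const lim_1_over_n, of "f z"] by simp
  qed simp
  have ineq: "(\<Sum>w\<in>?X. (\<Sum>s\<in>carrier R. h t (line_point J i0 (x w) w s)) ^ ?N) \<le> ?C * (\<Sum>z\<in>?Y. h t z ^ ?N)" for t
  proof -
    have "real (\<Sum>w\<in>?X. (\<Sum>s\<in>carrier R. g t (line_point J i0 (x w) w s)) ^ ?N) \<le>
        real (kakeya_const (card J) * card (carrier R) ^ card J * (\<Sum>z\<in>?Y. g t z ^ ?N))"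
      by (simp only: of_nat_le_iff) (rule kakeya_maximal_nat[OF fin i0 x])
    then have "(\<Sum>w\<in>?X. (\<Sum>s\<in>carrier R. real (g t (line_point J i0 (x w) w s))) ^ ?N) / real t ^ ?N
        \<le> ?C * (\<Sum>z\<in>?Y. real (g t z) ^ ?N) / real t ^ ?N"
      by (intro divide_right_mono) (simp_all del: power_Suc)
    then show ?thesis
      by (simp add: h_def sum_divide_distrib[symmetric] power_divide del: power_Suc)
  qed
  show ?thesis
  proof (rule LIMSEQ_le)
    show "(\<lambda>t. \<Sum>w\<in>?X. (\<Sum>s\<in>carrier R. h t (line_point J i0 (x w) w s)) ^ ?N) \<longlonglongrightarrow>
        (\<Sum>w\<in>?X. (\<Sum>s\<in>carrier R. f (line_point J i0 (x w) w s)) ^ ?N)"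
      by (intro tendsto_intros lim)
    show "(\<lambda>t. ?C * (\<Sum>z\<in>?Y. h t z ^ ?N)) \<longlonglongrightarrow> ?C * (\<Sum>z\<in>?Y. f z ^ ?N)"
      by (intro tendsto_intros lim)
  qed (use ineq in auto)
qed

end

section \<open>Finite fields as quotients of integer polynomials\<close>

lemma finite_field_cover:
  assumes "field R" "finite (carrier R)"
  shows "\<exists>\<phi> :: int poly \<Rightarrow> 'b. field_cover R \<phi>"
proof -
  interpret field R by fact
  obtain \<theta> where \<theta>: "\<theta> \<in> carrier (mult_of R)" "carrier (mult_of R) = {\<theta> [^]\<^bsub>R\<^esub> i |i::nat. i \<in> UNIV}"
    using finite_field_mult_group_has_gen[OF assms(2)] by auto
  then have th [simp]: "\<theta> \<in> carrier R" by (simp add: mult_of_def)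
  define num where "num a = add_pow R a \<one>\<^bsub>R\<^esub>" for a :: int
  have num_closed [simp]: "num a \<in> carrier R" for a
    by (simp add: num_def)
  have num_add: "num (a + b) = num a \<oplus>\<^bsub>R\<^esub> num b" for a b
    unfolding num_def by (rule add.int_pow_mult) simp
  have num_mult: "num (a * b) = num a \<otimes>\<^bsub>R\<^esub> num b" for a b
  proof -
    have "num a \<otimes>\<^bsub>R\<^esub> num b = add_pow R a (num b)"
      unfolding num_def by (subst add_pow_ldistr_int) (auto simp flip: num_def)
    also have "\<dots> = num (b * a)"
      unfolding num_def by (rule add.int_pow_pow) simp
    finally show ?thesis by (simp add: mult.commute)
  qed
  have num_0: "num 0 = \<zero>\<^bsub>R\<^esub>"
    using num_add[of 0 0] num_closed[of 0] by (metis a_assoc a_inv_closed add_0 r_neg r_zero)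
  have num_1: "num 1 = \<one>\<^bsub>R\<^esub>"
    by (simp add: num_def)
  \<comment> \<open>Horner evaluation at \<open>\<theta>\<close>, with integers mapped by
    \<open>num\<close>. Monomials already reach every nonzero element because
    \<open>\<theta>\<close> generates the multiplicative group.\<close>
  define \<phi> where "\<phi> p = fold_coeffs (\<lambda>a y. num a \<oplus>\<^bsub>R\<^esub> \<theta> \<otimes>\<^bsub>R\<^esub> y) p \<zero>\<^bsub>R\<^esub>" for p
  have phi_0: "\<phi> 0 = \<zero>\<^bsub>R\<^esub>" by (simp add: \<phi>_def)
  have phi_pCons: "\<phi> (pCons a p) = num a \<oplus>\<^bsub>R\<^esub> \<theta> \<otimes>\<^bsub>R\<^esub> \<phi> p" for a p
    by (cases "p = 0"; cases "a = 0") (auto simp: \<phi>_def num_0)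
  have closed [simp]: "\<phi> p \<in> carrier R" for p
    by (induction p) (simp_all add: phi_0 phi_pCons)
  have add: "\<phi> (p + q) = \<phi> p \<oplus>\<^bsub>R\<^esub> \<phi> q" for p q
  proof (induction p q rule: poly_induct2)
    case (pCons a p b q)
    have "num a \<oplus>\<^bsub>R\<^esub> num b \<oplus>\<^bsub>R\<^esub> (\<theta> \<otimes>\<^bsub>R\<^esub> \<phi> p \<oplus>\<^bsub>R\<^esub> \<theta> \<otimes>\<^bsub>R\<^esub> \<phi> q) =
        num a \<oplus>\<^bsub>R\<^esub> \<theta> \<otimes>\<^bsub>R\<^esub> \<phi> p \<oplus>\<^bsub>R\<^esub> (num b \<oplus>\<^bsub>R\<^esub> \<theta> \<otimes>\<^bsub>R\<^esub> \<phi> q)"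
      by (simp add: a_ac)
    then show ?case
      by (simp add: phi_pCons num_add pCons r_distr)
  qed (simp add: phi_0)
  have smult: "\<phi> (smult a p) = num a \<otimes>\<^bsub>R\<^esub> \<phi> p" for a p
  proof (induction p)
    case (pCons b p)
    then show ?case by (simp add: phi_pCons num_mult r_distr m_lcomm)
  qed (simp add: phi_0)
  have mult: "\<phi> (p * q) = \<phi> p \<otimes>\<^bsub>R\<^esub> \<phi> q" for p q
  proof (induction p)
    case (pCons a p)
    then show ?case by (simp add: phi_pCons add smult num_0 l_distr m_assoc)
  qed (simp add: phi_0)
  have one: "\<phi> 1 = \<one>\<^bsub>R\<^esub>"
    by (simp add: one_pCons phi_pCons phi_0 num_1)
  have power: "\<phi> (monom 1 i) = \<theta> [^]\<^bsub>R\<^esub> i" for i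
    by (induction i) (simp_all add: monom_0 monom_Suc phi_pCons phi_0 num_0 num_1 m_comm)
  have "carrier R \<subseteq> range \<phi>"
  proof
    fix y assume "y \<in> carrier R"
    then consider "y = \<zero>\<^bsub>R\<^esub>" | "y \<in> carrier (mult_of R)" by (auto simp: mult_of_def)
    then show "y \<in> range \<phi>"
    proof cases
      case 1
      then show ?thesis using phi_0 by (metis rangeI)
    next
      case 2
      then obtain i :: nat where "y = \<theta> [^]\<^bsub>R\<^esub> i" unfolding \<theta>(2) by blast
      then have "y = \<phi> (monom 1 i)" by (simp add: power)
      then show ?thesis by blast
    qed
  qed
  then have "field_cover R \<phi>"
    by unfold_locales (auto simp: add mult one assms(2))
  then show ?thesis by blast
qed

subsection \<open>Projection of horizontal lines\<close>

definition join_vecs :: "nat \<Rightarrow> (nat \<Rightarrow> 'a) \<times> (nat \<Rightarrow> 'a) \<Rightarrow> nat \<Rightarrow> 'a"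
  where "join_vecs n v = (\<lambda>i\<in>{..<2 * n}. if i < n then fst v i else snd v (i - n))"

definition split_vecs :: "nat \<Rightarrow> (nat \<Rightarrow> 'a) \<Rightarrow> (nat \<Rightarrow> 'a) \<times> (nat \<Rightarrow> 'a)"
  where "split_vecs n z = (\<lambda>i\<in>{..<n}. z i, \<lambda>i\<in>{..<n}. z (n + i))"

lemma join_vecs_closed:
  assumes "v \<in> vecs R n \<times> vecs R n"
  shows "join_vecs n v \<in> {..<2 * n} \<rightarrow>\<^sub>E carrier R"
proof -
  have "fst v i \<in> carrier R" "snd v i \<in> carrier R" if "i < n" for i
    using assms that by (auto simp: vecs_def mem_Times_iff PiE_iff)
  then show ?thesis by (simp add: join_vecs_def)
qed

lemma split_vecs_closed: "z \<in> {..<2 * n} \<rightarrow>\<^sub>E carrier R \<Longrightarrow> split_vecs n z \<in> vecs R n \<times> vecs R n"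
  by (simp add: split_vecs_def vecs_def PiE_iff)

lemma split_vecs_join_vecs:
  assumes "v \<in> vecs R n \<times> vecs R n"
  shows "split_vecs n (join_vecs n v) = v"
proof -
  have "(\<lambda>i\<in>{..<n}. join_vecs n v i) = fst v" "(\<lambda>i\<in>{..<n}. join_vecs n v (n + i)) = snd v"
    using assms by (auto simp: join_vecs_def vecs_def PiE_def intro!: extensionalityI[of _ "{..<n}"])
  then show ?thesis by (simp add: split_vecs_def)
qed

lemma join_vecs_split_vecs:
  assumes "z \<in> {..<2 * n} \<rightarrow>\<^sub>E carrier R"
  shows "join_vecs n (split_vecs n z) = z"
  using assms by (auto simp: join_vecs_def split_vecs_def PiE_def intro!: extensionalityI[of _ "{..<2 * n}"])

text \<open>Discards the central coordinate, after which horizontal lines are ordinary lines. The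
  supremum of a power is at most its sum over the fibre, so no norm increases.\<close>

definition fibre_sup :: "('a, 'm) ring_scheme \<Rightarrow> nat \<Rightarrow> ('a heis \<Rightarrow> complex) \<Rightarrow> (nat \<Rightarrow> 'a) \<Rightarrow> real"
  where "fibre_sup R n F z = Max ((\<lambda>t. norm (F (fst (split_vecs n z), snd (split_vecs n z), t))) ` carrier R)"

context field
begin

lemma vec_smult_closed: "c \<in> carrier R \<Longrightarrow> x \<in> vecs R n \<Longrightarrow> vec_smult R n c x \<in> vecs R n"
  by (auto simp: vec_smult_def vecs_def)

lemma proportionalI:
  "(a, b) \<in> nonzero_vecs R n \<Longrightarrow> (a', b') \<in> nonzero_vecs R n \<Longrightarrow> c \<in> carrier R \<Longrightarrow> c \<noteq> \<zero> \<Longrightarrow>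
    a' = vec_smult R n c a \<Longrightarrow> b' = vec_smult R n c b \<Longrightarrow> ((a, b), (a', b')) \<in> proportional R n"
  unfolding proportional_def by blast

lemma equiv_proportional: "equiv (nonzero_vecs R n) (proportional R n)"
proof (rule equivI)
  have vec: "a \<in> vecs R n \<and> b \<in> vecs R n" if "(a, b) \<in> nonzero_vecs R n" for a b
    using that by (auto simp: nonzero_vecs_def)
  show "proportional R n \<subseteq> nonzero_vecs R n \<times> nonzero_vecs R n"
    unfolding proportional_def by blast
  show "refl_on (nonzero_vecs R n) (proportional R n)"
  proof (rule refl_onI, clarify)
    fix a b assume ab: "(a, b) \<in> nonzero_vecs R n"
    show "((a, b), (a, b)) \<in> proportional R n"
      using vec[OF ab] by (intro proportionalI[OF ab ab, of \<one>]) (simp_all add: vec_smult_one[OF field_axioms])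
  qed
  show "sym (proportional R n)"
  proof (rule symI, clarify)
    fix a b a' b' assume *: "((a, b), (a', b')) \<in> proportional R n"
    then obtain c where c: "c \<in> carrier R" "c \<noteq> \<zero>" "a' = vec_smult R n c a" "b' = vec_smult R n c b"
      and nz: "(a, b) \<in> nonzero_vecs R n" "(a', b') \<in> nonzero_vecs R n"
      unfolding proportional_def by blast
    have u: "c \<in> Units R" using c by (simp add: field_Units)
    have "inv c \<noteq> \<zero>" using u by (metis Units_inv_Units Units_l_inv c(1) l_null zero_not_one)
    then show "((a', b'), (a, b)) \<in> proportional R n"
      using vec[OF nz(1)] u c
      by (intro proportionalI[OF nz(2,1), of "inv c"])
         (simp_all add: vec_smult_assoc[OF field_axioms] vec_smult_one[OF field_axioms] Units_l_inv)
  qed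
  show "trans (proportional R n)"
  proof (rule transI, clarify)
    fix a b a' b' a'' b''
    assume "((a, b), (a', b')) \<in> proportional R n" "((a', b'), (a'', b'')) \<in> proportional R n"
    then obtain c d where c: "c \<in> carrier R" "c \<noteq> \<zero>" "a' = vec_smult R n c a" "b' = vec_smult R n c b"
      and d: "d \<in> carrier R" "d \<noteq> \<zero>" "a'' = vec_smult R n d a'" "b'' = vec_smult R n d b'"
      and nz: "(a, b) \<in> nonzero_vecs R n" "(a'', b'') \<in> nonzero_vecs R n"
      unfolding proportional_def by blast
    show "((a, b), (a'', b'')) \<in> proportional R n"
      using vec[OF nz(1)] c d
      by (intro proportionalI[OF nz, of "d \<otimes> c"])
         (simp_all add: vec_smult_assoc[OF field_axioms] integral_iff)
  qed
qed

lemma join_vecs_nonzero: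
  assumes "v \<in> nonzero_vecs R n"
  shows "\<exists>i<2 * n. join_vecs n v i \<noteq> \<zero>"
proof (rule ccontr)
  assume *: "\<not> ?thesis"
  have v: "v \<in> vecs R n \<times> vecs R n" using assms by (simp add: nonzero_vecs_def)
  have "v = split_vecs n (join_vecs n v)" using split_vecs_join_vecs[OF v] by simp
  also have "\<dots> = (vec_zero R n, vec_zero R n)"
    using * by (auto simp: split_vecs_def vec_zero_def intro!: restrict_ext)
  finally show False using assms by (simp add: nonzero_vecs_def)
qed

text \<open>Scaling by the inverse of a nonzero coordinate moves a representative into one of the
  affine charts of \<open>line_point\<close>.\<close>

lemma direction_representative:
  assumes "D \<in> directions R n"
  shows "\<exists>i v. i < 2 * n \<and> v \<in> D \<and> v \<in> nonzero_vecs R n \<and> join_vecs n v i = \<one> \<and>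
    (\<forall>p. horizontal_line R n p D = line_through R n p v)"
proof -
  obtain v where v: "v \<in> nonzero_vecs R n" "D = proportional R n `` {v}"
    using assms unfolding directions_def by (auto elim: quotientE)
  obtain a b where ab: "v = (a, b)" by (cases v)
  have vec: "a \<in> vecs R n" "b \<in> vecs R n" using v(1) unfolding ab nonzero_vecs_def by auto
  obtain i where i: "i < 2 * n" "join_vecs n v i \<noteq> \<zero>" using join_vecs_nonzero[OF v(1)] by blast
  have fi: "join_vecs n v i \<in> carrier R"
    using join_vecs_closed[of v R n] vec i(1) unfolding ab by (auto dest: PiE_mem)
  have u: "join_vecs n v i \<in> Units R" using fi i(2) by (simp add: field_Units)
  define c where "c = inv (join_vecs n v i)"
  have c: "c \<in> carrier R" "c \<otimes> join_vecs n v i = \<one>" using u by (simp_all add: c_def)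
  then have c0: "c \<noteq> \<zero>" using fi by auto
  define v' where "v' = (vec_smult R n c a, vec_smult R n c b)"
  have "join_vecs n v' i = c \<otimes> join_vecs n v i"
    using i(1) by (auto simp: join_vecs_def v'_def ab vec_smult_def)
  then have one: "join_vecs n v' i = \<one>" using c(2) by simp
  have "v' \<noteq> (vec_zero R n, vec_zero R n)"
    using one i(1) by (auto simp: join_vecs_def vec_zero_def split: if_splits)
  then have v': "v' \<in> nonzero_vecs R n"
    using vec c(1) by (simp add: nonzero_vecs_def v'_def vec_smult_closed)
  then have vv: "(v, v') \<in> proportional R n"
    using v(1) c(1) c0 unfolding ab v'_def by (intro proportionalI) auto
  have "horizontal_line R n p D = line_through R n p v'" for p
    using horizontal_line_representative[OF field_axioms v(1)] line_through_proportional[OF field_axioms vv]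
    unfolding v(2) by simp
  then show ?thesis using i(1) vv v' one v(2) by blast
qed

lemma finite_vecs: "finite (carrier R) \<Longrightarrow> finite (vecs R n)"
  unfolding vecs_def by (rule finite_PiE) auto

lemma finite_heisenberg: "finite (carrier R) \<Longrightarrow> finite (carrier (heisenberg R n))"
  by (simp add: heisenberg_def finite_vecs)

lemma finite_directions: "finite (carrier R) \<Longrightarrow> finite (directions R n)"
  unfolding directions_def
  by (rule finite_quotient) (auto simp: finite_vecs nonzero_vecs_def proportional_def)

lemma maximal_op_attained:
  assumes "finite (carrier R)"
  shows "\<exists>p\<in>carrier (heisenberg R n). maximal_op R n F D = (\<Sum>x\<in>horizontal_line R n p D. norm (F x))"
proof -
  have "(vec_zero R n, vec_zero R n, \<zero>) \<in> carrier (heisenberg R n)"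
    by (auto simp: heisenberg_def vecs_def vec_zero_def)
  then have "maximal_op R n F D \<in> (\<lambda>p. \<Sum>x\<in>horizontal_line R n p D. norm (F x)) ` carrier (heisenberg R n)"
    unfolding maximal_op_def using finite_heisenberg[OF assms] by (intro Max_in) auto
  then show ?thesis by auto
qed

lemma norm_le_fibre_sup:
  assumes "finite (carrier R)" "t \<in> carrier R" "split_vecs n z = (x, y)"
  shows "norm (F (x, y, t)) \<le> fibre_sup R n F z"
  unfolding fibre_sup_def using assms by (intro Max_ge) auto

lemma vec_dot_closed:
  "x \<in> vecs R n \<Longrightarrow> y \<in> vecs R n \<Longrightarrow> vec_dot R n x y \<in> carrier R"
  unfolding vec_dot_def by (rule finsum_closed) (auto simp: vecs_def)

text \<open>The central coordinate \<open>\<tau>\<close> varies with \<open>s\<close> through the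
  dot products, but it only has to lie in the field: the supremum over the fibre absorbs it.\<close>

lemma sum_line_through_le:
  assumes fin: "finite (carrier R)" and p: "p \<in> carrier (heisenberg R n)"
    and v: "v \<in> nonzero_vecs R n" and i: "i < 2 * n" "join_vecs n v i = \<one>"
  shows "(\<Sum>x\<in>line_through R n p v. norm (F x)) \<le>
    (\<Sum>s\<in>carrier R. fibre_sup R n F (line_point ({..<2 * n} - {i}) i
       (join_vecs n (fst p, fst (snd p))) (restrict (join_vecs n v) ({..<2 * n} - {i})) s))"
proof -
  obtain x y t where xyt: "p = (x, y, t)" by (cases p)
  obtain a b where ab: "v = (a, b)" by (cases v)
  have vec: "x \<in> vecs R n" "y \<in> vecs R n" "t \<in> carrier R" "a \<in> vecs R n" "b \<in> vecs R n"
    using p v unfolding xyt ab by (auto simp: heisenberg_def nonzero_vecs_def)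
  define pt where "pt s = p \<otimes>\<^bsub>heisenberg R n\<^esub> (vec_smult R n s a, vec_smult R n s b, \<zero>)" for s
  have "line_through R n p v = pt ` carrier R"
    unfolding line_through_def pt_def ab by auto
  then have "(\<Sum>x\<in>line_through R n p v. norm (F x)) \<le> (\<Sum>s\<in>carrier R. norm (F (pt s)))"
    using sum_image_le[OF fin, of "\<lambda>x. norm (F x)" pt] by (simp add: o_def)
  also have "\<dots> \<le> (\<Sum>s\<in>carrier R. fibre_sup R n F (line_point ({..<2 * n} - {i}) i
       (join_vecs n (fst p, fst (snd p))) (restrict (join_vecs n v) ({..<2 * n} - {i})) s))"
  proof (rule sum_mono)
    fix s assume s: "s \<in> carrier R"
    define \<tau> where "\<tau> = t \<oplus> \<zero> \<oplus> (vec_dot R n x (vec_smult R n s b) \<ominus> vec_dot R n y (vec_smult R n s a))"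
    have "pt s = (vec_add R n x (vec_smult R n s a), vec_add R n y (vec_smult R n s b), \<tau>)"
      by (simp add: pt_def xyt heisenberg_def \<tau>_def)
    moreover have "\<tau> \<in> carrier R"
      unfolding \<tau>_def using vec s by (intro a_closed minus_closed vec_dot_closed vec_smult_closed) auto
    moreover have "split_vecs n (line_point ({..<2 * n} - {i}) i (join_vecs n (fst p, fst (snd p)))
        (restrict (join_vecs n v) ({..<2 * n} - {i})) s) =
        (vec_add R n x (vec_smult R n s a), vec_add R n y (vec_smult R n s b))"
    proof -
      have "line_point ({..<2 * n} - {i}) i (join_vecs n (fst p, fst (snd p)))
          (restrict (join_vecs n v) ({..<2 * n} - {i})) s j = join_vecs n (x, y) j \<oplus> s \<otimes> join_vecs n v j"
        if "j < 2 * n" for j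
        using that i by (auto simp: line_point_def xyt)
      then have "split_vecs n (line_point ({..<2 * n} - {i}) i (join_vecs n (fst p, fst (snd p)))
          (restrict (join_vecs n v) ({..<2 * n} - {i})) s) =
          (\<lambda>j\<in>{..<n}. join_vecs n (x, y) j \<oplus> s \<otimes> join_vecs n v j,
           \<lambda>j\<in>{..<n}. join_vecs n (x, y) (n + j) \<oplus> s \<otimes> join_vecs n v (n + j))"
        unfolding split_vecs_def by (auto intro!: restrict_ext)
      then show ?thesis
        by (auto simp: join_vecs_def vec_add_def vec_smult_def ab intro!: restrict_ext)
    qed
    ultimately show "norm (F (pt s)) \<le> fibre_sup R n F (line_point ({..<2 * n} - {i}) i
       (join_vecs n (fst p, fst (snd p))) (restrict (join_vecs n v) ({..<2 * n} - {i})) s)"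
      using norm_le_fibre_sup[OF fin] by simp
  qed
  finally show ?thesis .
qed

lemma line_point_closed:
  assumes "x \<in> insert i0 J \<rightarrow>\<^sub>E carrier R" "w \<in> J \<rightarrow>\<^sub>E carrier R" "s \<in> carrier R"
  shows "line_point J i0 x w s \<in> insert i0 J \<rightarrow>\<^sub>E carrier R"
  using assms unfolding line_point_def by (auto simp: PiE_iff intro!: a_closed m_closed)

lemma inj_on_line_point:
  assumes "x i0 \<in> carrier R"
  shows "inj_on (line_point J i0 x w) (carrier R)"
proof (rule inj_onI)
  fix s s' assume s: "s \<in> carrier R" "s' \<in> carrier R" and eq: "line_point J i0 x w s = line_point J i0 x w s'"
  have "x i0 \<oplus> s = x i0 \<oplus> s'"
    using fun_cong[OF eq, of i0] s by (simp add: line_point_def)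
  then show "s = s'" using s assms by (metis add.inv_closed a_assoc l_neg l_zero)
qed

text \<open>Every direction has a representative with some coordinate equal to one, so that the
  directions are covered by the \<open>2 * n\<close> affine charts of \<open>kakeya_maximal_real\<close>.\<close>

lemma maximal_op_linearization:
  fixes F :: "'a heis \<Rightarrow> complex"
  assumes fin: "finite (carrier R)" and n: "n \<ge> 1"
  defines "Z \<equiv> {..<2 * n} \<rightarrow>\<^sub>E carrier R" and "q \<equiv> card (carrier R)"
  shows "card (directions R n) \<le> 2 * n * q ^ (2 * n - 1)"
    and "\<exists>L. (\<forall>D\<in>directions R n. inj_on (L D) (carrier R) \<and> L D ` carrier R \<subseteq> Z \<and>
          maximal_op R n F D \<le> (\<Sum>s\<in>carrier R. fibre_sup R n F (L D s))) \<and>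
      (\<forall>f. (\<forall>z. 0 \<le> f z) \<longrightarrow>
        (\<Sum>D\<in>directions R n. (\<Sum>s\<in>carrier R. f (L D s)) ^ (2 * n)) \<le>
        real (2 * n * kakeya_const (2 * n - 1)) * real q ^ (2 * n - 1) * (\<Sum>z\<in>Z. f z ^ (2 * n)))"
proof -
  let ?I = "{..<2 * n}" and ?\<Delta> = "directions R n"
  have "\<forall>D\<in>?\<Delta>. \<exists>i v. i < 2 * n \<and> v \<in> D \<and> v \<in> nonzero_vecs R n \<and> join_vecs n v i = \<one> \<and>
    (\<forall>p. horizontal_line R n p D = line_through R n p v)"
    using direction_representative by blast
  then obtain \<iota> V where rep: "\<And>D. D \<in> ?\<Delta> \<Longrightarrow> \<iota> D < 2 * n \<and> V D \<in> D \<and> V D \<in> nonzero_vecs R n \<and>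
      join_vecs n (V D) (\<iota> D) = \<one> \<and> (\<forall>p. horizontal_line R n p D = line_through R n p (V D))"
    by metis
  \<comment> \<open>Fixing a maximising base point for each direction linearises the operator. The
    lines depend on \<open>F\<close>, but the estimate along them holds for every \<open>f\<close>,
    and interpolation needs it for powers of \<open>fibre_sup\<close>.\<close>
  obtain P where P: "\<And>D. P D \<in> carrier (heisenberg R n) \<and>
      maximal_op R n F D = (\<Sum>x\<in>horizontal_line R n (P D) D. norm (F x))"
    using maximal_op_attained[OF fin] by metis
  define J where "J i = ?I - {i}" for i
  have J: "finite (J i)" "i \<notin> J i" "card (J i) = 2 * n - 1" "insert i (J i) = ?I" if "i < 2 * n" for i
    using that by (auto simp: J_def)
  define W where "W D = restrict (join_vecs n (V D)) (J (\<iota> D))" for D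
  define X where "X D = join_vecs n (fst (P D), fst (snd (P D)))" for D
  define \<Delta> where "\<Delta> i = {D \<in> ?\<Delta>. \<iota> D = i}" for i
  have finD: "finite ?\<Delta>" by (rule finite_directions[OF fin])
  have V: "join_vecs n (V D) \<in> Z" if "D \<in> ?\<Delta>" for D
    using rep[OF that] join_vecs_closed[of "V D" R n] by (auto simp: nonzero_vecs_def Z_def)
  have W: "W D \<in> J (\<iota> D) \<rightarrow>\<^sub>E carrier R" if "D \<in> ?\<Delta>" for D
    using V[OF that] by (auto simp: W_def J_def Z_def)
  have X: "X D \<in> Z" for D
    using P[of D] join_vecs_closed[of "(fst (P D), fst (snd (P D)))" R n]
    by (auto simp: X_def heisenberg_def Z_def)
  \<comment> \<open>Within a chart, \<open>W D\<close> determines the representative, and classes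
    sharing a representative coincide.\<close>
  have injW: "inj_on W (\<Delta> i)" for i
  proof (rule inj_onI)
    fix D D' assume *: "D \<in> \<Delta> i" "D' \<in> \<Delta> i" "W D = W D'"
    then have D: "D \<in> ?\<Delta>" "D' \<in> ?\<Delta>" "\<iota> D = i" "\<iota> D' = i" by (auto simp: \<Delta>_def)
    have "join_vecs n (V D) = join_vecs n (V D')"
    proof (rule extensionalityI[of _ ?I])
      fix j assume j: "j \<in> ?I"
      show "join_vecs n (V D) j = join_vecs n (V D') j"
      proof (cases "j = i")
        case True
        then show ?thesis using rep[OF D(1)] rep[OF D(2)] D(3,4) by simp
      next
        case False
        then show ?thesis using fun_cong[OF *(3), of j] j D(3,4) by (simp add: W_def J_def)
      qed
    qed (use V D in \<open>auto simp: Z_def PiE_def\<close>)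
    moreover have "V D \<in> vecs R n \<times> vecs R n" "V D' \<in> vecs R n \<times> vecs R n"
      using rep[OF D(1)] rep[OF D(2)] by (auto simp: nonzero_vecs_def)
    ultimately have "V D = V D'" by (metis split_vecs_join_vecs)
    then have "V D \<in> D \<inter> D'" using rep[OF D(1)] rep[OF D(2)] by auto
    then show "D = D'"
      using quotient_disj[OF equiv_proportional] D(1,2) unfolding directions_def by blast
  qed
  have split: "?\<Delta> = (\<Union>i\<in>?I. \<Delta> i)" using rep by (auto simp: \<Delta>_def)
  have "card (\<Delta> i) \<le> q ^ (2 * n - 1)" if i: "i < 2 * n" for i
  proof -
    have "card (\<Delta> i) \<le> card (J i \<rightarrow>\<^sub>E carrier R)"
      using fin J[OF i] W by (intro card_inj_on_le[OF injW]) (auto simp: \<Delta>_def intro!: finite_PiE)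
    then show ?thesis using J[OF i] by (simp add: card_PiE q_def)
  qed
  then have "(\<Sum>i\<in>?I. card (\<Delta> i)) \<le> (\<Sum>i\<in>?I. q ^ (2 * n - 1))" by (intro sum_mono) auto
  moreover have "card ?\<Delta> \<le> (\<Sum>i\<in>?I. card (\<Delta> i))"
    by (subst split) (rule card_UN_le, simp)
  ultimately show "card (directions R n) \<le> 2 * n * q ^ (2 * n - 1)" by simp
  define L where "L D = line_point (J (\<iota> D)) (\<iota> D) (X D) (W D)" for D
  have "inj_on (L D) (carrier R) \<and> L D ` carrier R \<subseteq> Z \<and>
      maximal_op R n F D \<le> (\<Sum>s\<in>carrier R. fibre_sup R n F (L D s))" if D: "D \<in> ?\<Delta>" for D
  proof (intro conjI)
    have i: "\<iota> D < 2 * n" using rep[OF D] by blast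
    show "inj_on (L D) (carrier R)"
      unfolding L_def using X[of D] i by (intro inj_on_line_point) (auto simp: Z_def)
    show "L D ` carrier R \<subseteq> Z"
      using line_point_closed[of "X D" "\<iota> D" "J (\<iota> D)" "W D"] X[of D] W[OF D] J(4)[OF i]
      by (auto simp: L_def Z_def)
    have "maximal_op R n F D = (\<Sum>x\<in>line_through R n (P D) (V D). norm (F x))"
      using P[of D] rep[OF D] by simp
    also have "\<dots> \<le> (\<Sum>s\<in>carrier R. fibre_sup R n F (L D s))"
      unfolding L_def X_def W_def J_def using P[of D] rep[OF D]
      by (intro sum_line_through_le[OF fin]) auto
    finally show "maximal_op R n F D \<le> (\<Sum>s\<in>carrier R. fibre_sup R n F (L D s))" .
  qed
  moreover have "(\<Sum>D\<in>?\<Delta>. (\<Sum>s\<in>carrier R. f (L D s)) ^ (2 * n)) \<le>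
        real (2 * n * kakeya_const (2 * n - 1)) * real q ^ (2 * n - 1) * (\<Sum>z\<in>Z. f z ^ (2 * n))"
    if f: "\<And>z. 0 \<le> f z" for f
  proof -
    obtain \<phi> :: "int poly \<Rightarrow> 'a" where "field_cover R \<phi>"
      using finite_field_cover[OF field_axioms fin] by blast
    then interpret C: field_cover R \<phi> .
    let ?B = "real (kakeya_const (2 * n - 1)) * real q ^ (2 * n - 1) * (\<Sum>z\<in>Z. f z ^ (2 * n))"
    have chart: "(\<Sum>D\<in>\<Delta> i. (\<Sum>s\<in>carrier R. f (L D s)) ^ (2 * n)) \<le> ?B" if i: "i < 2 * n" for i
    proof -
      \<comment> \<open>Parameters \<open>w\<close> that come from no direction get the zero vector
        as base point; their nonnegative terms only enlarge the sum.\<close>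
      define x where "x w = (if w \<in> W ` \<Delta> i then X (inv_into (\<Delta> i) W w) else (\<lambda>j\<in>?I. \<zero>))" for w
      have x: "x w \<in> insert i (J i) \<rightarrow>\<^sub>E carrier R" for w
        using X J(4)[OF i] by (auto simp: x_def Z_def)
      have sn: "Suc (card (J i)) = 2 * n" using J(3)[OF i] n by simp
      have "(\<Sum>D\<in>\<Delta> i. (\<Sum>s\<in>carrier R. f (L D s)) ^ (2 * n)) =
          (\<Sum>D\<in>\<Delta> i. (\<Sum>s\<in>carrier R. f (line_point (J i) i (x (W D)) (W D) s)) ^ (2 * n))"
        using injW[of i] by (intro sum.cong refl) (auto simp: L_def x_def \<Delta>_def)
      also have "\<dots> = (\<Sum>w\<in>W ` \<Delta> i. (\<Sum>s\<in>carrier R. f (line_point (J i) i (x w) w s)) ^ (2 * n))"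
        by (simp add: sum.reindex[OF injW])
      also have "\<dots> \<le> (\<Sum>w\<in>J i \<rightarrow>\<^sub>E carrier R. (\<Sum>s\<in>carrier R. f (line_point (J i) i (x w) w s)) ^ (2 * n))"
        using fin J(1)[OF i] W f
        by (intro sum_mono2) (auto simp: \<Delta>_def intro!: finite_PiE zero_le_power sum_nonneg)
      also have "\<dots> \<le> ?B"
        using C.kakeya_maximal_real[OF J(1,2)[OF i], of x f] x f sn
        by (simp add: J(3,4)[OF i] Z_def q_def)
      finally show ?thesis .
    qed
    have "(\<Sum>D\<in>?\<Delta>. (\<Sum>s\<in>carrier R. f (L D s)) ^ (2 * n)) =
        (\<Sum>i\<in>?I. \<Sum>D\<in>\<Delta> i. (\<Sum>s\<in>carrier R. f (L D s)) ^ (2 * n))"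
      unfolding split using finD by (intro sum.UNION_disjoint) (auto simp: \<Delta>_def)
    also have "\<dots> \<le> (\<Sum>i\<in>?I. ?B)" by (intro sum_mono chart) auto
    finally show ?thesis by (simp add: mult_ac)
  qed
  ultimately show "\<exists>L. (\<forall>D\<in>directions R n. inj_on (L D) (carrier R) \<and> L D ` carrier R \<subseteq> Z \<and>
          maximal_op R n F D \<le> (\<Sum>s\<in>carrier R. fibre_sup R n F (L D s))) \<and>
      (\<forall>f. (\<forall>z. 0 \<le> f z) \<longrightarrow>
        (\<Sum>D\<in>directions R n. (\<Sum>s\<in>carrier R. f (L D s)) ^ (2 * n)) \<le>
        real (2 * n * kakeya_const (2 * n - 1)) * real q ^ (2 * n - 1) * (\<Sum>z\<in>Z. f z ^ (2 * n)))"
    by (intro exI[of _ L]) blast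
qed

end

subsection \<open>Interpolation\<close>

text \<open>Concavity of the logarithm, as \<open>ln t \<le> t - 1\<close> at the quotients of
  \<open>x\<close>, \<open>y\<close>, \<open>z\<close> by their weighted mean
  \<open>m\<close>.\<close>

lemma weighted_am_gm3:
  fixes x y z :: real
  assumes "x > 0" "y > 0" "z > 0" "\<kappa> \<ge> 0" "\<mu> \<ge> 0" "\<nu> \<ge> 0" "\<kappa> + \<mu> + \<nu> = 1"
  shows "x powr \<kappa> * y powr \<mu> * z powr \<nu> \<le> \<kappa> * x + \<mu> * y + \<nu> * z"
proof -
  define m where "m = \<kappa> * x + \<mu> * y + \<nu> * z"
  have "m > 0"
  proof -
    have "\<kappa> > 0 \<or> \<mu> > 0 \<or> \<nu> > 0" using assms by linarith
    then show ?thesis unfolding m_def using assms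
      by (smt (verit) mult_nonneg_nonneg mult_pos_pos)
  qed
  have ln: "ln t - ln m \<le> t / m - 1" if "t > 0" for t
    using ln_le_minus_one[of "t / m"] that \<open>m > 0\<close> by (simp add: ln_div)
  have "\<kappa> * (ln x - ln m) + \<mu> * (ln y - ln m) + \<nu> * (ln z - ln m) \<le>
      \<kappa> * (x / m - 1) + \<mu> * (y / m - 1) + \<nu> * (z / m - 1)"
    using assms by (intro add_mono mult_left_mono ln) auto
  also have "\<dots> = (\<kappa> * x + \<mu> * y + \<nu> * z) / m - (\<kappa> + \<mu> + \<nu>)"
    by (simp add: algebra_simps add_divide_distrib)
  also have "\<dots> = m / m - (\<kappa> + \<mu> + \<nu>)" by (simp only: m_def)
  also have "\<dots> = 0" using \<open>m > 0\<close> assms by simp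
  finally have "\<kappa> * ln x + \<mu> * ln y + \<nu> * ln z \<le> (\<kappa> + \<mu> + \<nu>) * ln m"
    by (simp add: algebra_simps)
  then have "exp (\<kappa> * ln x + \<mu> * ln y + \<nu> * ln z) \<le> exp (ln m)"
    using assms by simp
  then show ?thesis
    using assms \<open>m > 0\<close> by (simp add: powr_def exp_add m_def)
qed

text \<open>Normalise the three sums and apply \<open>weighted_am_gm3\<close> to each term. Since
  \<open>0 powr 0 = 0\<close>, a vanishing sum makes both sides zero even when its weight is
  zero.\<close>

lemma Holder_sum3:
  fixes f g h :: "'x \<Rightarrow> real"
  assumes "finite S" and nn: "\<And>x. x \<in> S \<Longrightarrow> f x \<ge> 0" "\<And>x. x \<in> S \<Longrightarrow> g x \<ge> 0" "\<And>x. x \<in> S \<Longrightarrow> h x \<ge> 0"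
    and w: "\<kappa> \<ge> 0" "\<mu> \<ge> 0" "\<nu> \<ge> 0" "\<kappa> + \<mu> + \<nu> = 1"
  shows "(\<Sum>x\<in>S. f x powr \<kappa> * g x powr \<mu> * h x powr \<nu>) \<le> sum f S powr \<kappa> * sum g S powr \<mu> * sum h S powr \<nu>"
proof (cases "sum f S = 0 \<or> sum g S = 0 \<or> sum h S = 0")
  case True
  then have "(\<forall>x\<in>S. f x = 0) \<or> (\<forall>x\<in>S. g x = 0) \<or> (\<forall>x\<in>S. h x = 0)"
    using assms by (auto simp: sum_nonneg_eq_0_iff)
  then have "(\<Sum>x\<in>S. f x powr \<kappa> * g x powr \<mu> * h x powr \<nu>) = 0" by (intro sum.neutral) auto
  then show ?thesis by simp
next
  case False
  define a b c where "a = sum f S" and "b = sum g S" and "c = sum h S"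
  have pos: "a > 0" "b > 0" "c > 0"
    using False nn by (simp_all add: a_def b_def c_def order_less_le sum_nonneg)
  have "f x powr \<kappa> * g x powr \<mu> * h x powr \<nu> \<le>
      (a powr \<kappa> * b powr \<mu> * c powr \<nu>) * (\<kappa> * (f x / a) + \<mu> * (g x / b) + \<nu> * (h x / c))" if x: "x \<in> S" for x
  proof (cases "f x = 0 \<or> g x = 0 \<or> h x = 0")
    case True
    have "0 \<le> \<kappa> * (f x / a) + \<mu> * (g x / b) + \<nu> * (h x / c)"
      using nn x w pos by (intro add_nonneg_nonneg mult_nonneg_nonneg divide_nonneg_pos) auto
    then show ?thesis using True by auto
  next
    case F: False
    then have "f x > 0" "g x > 0" "h x > 0" using nn x by (simp_all add: order_less_le)
    then have "(f x / a) powr \<kappa> * (g x / b) powr \<mu> * (h x / c) powr \<nu> \<le>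
        \<kappa> * (f x / a) + \<mu> * (g x / b) + \<nu> * (h x / c)"
      using pos w by (intro weighted_am_gm3) auto
    then have "(a powr \<kappa> * b powr \<mu> * c powr \<nu>) * ((f x / a) powr \<kappa> * (g x / b) powr \<mu> * (h x / c) powr \<nu>) \<le>
        (a powr \<kappa> * b powr \<mu> * c powr \<nu>) * (\<kappa> * (f x / a) + \<mu> * (g x / b) + \<nu> * (h x / c))"
      by (intro mult_left_mono) auto
    moreover have "(a powr \<kappa> * b powr \<mu> * c powr \<nu>) * ((f x / a) powr \<kappa> * (g x / b) powr \<mu> * (h x / c) powr \<nu>) =
        f x powr \<kappa> * g x powr \<mu> * h x powr \<nu>"
      using pos \<open>f x > 0\<close> \<open>g x > 0\<close> \<open>h x > 0\<close> by (simp add: powr_divide)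
    ultimately show ?thesis by simp
  qed
  then have "(\<Sum>x\<in>S. f x powr \<kappa> * g x powr \<mu> * h x powr \<nu>) \<le>
      (\<Sum>x\<in>S. (a powr \<kappa> * b powr \<mu> * c powr \<nu>) * (\<kappa> * (f x / a) + \<mu> * (g x / b) + \<nu> * (h x / c)))"
    by (rule sum_mono)
  also have "\<dots> = (a powr \<kappa> * b powr \<mu> * c powr \<nu>) * (\<kappa> * (a / a) + \<mu> * (b / b) + \<nu> * (c / c))"
    by (simp add: a_def b_def c_def sum.distrib sum_distrib_left[symmetric] sum_divide_distrib[symmetric])
  also have "\<dots> = a powr \<kappa> * b powr \<mu> * c powr \<nu>" using pos w by simp
  finally show ?thesis by (simp add: a_def b_def c_def)
qed

text \<open>Hoelder's inequality against the constant one. Norms are parametrised by the reciprocal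
  of the exponent, in which interpolation is linear.\<close>

lemma sum_powr_le_card_powr:
  fixes x :: "'x \<Rightarrow> real"
  assumes "finite S" "\<And>s. s \<in> S \<Longrightarrow> x s \<ge> 0" "0 < b'" "b' \<le> b"
  shows "(\<Sum>s\<in>S. x s powr (1 / b)) powr b \<le> real (card S) powr (b - b') * (\<Sum>s\<in>S. x s powr (1 / b')) powr b'"
proof (cases "S = {}")
  case False
  have b: "b > 0" using assms by linarith
  have "(\<Sum>s\<in>S. x s powr (1 / b)) = (\<Sum>s\<in>S. (x s powr (1 / b')) powr (b' / b) * 1 powr (1 - b' / b) * 1 powr 0)"
    using assms b by (simp add: powr_powr)
  also have "\<dots> \<le> (\<Sum>s\<in>S. x s powr (1 / b')) powr (b' / b) * (\<Sum>s\<in>S. 1) powr (1 - b' / b) * (\<Sum>s\<in>S. 1) powr 0"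
    using assms b by (intro Holder_sum3) auto
  also have "\<dots> = (\<Sum>s\<in>S. x s powr (1 / b')) powr (b' / b) * real (card S) powr (1 - b' / b)"
    using False assms by (simp add: card_gt_0_iff)
  finally have "(\<Sum>s\<in>S. x s powr (1 / b)) powr b \<le>
      ((\<Sum>s\<in>S. x s powr (1 / b')) powr (b' / b) * real (card S) powr (1 - b' / b)) powr b"
    using b by (intro powr_mono2 sum_nonneg) auto
  also have "\<dots> = (\<Sum>s\<in>S. x s powr (1 / b')) powr b' * real (card S) powr (b - b')"
    using b by (simp add: powr_mult powr_powr sum_nonneg left_diff_distrib)
  finally show ?thesis by (simp add: mult.commute)
qed simp

text \<open>Each \<open>x s\<close> is at most the norm \<open>W powr a\<close>, so the excess
  exponent \<open>1 / a' - 1 / a\<close> can be estimated by that norm.\<close>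

lemma sum_powr_antimono:
  fixes x :: "'x \<Rightarrow> real"
  assumes "finite S" "\<And>s. s \<in> S \<Longrightarrow> x s \<ge> 0" "0 < a'" "a' \<le> a"
  shows "(\<Sum>s\<in>S. x s powr (1 / a')) powr a' \<le> (\<Sum>s\<in>S. x s powr (1 / a)) powr a"
proof -
  define W where "W = (\<Sum>s\<in>S. x s powr (1 / a))"
  have a: "a > 0" using assms by linarith
  have e: "1 / a' - 1 / a \<ge> 0" using assms by (simp add: field_simps)
  have W: "W \<ge> 0" unfolding W_def by (intro sum_nonneg) simp
  have "x s powr (1 / a') \<le> x s powr (1 / a) * W powr (a / a' - 1)" if s: "s \<in> S" for s
  proof -
    have "x s powr (1 / a) \<le> W" unfolding W_def by (rule member_le_sum) (use s assms in auto)
    then have "(x s powr (1 / a)) powr a \<le> W powr a" using a by (intro powr_mono2) auto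
    then have "x s \<le> W powr a" using a assms(2)[OF s] by (simp add: powr_powr)
    then have "x s powr (1 / a' - 1 / a) \<le> (W powr a) powr (1 / a' - 1 / a)"
      using e assms(2)[OF s] by (intro powr_mono2) auto
    also have "\<dots> = W powr (a / a' - 1)"
      using a by (simp add: powr_powr right_diff_distrib)
    finally have "x s powr (1 / a) * x s powr (1 / a' - 1 / a) \<le> x s powr (1 / a) * W powr (a / a' - 1)"
      by (intro mult_left_mono) auto
    moreover have "x s powr (1 / a) * x s powr (1 / a' - 1 / a) = x s powr (1 / a')"
      by (simp flip: powr_add)
    ultimately show ?thesis by simp
  qed
  then have "(\<Sum>s\<in>S. x s powr (1 / a')) \<le> (\<Sum>s\<in>S. x s powr (1 / a) * W powr (a / a' - 1))"
    by (rule sum_mono)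
  also have "\<dots> = W powr 1 * W powr (a / a' - 1)" using W by (simp add: sum_distrib_right[symmetric] W_def[symmetric])
  also have "\<dots> = W powr (a / a')" by (simp only: powr_add[symmetric]) simp
  finally have "(\<Sum>s\<in>S. x s powr (1 / a')) powr a' \<le> (W powr (a / a')) powr a'"
    using assms by (intro powr_mono2 sum_nonneg) auto
  also have "\<dots> = W powr a" using assms by (simp add: powr_powr)
  finally show ?thesis by (simp add: W_def)
qed

text \<open>With \<open>F = (F powr (u / N)) powr \<kappa> * 1 powr \<mu> * (F powr u) powr \<nu>\<close>, Hoelder's inequality on each
  line interpolates between the endpoint \<open>(N, N)\<close> and the trivial endpoints \<open>(\<infinity>, \<infinity>)\<close> and \<open>(1, \<infinity>)\<close>.
  Exponents outside the triangle spanned by these three are first moved to its boundary.\<close>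

lemma maximal_interpolation:
  fixes L :: "'d \<Rightarrow> 's \<Rightarrow> 'z" and F :: "'z \<Rightarrow> real" and K a b A :: real and N :: nat
  assumes fin: "finite \<Delta>" "finite S" "finite Z" and N: "N \<ge> 1" and K: "K \<ge> 1"
    and S: "card S \<ge> 1" and cardZ: "card Z = card S ^ N" and card\<Delta>: "card \<Delta> \<le> K * real (card S) ^ (N - 1)"
    and L: "\<And>D. D \<in> \<Delta> \<Longrightarrow> inj_on (L D) S" "\<And>D. D \<in> \<Delta> \<Longrightarrow> L D ` S \<subseteq> Z"
    and endpoint: "\<And>f. (\<And>z. f z \<ge> 0) \<Longrightarrow>
      (\<Sum>D\<in>\<Delta>. (\<Sum>s\<in>S. f (L D s)) ^ N) \<le> K * real (card S) ^ (N - 1) * (\<Sum>z\<in>Z. f z ^ N)"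
    and F: "\<And>z. F z \<ge> 0" and a: "0 < a" "a \<le> 1" and b: "0 < b" "b \<le> 1"
    and A: "(real N - 1) * b \<le> A" "1 - a \<le> A" "1 + (real N - 1) * b - real N * a \<le> A"
  shows "(\<Sum>D\<in>\<Delta>. (\<Sum>s\<in>S. F (L D s)) powr (1 / b)) powr b \<le>
    K * card S powr A * (\<Sum>z\<in>Z. F z powr (1 / a)) powr a"
proof -
  define q where "q = real (card S)"
  have q: "q \<ge> 1" using S by (simp add: q_def)
  \<comment> \<open>The pair \<open>(a', b')\<close> lies in the triangle
    \<open>b' \<le> a' \<le> 1 - (N - 1) * b'\<close>, whose vertices \<open>(1 / N, 1 / N)\<close>,
    \<open>(0, 0)\<close> and \<open>(1, 0)\<close> are the endpoints in reciprocal
    exponents.\<close>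
  define b' where "b' = min b (1 / N)"
  define a' where "a' = min (max a b') (1 - (real N - 1) * b')"
  have b': "0 < b'" "b' \<le> b" "N * b' \<le> 1" using b N by (auto simp: b'_def min_def field_simps)
  have a': "b' \<le> a'" "a' \<le> 1 - (real N - 1) * b'" using b' by (auto simp: a'_def left_diff_distrib)
  have a'pos: "a' > 0" using a' b' by linarith
  \<comment> \<open>Barycentric coordinates of \<open>(a', b')\<close> with respect to those
    vertices, in the same order.\<close>
  define \<kappa> \<mu> \<nu> where "\<kappa> = N * b'" and "\<mu> = 1 - (real N - 1) * b' - a'" and "\<nu> = a' - b'"
  have w: "\<kappa> \<ge> 0" "\<mu> \<ge> 0" "\<nu> \<ge> 0" "\<kappa> + \<mu> + \<nu> = 1"
    using a' b' by (auto simp: \<kappa>_def \<mu>_def \<nu>_def left_diff_distrib)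
  define T where "T D = (\<Sum>s\<in>S. F (L D s) powr (1 / a' / N))" for D
  define G where "G = (\<Sum>z\<in>Z. F z powr (1 / a'))"
  define c where "c = q powr \<mu> * G powr \<nu>"
  define m where "m D = (\<Sum>s\<in>S. F (L D s))" for D
  have nonneg: "T D \<ge> 0" "G \<ge> 0" "c \<ge> 0" "m D \<ge> 0" for D
    using F by (auto simp: T_def G_def c_def m_def intro!: sum_nonneg)
  have line: "m D \<le> T D powr \<kappa> * c" if D: "D \<in> \<Delta>" for D
  proof -
    have eq: "x = (x powr (1 / a' / N)) powr \<kappa> * 1 powr \<mu> * (x powr (1 / a')) powr \<nu>" if "x \<ge> 0" for x :: real
    proof (cases "x = 0")
      case False
      have "1 / a' / N * \<kappa> + 1 / a' * \<nu> = 1"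
        using N a'pos by (simp add: \<kappa>_def \<nu>_def field_simps)
      then show ?thesis using that False by (simp add: powr_powr flip: powr_add)
    qed simp
    have "m D = (\<Sum>s\<in>S. (F (L D s) powr (1 / a' / N)) powr \<kappa> * 1 powr \<mu> * (F (L D s) powr (1 / a')) powr \<nu>)"
      unfolding m_def using eq F by (intro sum.cong) auto
    also have "\<dots> \<le> T D powr \<kappa> * (\<Sum>s\<in>S. 1) powr \<mu> * (\<Sum>s\<in>S. F (L D s) powr (1 / a')) powr \<nu>"
      unfolding T_def using fin w by (intro Holder_sum3) auto
    also have "\<dots> \<le> T D powr \<kappa> * (\<Sum>s\<in>S. 1) powr \<mu> * G powr \<nu>"
    proof (intro mult_left_mono powr_mono2)
      have "(\<Sum>s\<in>S. F (L D s) powr (1 / a')) = (\<Sum>z\<in>L D ` S. F z powr (1 / a'))"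
        using L(1)[OF D] by (simp add: sum.reindex)
      also have "\<dots> \<le> G" unfolding G_def using L(2)[OF D] fin by (intro sum_mono2) auto
      finally show "(\<Sum>s\<in>S. F (L D s) powr (1 / a')) \<le> G" .
    qed (use w in \<open>auto intro!: sum_nonneg\<close>)
    finally show ?thesis by (simp add: c_def q_def mult.assoc)
  qed
  have "m D powr (1 / b') \<le> c powr (1 / b') * T D ^ N" if D: "D \<in> \<Delta>" for D
  proof -
    have "m D powr (1 / b') \<le> (T D powr \<kappa> * c) powr (1 / b')"
      using line[OF D] nonneg b' by (intro powr_mono2) auto
    also have "\<dots> = (T D powr \<kappa>) powr (1 / b') * c powr (1 / b')"
      using nonneg by (simp add: powr_mult)
    also have "(T D powr \<kappa>) powr (1 / b') = T D powr real N"
      using b' by (simp add: powr_powr \<kappa>_def)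
    also have "\<dots> = T D ^ N"
      using nonneg(1)[of D] N by (cases "T D = 0") (auto simp: powr_realpow)
    finally show ?thesis by (simp add: mult.commute)
  qed
  then have "(\<Sum>D\<in>\<Delta>. m D powr (1 / b')) \<le> (\<Sum>D\<in>\<Delta>. c powr (1 / b') * T D ^ N)"
    by (rule sum_mono)
  also have "\<dots> \<le> c powr (1 / b') * (K * q ^ (N - 1) * (\<Sum>z\<in>Z. (F z powr (1 / a' / N)) ^ N))"
    unfolding sum_distrib_left[symmetric] T_def using endpoint[of "\<lambda>z. F z powr (1 / a' / N)"]
    by (intro mult_left_mono) (auto simp: q_def)
  also have "(\<Sum>z\<in>Z. (F z powr (1 / a' / N)) ^ N) = G"
    unfolding G_def
  proof (intro sum.cong refl)
    fix z
    have "(F z powr (1 / a' / N)) ^ N = (F z powr (1 / a' / N)) powr N" if "F z \<noteq> 0"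
      using that by (intro powr_realpow[symmetric]) simp
    then show "(F z powr (1 / a' / N)) ^ N = F z powr (1 / a')"
      using N by (cases "F z = 0") (simp_all add: powr_powr)
  qed
  finally have "(\<Sum>D\<in>\<Delta>. m D powr (1 / b')) powr b' \<le> (c powr (1 / b') * (K * q ^ (N - 1) * G)) powr b'"
    using b' by (intro powr_mono2 sum_nonneg) auto
  also have "\<dots> = c * (K powr b' * q powr ((real N - 1) * b') * G powr b')"
    using nonneg b' q K N by (simp add: powr_mult powr_powr powr_realpow[symmetric] of_nat_diff)
  also have "\<dots> = K powr b' * q powr (\<mu> + (real N - 1) * b') * G powr a'"
    using q by (simp add: c_def powr_add mult_ac \<nu>_def flip: powr_add[of G])
  finally have inner: "(\<Sum>D\<in>\<Delta>. m D powr (1 / b')) powr b' \<le> K powr b' * q powr (\<mu> + (real N - 1) * b') * G powr a'" .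
  \<comment> \<open>Going from \<open>b'\<close> to the larger \<open>b\<close> lowers the exponent
    of the norm over directions and costs a power of \<open>card \<Delta>\<close>.\<close>
  have outer: "(\<Sum>D\<in>\<Delta>. m D powr (1 / b)) powr b \<le>
      (K powr (b - b') * q powr ((real N - 1) * (b - b'))) * (\<Sum>D\<in>\<Delta>. m D powr (1 / b')) powr b'"
  proof -
    have "real (card \<Delta>) powr (b - b') \<le> (K * q ^ (N - 1)) powr (b - b')"
      using card\<Delta> b' by (intro powr_mono2) (auto simp: q_def)
    also have "\<dots> = K powr (b - b') * q powr ((real N - 1) * (b - b'))"
      using K q N by (simp add: powr_mult powr_powr powr_realpow[symmetric] of_nat_diff)
    finally show ?thesis
      using sum_powr_le_card_powr[OF fin(1), of m b' b] nonneg b'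
      by (meson mult_right_mono order_trans powr_ge_zero)
  qed
  \<comment> \<open>A power of \<open>card Z\<close> is lost only if \<open>a < a'\<close>;
    otherwise the norms are monotone.\<close>
  have norm_change: "G powr a' \<le> q powr (N * max (a' - a) 0) * (\<Sum>z\<in>Z. F z powr (1 / a)) powr a"
  proof (cases "a \<le> a'")
    case True
    have "real (card Z) powr (a' - a) = q powr (N * max (a' - a) 0)"
      using q True by (simp add: cardZ q_def[symmetric] powr_powr flip: powr_realpow)
    then show ?thesis
      unfolding G_def using sum_powr_le_card_powr[OF fin(3), of F a a'] F a True by simp
  next
    case False
    then have "G powr a' \<le> (\<Sum>z\<in>Z. F z powr (1 / a)) powr a"
      unfolding G_def using F a'pos by (intro sum_powr_antimono[OF fin(3)]) auto
    then show ?thesis using False q by simp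
  qed
  \<comment> \<open>For \<open>b \<le> 1 / N\<close>, the left of the triangle gives
    \<open>1 + (N - 1) * b - N * a\<close>, the triangle itself \<open>1 - a\<close>, and its right
    \<open>(N - 1) * b\<close>. For larger \<open>b\<close> only the first and the last
    compete.\<close>
  have exponent: "\<mu> + (real N - 1) * b' + (N * max (a' - a) 0 + (real N - 1) * (b - b')) \<le> A"
  proof (cases "b \<le> 1 / N")
    case True
    then have bb: "b' = b" by (simp add: b'_def)
    have Nb: "real N * b \<le> 1" using b'(3) bb by simp
    consider "a < b" | "b \<le> a" "a \<le> 1 - (real N - 1) * b" | "1 - (real N - 1) * b < a" "b \<le> a" by linarith
    then show ?thesis
    proof cases
      case 1
      then have "a' = b" using Nb unfolding a'_def bb by (auto simp: left_diff_distrib)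
      then show ?thesis using A 1 by (simp add: \<mu>_def bb algebra_simps)
    next
      case 2
      then have "a' = a" unfolding a'_def bb by auto
      then show ?thesis using A by (simp add: \<mu>_def bb)
    next
      case 3
      then have "a' = 1 - (real N - 1) * b" unfolding a'_def bb by auto
      then show ?thesis using A 3 by (simp add: \<mu>_def bb)
    qed
  next
    case False
    then have bb: "b' = 1 / N" by (simp add: b'_def)
    have Nb: "real N * b' = 1" using N by (simp add: bb)
    then have aa: "a' = b'" using a' by (simp add: left_diff_distrib)
    have "N * max (a' - a) 0 = max (1 - N * a) 0"
      using Nb by (simp add: aa max_mult_distrib_left right_diff_distrib)
    then show ?thesis using A Nb unfolding aa \<mu>_def by (auto simp: algebra_simps max_def)
  qed
  have "(\<Sum>D\<in>\<Delta>. m D powr (1 / b)) powr b \<le>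
      (K powr (b - b') * q powr ((real N - 1) * (b - b'))) *
      (K powr b' * q powr (\<mu> + (real N - 1) * b') *
        (q powr (N * max (a' - a) 0) * (\<Sum>z\<in>Z. F z powr (1 / a)) powr a))"
    using inner norm_change by (intro order_trans[OF outer] mult_left_mono order_trans[OF inner]) auto
  also have "\<dots> = K powr ((b - b') + b') *
      q powr (\<mu> + (real N - 1) * b' + (N * max (a' - a) 0 + (real N - 1) * (b - b'))) *
      (\<Sum>z\<in>Z. F z powr (1 / a)) powr a"
    unfolding powr_add by (simp add: mult_ac)
  also have "\<dots> \<le> K * q powr A * (\<Sum>z\<in>Z. F z powr (1 / a)) powr a"
  proof (intro mult_right_mono mult_mono)
    show "K powr ((b - b') + b') \<le> K" using powr_mono[of b 1 K] K b by simp
    show "q powr (\<mu> + (real N - 1) * b' + (N * max (a' - a) 0 + (real N - 1) * (b - b'))) \<le> q powr A"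
      using exponent q by (intro powr_mono) auto
  qed (use K in auto)
  finally show ?thesis by (simp add: m_def q_def)
qed

section \<open>Norms with possibly infinite exponents and the upper bound\<close>

lemma exponent_cases:
  assumes "1 \<le> (u :: ennreal)"
  obtains "u = \<infinity>" "recip u = 0"
  | U where "u = ennreal U" "U \<ge> 1" "enn2real u = U" "recip u = 1 / U" "u \<noteq> \<infinity>"
proof (cases u)
  case (real U)
  then have "U \<ge> 1" using assms by (simp add: ennreal_ge_1)
  moreover have "recip u = 1 / U"
  proof -
    have "1 / u = ennreal (1 / U)"
      using divide_ennreal[of 1 U] real \<open>U \<ge> 1\<close> by simp
    then show ?thesis using \<open>U \<ge> 1\<close> by (simp add: recip_def)
  qed
  ultimately show ?thesis using real that(2)[of U] by simp
next
  case top
  then show ?thesis using that(1) by (simp add: recip_def)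
qed

lemma recip_bounds: "1 \<le> u \<Longrightarrow> 0 \<le> recip u \<and> recip u \<le> 1"
  by (erule exponent_cases[of u]) auto

lemma lp_norm_ge_const:
  fixes m :: "'x \<Rightarrow> real"
  assumes "1 \<le> v" "finite S" "T \<subseteq> S" "T \<noteq> {}" "c \<ge> 0" "\<And>x. x \<in> T \<Longrightarrow> c \<le> m x"
  shows "c * card T powr recip v \<le> lp_norm v S m"
  using assms(1)
proof (cases v rule: exponent_cases)
  case 1
  obtain x where x: "x \<in> T" using assms(4) by blast
  have "c \<le> norm (m x)" using assms(6)[OF x] by simp
  also have "\<dots> \<le> Max ((\<lambda>x. norm (m x)) ` S)" using x assms by (intro Max_ge) auto
  finally show ?thesis
    using 1 assms by (simp add: lp_norm_def card_gt_0_iff finite_subset)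
next
  case (2 V)
  have "real (card T) * c powr V = (\<Sum>x\<in>T. c powr V)" by simp
  also have "\<dots> \<le> (\<Sum>x\<in>T. norm (m x) powr V)"
    using assms(5) 2 by (intro sum_mono powr_mono2) (auto intro: order_trans[OF assms(6) abs_ge_self])
  also have "\<dots> \<le> (\<Sum>x\<in>S. norm (m x) powr V)" using assms by (intro sum_mono2) auto
  finally have "(real (card T) * c powr V) powr (1 / V) \<le> (\<Sum>x\<in>S. norm (m x) powr V) powr (1 / V)"
    using 2 by (intro powr_mono2) auto
  moreover have "(real (card T) * c powr V) powr (1 / V) = c * card T powr (1 / V)"
    using 2 assms(5) by (simp add: powr_mult powr_powr)
  ultimately show ?thesis using 2 by (simp add: lp_norm_def)
qed

lemma lp_norm_indicator_le:
  fixes F :: "'x \<Rightarrow> complex"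
  assumes "1 \<le> u" "finite S" "E \<subseteq> S" "E \<noteq> {}"
  shows "lp_norm u S (\<lambda>x. if x \<in> E then 1 else 0 :: complex) \<le> card E powr recip u"
  using assms(1)
proof (cases u rule: exponent_cases)
  case 1
  have "norm (if x \<in> E then 1 else 0 :: complex) \<le> 1" for x by simp
  then have "Max ((\<lambda>x. norm (if x \<in> E then 1 else 0 :: complex)) ` S) \<le> 1"
    using assms by (intro Max.boundedI) blast+
  then show ?thesis
    using 1 assms by (simp add: lp_norm_def card_gt_0_iff finite_subset)
next
  case (2 U)
  have "(\<Sum>x\<in>S. norm (if x \<in> E then 1 else 0 :: complex) powr U) = (\<Sum>x\<in>S. if x \<in> E then 1 else 0)"
    using 2 by (intro sum.cong) auto
  also have "\<dots> = card E"
    using assms by (simp add: sum.If_cases Int_absorb1)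
  finally show ?thesis using 2 by (simp add: lp_norm_def)
qed

context field
begin

lemma fibre_sup_nonneg:
  assumes "finite (carrier R)"
  shows "fibre_sup R n F z \<ge> 0"
proof -
  obtain x y where "split_vecs n z = (x, y)" by (cases "split_vecs n z")
  then show ?thesis
    using norm_le_fibre_sup[OF assms zero_closed, of n z x y F] by (meson norm_ge_zero order_trans)
qed

lemma fibre_sup_attained:
  assumes "finite (carrier R)" "z \<in> {..<2 * n} \<rightarrow>\<^sub>E carrier R"
  shows "\<exists>t\<in>carrier R. fibre_sup R n F z = norm (F (fst (split_vecs n z), snd (split_vecs n z), t))"
proof -
  have "fibre_sup R n F z \<in> (\<lambda>t. norm (F (fst (split_vecs n z), snd (split_vecs n z), t))) ` carrier R"
    unfolding fibre_sup_def using assms(1) by (intro Max_in) auto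
  then show ?thesis by auto
qed

lemma split_vecs_in_heisenberg:
  "z \<in> {..<2 * n} \<rightarrow>\<^sub>E carrier R \<Longrightarrow> t \<in> carrier R \<Longrightarrow>
    (fst (split_vecs n z), snd (split_vecs n z), t) \<in> carrier (heisenberg R n)"
  by (drule split_vecs_closed) (simp add: heisenberg_def mem_Times_iff)

text \<open>A maximising \<open>t\<close> over each \<open>z\<close> embeds the projected space into
  the group, so the left side is a partial sum of the right.\<close>

lemma sum_fibre_sup_le:
  assumes fin: "finite (carrier R)"
  shows "(\<Sum>z\<in>{..<2 * n} \<rightarrow>\<^sub>E carrier R. fibre_sup R n F z powr U) \<le>
    (\<Sum>x\<in>carrier (heisenberg R n). norm (F x) powr U)"
proof -
  let ?Z = "{..<2 * n} \<rightarrow>\<^sub>E carrier R"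
  have "\<forall>z\<in>?Z. \<exists>t. t \<in> carrier R \<and>
      fibre_sup R n F z = norm (F (fst (split_vecs n z), snd (split_vecs n z), t))"
    using fibre_sup_attained[OF fin] by blast
  then obtain t where t: "\<And>z. z \<in> ?Z \<Longrightarrow> t z \<in> carrier R \<and>
      fibre_sup R n F z = norm (F (fst (split_vecs n z), snd (split_vecs n z), t z))"
    unfolding bchoice_iff by blast
  define h where "h z = (fst (split_vecs n z), snd (split_vecs n z), t z)" for z
  have inj: "inj_on h ?Z"
  proof (rule inj_onI)
    fix z z' assume z: "z \<in> ?Z" "z' \<in> ?Z" "h z = h z'"
    from z(3) have "split_vecs n z = split_vecs n z'"
      unfolding h_def prod.inject by (intro prod_eqI) blast+
    then have "join_vecs n (split_vecs n z) = join_vecs n (split_vecs n z')" by (rule arg_cong)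
    then show "z = z'" unfolding join_vecs_split_vecs[OF z(1)] join_vecs_split_vecs[OF z(2)] .
  qed
  have "(\<Sum>z\<in>?Z. fibre_sup R n F z powr U) = (\<Sum>z\<in>?Z. norm (F (h z)) powr U)"
    using t by (intro sum.cong) (auto simp: h_def)
  also have "\<dots> = (\<Sum>x\<in>h ` ?Z. norm (F x) powr U)" by (simp add: sum.reindex[OF inj])
  also have "\<dots> \<le> (\<Sum>x\<in>carrier (heisenberg R n). norm (F x) powr U)"
    using t split_vecs_in_heisenberg finite_heisenberg[OF fin]
    by (intro sum_mono2) (auto simp: h_def)
  finally show ?thesis .
qed

lemma maximal_op_nonneg:
  assumes "finite (carrier R)"
  shows "maximal_op R n F D \<ge> 0"
  using maximal_op_attained[OF assms, of n F D] by (auto intro!: sum_nonneg)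

text \<open>For finite \<open>u\<close> and \<open>v\<close> this is
  \<open>maximal_interpolation\<close> with \<open>N = 2 * n\<close>. That result requires positive
  reciprocals, so infinite exponents are handled by Hoelder on a single line or by the trivial bound
  times the number of directions.\<close>

lemma maximal_op_bound:
  assumes fin: "finite (carrier R)" and n: "n \<ge> 1" and u: "1 \<le> u" and v: "1 \<le> v"
    and A: "(2 * real n - 1) * recip v \<le> A" "1 - recip u \<le> A"
      "1 + (2 * real n - 1) * recip v - 2 * real n * recip u \<le> A"
    and ne: "directions R n \<noteq> {}"
  shows "lp_norm v (directions R n) (maximal_op R n F) \<le>
    real (2 * n * kakeya_const (2 * n - 1)) * real (card (carrier R)) powr A *
      lp_norm u (carrier (heisenberg R n)) F"
proof -
  let ?Z = "{..<2 * n} \<rightarrow>\<^sub>E carrier R" and ?\<Delta> = "directions R n" and ?H = "carrier (heisenberg R n)"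
  let ?q = "card (carrier R)" and ?f = "fibre_sup R n F"
  define K where "K = real (2 * n * kakeya_const (2 * n - 1))"
  define U where "U = lp_norm u ?H F"
  have q: "?q \<ge> 1" using fin by (simp add: Suc_le_eq card_gt_0_iff) blast
  have kak: "kakeya_const (2 * n - 1) \<ge> 1" using n by (simp add: kakeya_const_def)
  have "2 * n * 1 \<le> 2 * n * kakeya_const (2 * n - 1)" using kak by (rule mult_le_mono2)
  then have K2n: "real (2 * n) \<le> K" unfolding K_def by (metis of_nat_le_iff mult_1_right)
  then have K: "K \<ge> 1" using n by simp
  obtain L where L: "\<And>D. D \<in> ?\<Delta> \<Longrightarrow> inj_on (L D) (carrier R)" "\<And>D. D \<in> ?\<Delta> \<Longrightarrow> L D ` carrier R \<subseteq> ?Z"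
      "\<And>D. D \<in> ?\<Delta> \<Longrightarrow> maximal_op R n F D \<le> (\<Sum>s\<in>carrier R. ?f (L D s))"
    and key: "\<And>f. (\<And>z. 0 \<le> f z) \<Longrightarrow> (\<Sum>D\<in>?\<Delta>. (\<Sum>s\<in>carrier R. f (L D s)) ^ (2 * n)) \<le>
        K * real ?q ^ (2 * n - 1) * (\<Sum>z\<in>?Z. f z ^ (2 * n))"
    using maximal_op_linearization(2)[OF fin n, of F] unfolding K_def by blast
  have "card ?\<Delta> \<le> 2 * n * ?q ^ (2 * n - 1)"
    by (rule maximal_op_linearization(1)[OF fin n])
  then have "real (card ?\<Delta>) \<le> real (2 * n) * real ?q ^ (2 * n - 1)"
    by (metis of_nat_le_iff of_nat_mult of_nat_power)
  also have "\<dots> \<le> K * real ?q ^ (2 * n - 1)" using K2n by (rule mult_right_mono) simp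
  finally have card\<Delta>: "real (card ?\<Delta>) \<le> K * real ?q ^ (2 * n - 1)" .
  have cardZ: "card ?Z = ?q ^ (2 * n)" by (simp add: card_PiE)
  have finZ: "finite ?Z" using fin by (intro finite_PiE) auto
  have fin\<Delta>: "finite ?\<Delta>" by (rule finite_directions[OF fin])
  have f0: "?f z \<ge> 0" for z by (rule fibre_sup_nonneg[OF fin])
  have m0: "maximal_op R n F D \<ge> 0" for D by (rule maximal_op_nonneg[OF fin])
  have Ufin: "(\<Sum>z\<in>?Z. ?f z powr (1 / (1 / r))) powr (1 / r) \<le> U" if "u = ennreal r" "r \<ge> 1" for r
  proof -
    have "(\<Sum>z\<in>?Z. ?f z powr r) powr (1 / r) \<le> (\<Sum>x\<in>?H. norm (F x) powr r) powr (1 / r)"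
      using that by (intro powr_mono2 sum_fibre_sup_le[OF fin] sum_nonneg) auto
    then show ?thesis using that by (simp add: U_def lp_norm_def)
  qed
  have Uinf: "?f z \<le> U" if ui: "u = \<infinity>" and z: "z \<in> ?Z" for z
  proof -
    obtain t where "t \<in> carrier R" "?f z = norm (F (fst (split_vecs n z), snd (split_vecs n z), t))"
      using fibre_sup_attained[OF fin z] by blast
    then show ?thesis
      unfolding U_def lp_norm_def using ui z finite_heisenberg[OF fin] split_vecs_in_heisenberg
      by (auto intro!: Max_ge)
  qed
  have m_inf: "maximal_op R n F D \<le> ?q * U" if "u = \<infinity>" "D \<in> ?\<Delta>" for D
  proof -
    have "(\<Sum>s\<in>carrier R. ?f (L D s)) \<le> (\<Sum>s\<in>carrier R. U)"
      using L(2)[OF that(2)] Uinf[OF that(1)] by (intro sum_mono) auto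
    then show ?thesis using L(3)[OF that(2)] by simp
  qed
  have "lp_norm v ?\<Delta> (maximal_op R n F) \<le> K * real ?q powr A * U"
    using v
  proof (cases v rule: exponent_cases)
    case v: 1
    have "maximal_op R n F D \<le> K * real ?q powr A * U" if D: "D \<in> ?\<Delta>" for D
    proof -
      have "maximal_op R n F D \<le> ?q powr (1 - recip u) * U"
        using u
      proof (cases u rule: exponent_cases)
        case 1
        then show ?thesis using m_inf[OF _ D] q by simp
      next
        case (2 r)
        have "maximal_op R n F D \<le> (\<Sum>s\<in>carrier R. ?f (L D s) powr (1 / 1)) powr 1"
          using L(3)[OF D] f0 by (simp add: sum_nonneg)
        also have "\<dots> \<le> ?q powr (1 - 1 / r) * (\<Sum>s\<in>carrier R. ?f (L D s) powr (1 / (1 / r))) powr (1 / r)"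
          using f0 2 by (intro sum_powr_le_card_powr[OF fin]) auto
        also have "\<dots> \<le> ?q powr (1 - 1 / r) * (\<Sum>z\<in>?Z. ?f z powr (1 / (1 / r))) powr (1 / r)"
        proof (intro mult_left_mono powr_mono2)
          have "(\<Sum>s\<in>carrier R. ?f (L D s) powr (1 / (1 / r))) = (\<Sum>z\<in>L D ` carrier R. ?f z powr (1 / (1 / r)))"
            using L(1)[OF D] by (simp add: sum.reindex)
          also have "\<dots> \<le> (\<Sum>z\<in>?Z. ?f z powr (1 / (1 / r)))"
            using L(2)[OF D] finZ by (intro sum_mono2) auto
          finally show "(\<Sum>s\<in>carrier R. ?f (L D s) powr (1 / (1 / r))) \<le> (\<Sum>z\<in>?Z. ?f z powr (1 / (1 / r)))" .
        qed (use 2 in \<open>auto intro: sum_nonneg\<close>)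
        also have "\<dots> \<le> ?q powr (1 - 1 / r) * U"
          using Ufin 2 by (intro mult_left_mono) auto
        finally show ?thesis using 2 by simp
      qed
      also have "\<dots> \<le> (K * ?q powr A) * U"
      proof (rule mult_right_mono)
        have "?q powr (1 - recip u) \<le> 1 * ?q powr A" using q A by (simp add: powr_mono)
        also have "\<dots> \<le> K * ?q powr A" using K by (intro mult_right_mono) auto
        finally show "?q powr (1 - recip u) \<le> K * ?q powr A" .
        \<comment> \<open>For \<open>u = \<infinity>\<close> the sign of the maximum
          \<open>U\<close> is deduced from the operator bound \<open>m_inf\<close>.\<close>
        show "U \<ge> 0"
          using u
        proof (cases u rule: exponent_cases)
          case 1
          have "0 \<le> ?q * U" using m0[of D] m_inf[OF 1(1) D] by linarith
          then show ?thesis using q by (simp add: zero_le_mult_iff)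
        qed (simp add: U_def lp_norm_def)
      qed
      finally show ?thesis .
    qed
    then have "Max ((\<lambda>D. norm (maximal_op R n F D)) ` ?\<Delta>) \<le> K * real ?q powr A * U"
      using fin\<Delta> ne m0 by (intro Max.boundedI) auto
    then show ?thesis using v by (simp add: lp_norm_def)
  next
    case v: (2 V)
    have lp: "lp_norm v ?\<Delta> (maximal_op R n F) = (\<Sum>D\<in>?\<Delta>. maximal_op R n F D powr V) powr (1 / V)"
      using v m0 by (simp add: lp_norm_def)
    show ?thesis
      using u
    proof (cases u rule: exponent_cases)
      case 1
      obtain D0 where D0: "D0 \<in> ?\<Delta>" using ne by blast
      have "0 \<le> ?q * U" using m0[of D0] m_inf[OF 1(1) D0] by linarith
      then have U0: "U \<ge> 0" using q by (simp add: zero_le_mult_iff)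
      have "(\<Sum>D\<in>?\<Delta>. maximal_op R n F D powr V) \<le> (\<Sum>D\<in>?\<Delta>. (?q * U) powr V)"
        using m0 m_inf[OF 1(1)] v by (intro sum_mono powr_mono2) auto
      also have "\<dots> \<le> (K * real ?q ^ (2 * n - 1)) * (?q * U) powr V"
        using card\<Delta> by (simp add: mult_right_mono)
      finally have "(\<Sum>D\<in>?\<Delta>. maximal_op R n F D powr V) powr (1 / V) \<le>
          ((K * real ?q ^ (2 * n - 1)) * (?q * U) powr V) powr (1 / V)"
        using v by (intro powr_mono2 sum_nonneg) auto
      also have "\<dots> = K powr (1 / V) * ?q powr ((2 * real n - 1) / V) * (?q * U)"
        using K q v n U0 by (simp add: powr_mult powr_powr powr_realpow[symmetric] of_nat_diff)
      also have "\<dots> = K powr (1 / V) * ?q powr (1 + (2 * real n - 1) / V) * U"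
        using q by (simp add: powr_add)
      also have "\<dots> \<le> K * ?q powr A * U"
      proof (intro mult_right_mono mult_mono U0)
        show "K powr (1 / V) \<le> K" using powr_mono[of "1 / V" 1 K] K v by simp
        show "?q powr (1 + (2 * real n - 1) / V) \<le> ?q powr A"
          using A(3) q 1 v by (intro powr_mono) auto
      qed (use K in auto)
      finally show ?thesis using lp by simp
    next
      case (2 r)
      have "(\<Sum>D\<in>?\<Delta>. maximal_op R n F D powr V) \<le>
          (\<Sum>D\<in>?\<Delta>. (\<Sum>s\<in>carrier R. ?f (L D s)) powr V)"
        using L(3) m0 v by (intro powr_mono2 sum_mono) auto
      then have "(\<Sum>D\<in>?\<Delta>. maximal_op R n F D powr V) powr (1 / V) \<le>
          (\<Sum>D\<in>?\<Delta>. (\<Sum>s\<in>carrier R. ?f (L D s)) powr (1 / (1 / V))) powr (1 / V)"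
        using v by (simp add: powr_mono2 sum_nonneg)
      also have "\<dots> \<le> K * ?q powr A * (\<Sum>z\<in>?Z. ?f z powr (1 / (1 / r))) powr (1 / r)"
        using n K q card\<Delta> cardZ f0 2 v A
        by (intro maximal_interpolation[OF fin\<Delta> fin finZ _ _ _ cardZ _ L(1,2) key]) auto
      also have "\<dots> \<le> K * ?q powr A * U"
        using Ufin 2 K by (intro mult_left_mono) auto
      finally show ?thesis using lp by simp
    qed
  qed
  then show ?thesis by (simp add: K_def U_def)
qed

end

subsection \<open>Test functions and the optimal exponent\<close>

context field
begin

text \<open>Vectors with first coordinate one are proportional only if equal, so one affine chart
  already provides this many directions.\<close>

lemma card_directions_ge:
  assumes fin: "finite (carrier R)" and n: "n \<ge> 1"
  shows "card (carrier R) ^ (2 * n - 1) \<le> card (directions R n)"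
proof -
  let ?I = "{..<2 * n}" and ?J = "{1..<2 * n}"
  define z where "z w = (\<lambda>i\<in>?I. if i = 0 then \<one> else w i)" for w :: "nat \<Rightarrow> 'a"
  define V where "V w = split_vecs n (z w)" for w
  define cls where "cls w = proportional R n `` {V w}" for w
  have z: "z w \<in> ?I \<rightarrow>\<^sub>E carrier R" if "w \<in> ?J \<rightarrow>\<^sub>E carrier R" for w
    using that by (auto simp: z_def PiE_iff)
  have V0: "fst (V w) 0 = \<one>" for w
    using n by (simp add: V_def split_vecs_def z_def)
  have V: "V w \<in> nonzero_vecs R n" if "w \<in> ?J \<rightarrow>\<^sub>E carrier R" for w
  proof -
    have "V w \<noteq> (vec_zero R n, vec_zero R n)"
    proof
      assume "V w = (vec_zero R n, vec_zero R n)"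
      then have "fst (V w) 0 = \<zero>" using n by (simp add: vec_zero_def)
      then show False using V0[of w] by simp
    qed
    then show ?thesis
      using split_vecs_closed[OF z[OF that]] by (simp add: nonzero_vecs_def V_def)
  qed
  have "inj_on cls (?J \<rightarrow>\<^sub>E carrier R)"
  proof (rule inj_onI)
    fix w w' assume w: "w \<in> ?J \<rightarrow>\<^sub>E carrier R" "w' \<in> ?J \<rightarrow>\<^sub>E carrier R" and eq: "cls w = cls w'"
    obtain a b where ab: "V w = (a, b)" by (cases "V w")
    obtain a' b' where ab': "V w' = (a', b')" by (cases "V w'")
    have "(V w, V w') \<in> proportional R n"
      using eq V[OF w(2)] unfolding cls_def by (rule eq_equiv_class[OF _ equiv_proportional])
    then obtain c where c: "c \<in> carrier R" "a' = vec_smult R n c a" "b' = vec_smult R n c b"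
      unfolding ab ab' proportional_def by blast
    have "a' 0 = c \<otimes> a 0" using n c(2) by (simp add: vec_smult_def)
    then have "c = \<one>" using V0[of w] V0[of w'] ab ab' c(1) by simp
    moreover have "a \<in> vecs R n" "b \<in> vecs R n" using V[OF w(1)] ab by (auto simp: nonzero_vecs_def)
    ultimately have "V w = V w'" using c vec_smult_one[OF field_axioms] ab ab' by metis
    then have "join_vecs n (split_vecs n (z w)) = join_vecs n (split_vecs n (z w'))"
      unfolding V_def by (rule arg_cong)
    then have eqz: "z w = z w'"
      unfolding join_vecs_split_vecs[OF z[OF w(1)]] join_vecs_split_vecs[OF z[OF w(2)]] .
    show "w = w'"
    proof (rule PiE_ext[OF w])
      fix i assume "i \<in> ?J"
      then show "w i = w' i" using fun_cong[OF eqz, of i] by (simp add: z_def)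
    qed
  qed
  moreover have "cls ` (?J \<rightarrow>\<^sub>E carrier R) \<subseteq> directions R n"
    using V by (auto simp: cls_def directions_def intro: quotientI)
  ultimately have "card (?J \<rightarrow>\<^sub>E carrier R) \<le> card (directions R n)"
    using finite_directions[OF fin] by (intro card_inj_on_le)
  then show ?thesis by (simp add: card_PiE)
qed

text \<open>Both dot products with the zero vector vanish, so the line stays in the slice of central
  coordinate zero.\<close>

lemma line_through_origin:
  assumes "a \<in> vecs R n" "b \<in> vecs R n"
  shows "line_through R n (vec_zero R n, vec_zero R n, \<zero>) (a, b) =
    (\<lambda>s. (vec_smult R n s a, vec_smult R n s b, \<zero>)) ` carrier R"
proof -
  have add: "vec_add R n (vec_zero R n) x = x" if "x \<in> vecs R n" for x
    using that by (intro extensionalityI[of _ "{..<n}"])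
      (auto simp: vecs_def vec_add_def vec_zero_def PiE_iff)
  have dot: "vec_dot R n (vec_zero R n) x = \<zero>" if "x \<in> vecs R n" for x
    unfolding vec_dot_def
    by (rule add.finprod_one_eqI) (use that in \<open>auto simp: vec_zero_def vecs_def PiE_iff\<close>)
  have "(vec_zero R n, vec_zero R n, \<zero>) \<otimes>\<^bsub>heisenberg R n\<^esub> (vec_smult R n s a, vec_smult R n s b, \<zero>) =
      (vec_smult R n s a, vec_smult R n s b, \<zero>)" if "s \<in> carrier R" for s
    using assms that by (simp add: heisenberg_def add dot vec_smult_closed minus_eq)
  moreover have "line_through R n (vec_zero R n, vec_zero R n, \<zero>) (a, b) =
      (\<lambda>s. (vec_zero R n, vec_zero R n, \<zero>) \<otimes>\<^bsub>heisenberg R n\<^esub> (vec_smult R n s a, vec_smult R n s b, \<zero>)) ` carrier R"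
    unfolding line_through_def by auto
  ultimately show ?thesis by simp
qed

lemma card_line_through_origin:
  assumes "v \<in> nonzero_vecs R n" "i < 2 * n" "join_vecs n v i = \<one>"
  shows "card (line_through R n (vec_zero R n, vec_zero R n, \<zero>) v) = card (carrier R)"
proof -
  obtain a b where ab: "v = (a, b)" by (cases v)
  have vec: "a \<in> vecs R n" "b \<in> vecs R n" using assms(1) unfolding ab nonzero_vecs_def by auto
  have "inj_on (\<lambda>s. (vec_smult R n s a, vec_smult R n s b, \<zero>)) (carrier R)"
  proof (rule inj_onI)
    fix s s' assume s: "s \<in> carrier R" "s' \<in> carrier R"
      and eq: "(vec_smult R n s a, vec_smult R n s b, \<zero>) = (vec_smult R n s' a, vec_smult R n s' b, \<zero>)"
    have smult: "join_vecs n (vec_smult R n s a, vec_smult R n s b) i = s \<otimes> join_vecs n v i" for s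
      using assms(2) by (auto simp: join_vecs_def ab vec_smult_def)
    have "s \<otimes> join_vecs n v i = s' \<otimes> join_vecs n v i"
      using eq smult[of s] smult[of s'] by simp
    then show "s = s'" using s assms(3) by simp
  qed
  then show ?thesis
    unfolding ab line_through_origin[OF vec] by (rule card_image)
qed

lemma origin_in_heisenberg: "(vec_zero R n, vec_zero R n, \<zero>) \<in> carrier (heisenberg R n)"
  by (auto simp: heisenberg_def vecs_def vec_zero_def)

lemma maximal_op_ge:
  assumes fin: "finite (carrier R)" and "p \<in> carrier (heisenberg R n)" "finite (horizontal_line R n p D)"
  shows "real (card (horizontal_line R n p D \<inter> E)) \<le> maximal_op R n (\<lambda>x. if x \<in> E then 1 else 0) D"
proof -
  have "real (card (horizontal_line R n p D \<inter> E)) =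
      (\<Sum>x\<in>horizontal_line R n p D. if x \<in> E then 1 else 0)"
    using assms(3) by (simp add: sum.If_cases)
  also have "\<dots> = (\<Sum>x\<in>horizontal_line R n p D. norm (if x \<in> E then 1 else 0 :: complex))"
    by (intro sum.cong) auto
  also have "\<dots> \<le> maximal_op R n (\<lambda>x. if x \<in> E then 1 else 0) D"
    unfolding maximal_op_def using finite_heisenberg[OF fin] assms(2) by (intro Max_ge) auto
  finally show ?thesis .
qed

end

text \<open>Common frame of the three examples: the indicator of \<open>E\<close>, tested on the
  lines through the origin in the directions \<open>T\<close>.\<close>

lemma admissible_exponent_test:
  fixes R :: "int ring"
  assumes adm: "\<And>F :: int heis \<Rightarrow> complex. lp_norm v (directions R n) (maximal_op R n F)
      \<le> C * real q powr A * lp_norm u (carrier (heisenberg R n)) F"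
    and R: "field R" "card (carrier R) = q" "q > 0" and C: "C > 0" and uv: "1 \<le> u" "1 \<le> v"
    and E: "E \<subseteq> carrier (heisenberg R n)" "E \<noteq> {}" "T \<subseteq> directions R n" "T \<noteq> {}"
    and c: "\<And>D. D \<in> T \<Longrightarrow> c \<le> card (horizontal_line R n (vec_zero R n, vec_zero R n, \<zero>\<^bsub>R\<^esub>) D \<inter> E)"
  shows "real c * card T powr recip v \<le> C * q powr A * card E powr recip u"
proof -
  interpret field R by fact
  have fin: "finite (carrier R)" using R by (metis card.infinite less_irrefl)
  let ?F = "\<lambda>x. if x \<in> E then 1 else 0 :: complex"
  have "real c \<le> maximal_op R n ?F D" if "D \<in> T" for D
  proof -
    let ?l = "horizontal_line R n (vec_zero R n, vec_zero R n, \<zero>\<^bsub>R\<^esub>) D"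
    obtain v where "?l = line_through R n (vec_zero R n, vec_zero R n, \<zero>\<^bsub>R\<^esub>) v"
      using direction_representative[of D n] E(3) \<open>D \<in> T\<close> by blast
    then have "finite ?l" using fin by (simp add: line_through_def)
    then have "real (card (?l \<inter> E)) \<le> maximal_op R n ?F D"
      by (rule maximal_op_ge[OF fin origin_in_heisenberg])
    then show ?thesis using c[OF that] by linarith
  qed
  then have "real c * card T powr recip v \<le> lp_norm v (directions R n) (maximal_op R n ?F)"
    using E finite_directions[OF fin] uv by (intro lp_norm_ge_const) auto
  also have "\<dots> \<le> C * real q powr A * lp_norm u (carrier (heisenberg R n)) ?F" by (rule adm)
  also have "\<dots> \<le> C * real q powr A * card E powr recip u"
    using C E finite_heisenberg[OF fin] uv by (intro mult_left_mono lp_norm_indicator_le) auto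
  finally show ?thesis .
qed

text \<open>Otherwise \<open>p powr (B - A)\<close> would stay below \<open>C\<close> along
  arbitrarily large primes.\<close>

lemma exponent_le_of_primes:
  fixes A B C :: real
  assumes "\<And>p::nat. prime p \<Longrightarrow> odd p \<Longrightarrow> real p powr B \<le> C * real p powr A"
  shows "B \<le> A"
proof (rule ccontr)
  assume "\<not> B \<le> A"
  then have d: "B - A > 0" by simp
  \<comment> \<open>\<open>C\<close> is an arbitrary real here, while extracting the root needs a
    positive base.\<close>
  define M where "M = max C 1"
  obtain p :: nat where p: "prime p" "p > max 2 (nat \<lceil>M powr (1 / (B - A))\<rceil>)"
    using bigger_prime by blast
  then have "odd p" using prime_odd_nat by auto
  then have "real p powr B \<le> C * real p powr A" using assms p by blast
  moreover have "real p powr B = real p powr (B - A) * real p powr A"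
    by (simp flip: powr_add)
  ultimately have "real p powr (B - A) \<le> C"
    using p by (simp add: prime_gt_0_nat)
  moreover have "M powr (1 / (B - A)) < real p"
    using p(2) by linarith
  then have "(M powr (1 / (B - A))) powr (B - A) < real p powr (B - A)"
    using d by (intro powr_less_mono2) auto
  then have "M < real p powr (B - A)"
    using d by (simp add: powr_powr M_def)
  ultimately show False by (simp add: M_def)
qed

lemma admissible_exponent_lower_bounds:
  assumes adm: "admissible_exponent n u v A" and n: "n \<ge> 1" and u: "1 \<le> u" and v: "1 \<le> v"
  shows "(2 * real n - 1) * recip v \<le> A" "1 - recip u \<le> A"
    "1 + (2 * real n - 1) * recip v - 2 * real n * recip u \<le> A"
proof -
  obtain C where C: "C > 0" and bound: "\<And>q (R :: int ring) (F :: int heis \<Rightarrow> complex).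
      primepow q \<Longrightarrow> odd q \<Longrightarrow> field R \<Longrightarrow> card (carrier R) = q \<Longrightarrow>
       lp_norm v (directions R n) (maximal_op R n F)
         \<le> C * real q powr A * lp_norm u (carrier (heisenberg R n)) F"
    using adm unfolding admissible_exponent_def by blast
  have tests: "real p powr ((2 * real n - 1) * recip v) \<le> C * real p powr A \<and>
      real p powr (1 - recip u) \<le> C * real p powr A \<and>
      real p powr (1 + (2 * real n - 1) * recip v - 2 * real n * recip u) \<le> C * real p powr A"
    if p: "prime p" "odd p" for p :: nat
  proof -
    \<comment> \<open>The prime field realised on the integers from \<open>0\<close> to
      \<open>p - 1\<close>, as \<open>R\<close> must be a ring on \<open>int\<close>.\<close>
    define R where "R = residue_ring (int p)"
    have p1: "p > 1" using p(1) by (rule prime_gt_1_nat)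
    have "residues_prime p" using p(1) by (rule residues_prime.intro)
    then interpret field R unfolding R_def by (rule residues_prime.is_field)
    have "carrier R = {0..int p - 1}" by (simp add: R_def residue_ring_def)
    then have card: "card (carrier R) = p" and fin: "finite (carrier R)" by simp_all
    let ?o = "(vec_zero R n, vec_zero R n, \<zero>\<^bsub>R\<^esub>)" and ?\<Delta> = "directions R n"
    have "\<And>F :: int heis \<Rightarrow> complex. lp_norm v ?\<Delta> (maximal_op R n F)
         \<le> C * real p powr A * lp_norm u (carrier (heisenberg R n)) F"
      using p card field_axioms by (intro bound) auto
    note test = admissible_exponent_test[OF this field_axioms card _ C u v]
    have card\<Delta>: "real p powr (2 * real n - 1) \<le> card ?\<Delta>"
    proof -
      have "real (p ^ (2 * n - 1)) \<le> card ?\<Delta>"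
        using card_directions_ge[OF fin n] by (simp only: card of_nat_le_iff)
      moreover have "real (p ^ (2 * n - 1)) = real p powr (2 * real n - 1)"
        using p1 n by (simp add: powr_realpow[symmetric] of_nat_diff)
      ultimately show ?thesis by linarith
    qed
    moreover have "real p powr (2 * real n - 1) > 0" using p1 by simp
    ultimately have "card ?\<Delta> > 0" by linarith
    then have ne: "?\<Delta> \<noteq> {}" by auto
    have card\<Delta>': "real p powr ((2 * real n - 1) * recip v) \<le> card ?\<Delta> powr recip v"
      using powr_mono2[OF _ _ card\<Delta>, of "recip v"] recip_bounds[OF v] by (simp add: powr_powr)
    have line: "\<exists>l. horizontal_line R n ?o D = l \<and> card l = p \<and> ?o \<in> l \<and>
        l \<subseteq> vecs R n \<times> vecs R n \<times> {\<zero>\<^bsub>R\<^esub>}" if D: "D \<in> ?\<Delta>" for D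
    proof -
      obtain i w where iw: "i < 2 * n" "w \<in> nonzero_vecs R n" "join_vecs n w i = \<one>\<^bsub>R\<^esub>"
        "horizontal_line R n ?o D = line_through R n ?o w"
        using direction_representative[OF D] by blast
      obtain a b where ab: "w = (a, b)" by (cases w)
      have vec: "a \<in> vecs R n" "b \<in> vecs R n" using iw(2) unfolding ab nonzero_vecs_def by auto
      have l: "line_through R n ?o w = (\<lambda>s. (vec_smult R n s a, vec_smult R n s b, \<zero>\<^bsub>R\<^esub>)) ` carrier R"
        unfolding ab by (rule line_through_origin[OF vec])
      have "vec_smult R n \<zero>\<^bsub>R\<^esub> x = vec_zero R n" if "x \<in> vecs R n" for x
        using that by (auto simp: vec_smult_def vec_zero_def vecs_def PiE_iff intro!: restrict_ext)
      then have "?o \<in> line_through R n ?o w"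
        unfolding l using vec by (intro image_eqI[of _ _ "\<zero>\<^bsub>R\<^esub>"]) auto
      moreover have "line_through R n ?o w \<subseteq> vecs R n \<times> vecs R n \<times> {\<zero>\<^bsub>R\<^esub>}"
        unfolding l using vec by (auto intro: vec_smult_closed)
      ultimately show ?thesis
        using card_line_through_origin[OF iw(2,1,3)] iw(4) card by auto
    qed
    have sub: "vecs R n \<times> vecs R n \<times> {\<zero>\<^bsub>R\<^esub>} \<subseteq> carrier (heisenberg R n)"
      by (auto simp: heisenberg_def)
    have vz: "vec_zero R n \<in> vecs R n" by (auto simp: vecs_def vec_zero_def)
    \<comment> \<open>A single point: the function has norm one and the operator is at least one in
      every direction.\<close>
    have "real 1 * card ?\<Delta> powr recip v \<le> C * p powr A * card {?o} powr recip u"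
    proof (rule test)
      fix D assume "D \<in> ?\<Delta>"
      then have "horizontal_line R n ?o D \<inter> {?o} = {?o}" using line by auto
      then show "1 \<le> card (horizontal_line R n ?o D \<inter> {?o})" by simp
    qed (use p1 ne origin_in_heisenberg in auto)
    then have 1: "real p powr ((2 * real n - 1) * recip v) \<le> C * real p powr A"
      using card\<Delta>' by simp
    obtain D0 where D0: "D0 \<in> ?\<Delta>" using ne by blast
    obtain l where l: "horizontal_line R n ?o D0 = l" "card l = p" "?o \<in> l"
        "l \<subseteq> vecs R n \<times> vecs R n \<times> {\<zero>\<^bsub>R\<^esub>}"
      using line[OF D0] by blast
    \<comment> \<open>One line, tested in its own direction only: value at least \<open>p\<close>
      against norm at most \<open>p powr recip u\<close>.\<close>
    have "real p * card {D0} powr recip v \<le> C * p powr A * card l powr recip u"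
      by (rule test) (use p1 D0 l sub in auto)
    then have "real p powr 1 \<le> C * p powr A * p powr recip u"
      using l(2) p1 by simp
    moreover have "real p powr 1 = real p powr (1 - recip u) * p powr recip u"
      by (simp flip: powr_add)
    ultimately have "real p powr (1 - recip u) * p powr recip u \<le> C * real p powr A * p powr recip u"
      by linarith
    then have 2: "real p powr (1 - recip u) \<le> C * real p powr A"
      by (rule mult_right_le_imp_le) (use p1 in simp)
    have cv: "card (vecs R n) = p ^ n" by (simp add: vecs_def card_PiE card)
    have cE: "card (vecs R n \<times> vecs R n \<times> {\<zero>\<^bsub>R\<^esub>}) = p ^ (2 * n)"
      by (simp add: card_cartesian_product cv mult_2 power_add)
    \<comment> \<open>The slice of central coordinate zero has \<open>p ^ (2 * n)\<close> points and
      contains a full line in every direction.\<close>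
    have line_union: "real p * card ?\<Delta> powr recip v \<le> C * p powr A * card (vecs R n \<times> vecs R n \<times> {\<zero>\<^bsub>R\<^esub>}) powr recip u"
    proof (rule test)
      fix D assume "D \<in> ?\<Delta>"
      then obtain l where "horizontal_line R n ?o D = l" "card l = p" "l \<subseteq> vecs R n \<times> vecs R n \<times> {\<zero>\<^bsub>R\<^esub>}"
        using line by blast
      then show "p \<le> card (horizontal_line R n ?o D \<inter> (vecs R n \<times> vecs R n \<times> {\<zero>\<^bsub>R\<^esub>}))"
        by (simp add: Int_absorb2)
    qed (use p1 ne sub vz in auto)
    have dirs: "real p * real p powr ((2 * real n - 1) * recip v) \<le> real p * card ?\<Delta> powr recip v"
      using card\<Delta>' by (intro mult_left_mono) auto
    have split: "real p * real p powr ((2 * real n - 1) * recip v) =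
        real p powr (1 + (2 * real n - 1) * recip v - 2 * real n * recip u) * real p powr (2 * real n * recip u)"
      using p1 by (simp add: powr_add[symmetric] powr_mult_base)
    have size: "real (p ^ (2 * n)) powr recip u = real p powr (2 * real n * recip u)"
      using p1 by (simp add: powr_realpow[symmetric] powr_powr)
    have "real p powr (1 + (2 * real n - 1) * recip v - 2 * real n * recip u) * real p powr (2 * real n * recip u)
        \<le> C * p powr A * real p powr (2 * real n * recip u)"
      using order_trans[OF dirs line_union] unfolding cE split size .
    then have "real p powr (1 + (2 * real n - 1) * recip v - 2 * real n * recip u) \<le> C * real p powr A"
      by (rule mult_right_le_imp_le) (use p1 in simp)
    then show ?thesis using 1 2 by blast
  qed
  show "(2 * real n - 1) * recip v \<le> A"
    by (rule exponent_le_of_primes[where C=C]) (use tests in blast)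
  show "1 - recip u \<le> A"
    by (rule exponent_le_of_primes[where C=C]) (use tests in blast)
  show "1 + (2 * real n - 1) * recip v - 2 * real n * recip u \<le> A"
    by (rule exponent_le_of_primes[where C=C]) (use tests in blast)
qed

lemma admissible_exponent_upper_bound:
  assumes n: "n \<ge> 1" and uv: "1 \<le> u" "1 \<le> v"
    and A: "(2 * real n - 1) * recip v \<le> A" "1 - recip u \<le> A"
      "1 + (2 * real n - 1) * recip v - 2 * real n * recip u \<le> A"
  shows "admissible_exponent n u v A"
  unfolding admissible_exponent_def
proof (intro conjI exI[of _ "real (2 * n * kakeya_const (2 * n - 1))"] allI impI)
  show "0 \<le> A" using A(2) recip_bounds[OF uv(1)] by linarith
  show "0 < real (2 * n * kakeya_const (2 * n - 1))"
    using n by (simp add: kakeya_const_def)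
  fix q :: nat and R :: "int ring" and F :: "int heis \<Rightarrow> complex"
  assume *: "primepow q \<and> odd q \<and> field R \<and> card (carrier R) = q"
  then interpret field R by blast
  have q: "q > 0" using * by (auto simp: primepow_gt_0_nat)
  then have fin: "finite (carrier R)" using * by (metis card.infinite less_irrefl)
  have "q ^ (2 * n - 1) \<le> card (directions R n)"
    using card_directions_ge[OF fin n] * by simp
  moreover have "q ^ (2 * n - 1) > 0" using q by simp
  ultimately have "directions R n \<noteq> {}" by (metis card.empty not_le)
  then show "lp_norm v (directions R n) (maximal_op R n F)
      \<le> real (2 * n * kakeya_const (2 * n - 1)) * real q powr A * lp_norm u (carrier (heisenberg R n)) F"
    using maximal_op_bound[OF fin n uv A] * by simp
qed

theorem theorem1p5:
  fixes n :: nat and u v :: ennreal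
  assumes "n \<ge> 1" and "1 \<le> u" and "1 \<le> v"
  shows "admissible_exponent n u v (optimal_exponent n u v) \<and>
    (\<forall>A. admissible_exponent n u v A \<longrightarrow> optimal_exponent n u v \<le> A) \<and>
    optimal_exponent n u v =
      Max {(2 * real n - 1) * recip v,
           1 - recip u,
           1 + (2 * real n - 1) * recip v - 2 * real n * recip u}"
proof -
  define M where "M = Max {(2 * real n - 1) * recip v, 1 - recip u,
    1 + (2 * real n - 1) * recip v - 2 * real n * recip u}"
  have adm: "admissible_exponent n u v M"
    unfolding M_def by (rule admissible_exponent_upper_bound[OF assms]) simp_all
  have least: "M \<le> A" if "admissible_exponent n u v A" for A
    using admissible_exponent_lower_bounds[OF that assms] by (simp add: M_def)
  \<comment> \<open>\<open>M\<close> is itself admissible, so the \<open>LEAST\<close> over the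
    reals is attained.\<close>
  have "optimal_exponent n u v = M"
    unfolding optimal_exponent_def using adm least by (rule Least_equality)
  then show ?thesis using adm least by (simp add: M_def)
qed

end
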